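(* Let $v_0\in\mathcal{A}_+\cup\mathcal{A}_-$, let $v(x,t)=(S_tv_0)(x)$, and let $\lambda_1(x,t)\ge\lambda_2(x,t)\ge\lambda_3(x,t)$ be the eigenvalues of the deformation tensor associated with $v(x,t)$, for $t\in(0,T(v_0))$. Define $$\varepsilon(x,t)=\frac{|\lambda_2(x,t)|}{\lambda(x,t)}\qquad\forall (x,t)\in\mathbb{T}^3\times(0,T(v_0)),$$ where $$\lambda(x,t)=\begin{cases}\lambda_1(x,t) & \text{if } v_0\in\mathcal{A}_+,\\ -\lambda_3(x,t) & \text{if } v_0\in\mathcal{A}_-.\end{cases}$$ Then there exists a constant $C=C(v_0,|\Omega|)$ (independent of $t$), with $|\Omega|$ denoting the volume of the box $\Omega=\mathbb{T}^3$, such that $$\inf_{(x,s)\in\mathbb{T}^3\times(0,t)}\varepsilon(x,s)<\frac{C}{\sqrt{t}}\qquad\forall t\in(0,T(v_0)).$$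
   Context: $\mathbb{T}^3$ is the 3D periodic box (all functions are periodic in space). Fix an integer $m>5/2$. $H^m(\mathbb{T}^3)$ is the standard $L^2$-based Sobolev space and $\mathbb{H}^m_\sigma=\{u\in[H^m(\mathbb{T}^3)]^3 : \operatorname{div} u=0\}$. The Euler equations are $$\frac{\partial v}{\partial t}+(v\cdot\nabla)v=-\nabla p,\qquad \operatorname{div} v=0,\qquad v(x,0)=v_0(x).$$ For $v_0\in\mathbb{H}^m_\sigma$, $T_*(v_0)$ is the maximal time of unique existence of a solution in $\mathbb{H}^m_\sigma$ (i.e. $v\in C([0,T_*(v_0));\mathbb{H}^m_\sigma)$), and $S_t$ is the solution operator $v_0\mapsto v(t)=S_tv_0$ for $0\le t<T_*(v_0)$. For a differentiable vector field $f=(f_1,f_2,f_3)$ on $\mathbb{T}^3$, $\lambda_1(f)\ge\lambda_2(f)\ge\lambda_3(f)$ denote the eigenvalues (scalar fields on $\mathbb{T}^3$) of the deformation tensor $\frac12\left(\frac{\partial f_j}{\partial x_i}+\frac{\partial f_i}{\partial x_j}\right)_{i,j}$. Define $$\mathcal{A}_+=\{f\in\mathbb{H}^m_\sigma : \inf_{x\in\mathbb{T}^3}\lambda_2(f)(x)>0\},\qquad \mathcal{A}_-=\{f\in\mathbb{H}^m_\sigma : \sup_{x\in\mathbb{T}^3}\lambda_2(f)(x)<0\}.$$ For $f\in\mathcal{A}_+$, $$T(f)=\inf\{t\in(0,T_*(f)) : \exists x\in\mathbb{T}^3\text{ such that }\lambda_2(S_tf)(x)<0\},$$ and for $f\in\mathcal{A}_-$,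 $$T(f)=\inf\{t\in(0,T_*(f)) : \exists x\in\mathbb{T}^3\text{ such that }\lambda_2(S_tf)(x)>0\},$$ with $T(f)=T_*(f)$ if the corresponding set is empty. At any point where $\lambda(x,t)=0$ (so that also $\lambda_2(x,t)=0$), $\varepsilon(x,t)$ is taken to be $0$. *)

theory Defs
  imports "HOL-Analysis.Analysis"
begin

text \<open>
  The periodic box with side \<open>L\<close> is the torus of side \<open>L\<close> in each coordinate direction.
  Functions on it are represented by \<open>L\<close>-periodic functions on \<open>real^3\<close>, so that a point of the
  torus is any point of \<open>real^3\<close>; integrals are taken over the fundamental cell \<open>box_cell L\<close>.
\<close>

definition box_cell :: "real \<Rightarrow> (real^3) set" where
  "box_cell L = cbox 0 (vec L)"

definition box_volume :: "real \<Rightarrow> real" where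
  "box_volume L = measure lborel (box_cell L)"

definition box_periodic :: "real \<Rightarrow> (real^3 \<Rightarrow> 'a) \<Rightarrow> bool" where
  "box_periodic L f \<longleftrightarrow> (\<forall>x i. f (x + L *\<^sub>R axis i 1) = f x)"


subsection \<open>Sobolev spaces\<close>

definition wave_vector :: "real \<Rightarrow> int^3 \<Rightarrow> real^3" where
  "wave_vector L k = (\<chi> i. 2 * pi * of_int (k $ i) / L)"

definition fourier_coeff :: "real \<Rightarrow> (real^3 \<Rightarrow> real) \<Rightarrow> int^3 \<Rightarrow> complex" where
  "fourier_coeff L f k =
     (LINT x:box_cell L|lborel. complex_of_real (f x) * cis (- (wave_vector L k \<bullet> x)))
       / complex_of_real (box_volume L)"

definition sobolev_term :: "nat \<Rightarrow> real \<Rightarrow> (real^3 \<Rightarrow> real) \<Rightarrow> int^3 \<Rightarrow> real" where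
  "sobolev_term m L f k =
     (1 + (norm (wave_vector L k))\<^sup>2) ^ m * (cmod (fourier_coeff L f k))\<^sup>2"

definition sobolev :: "nat \<Rightarrow> real \<Rightarrow> (real^3 \<Rightarrow> real) set" where
  "sobolev m L = {f. f \<in> borel_measurable borel \<and> box_periodic L f \<and>
     set_integrable lborel (box_cell L) (\<lambda>x. (f x)\<^sup>2) \<and>
     sobolev_term m L f summable_on UNIV}"

definition sobolev_norm :: "nat \<Rightarrow> real \<Rightarrow> (real^3 \<Rightarrow> real^3) \<Rightarrow> real" where
  "sobolev_norm m L u = sqrt (\<Sum>i\<in>UNIV. \<Sum>\<^sub>\<infinity>k\<in>UNIV. sobolev_term m L (\<lambda>x. u x $ i) k)"

text \<open>
  The elements of \<open>sobolev\<close> are functions, not classes modulo null sets. For \<open>m > 5/2\<close> every class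
  has exactly one continuous representative, which is continuously differentiable by the Sobolev
  embedding; the solenoidal space below consists of these representatives, so the derivatives
  of its elements are classical.
\<close>

definition sobolev_solenoidal :: "nat \<Rightarrow> real \<Rightarrow> (real^3 \<Rightarrow> real^3) set" where
  "sobolev_solenoidal m L = {u. (\<forall>i. (\<lambda>x. u x $ i) \<in> sobolev m L) \<and>
     continuous_on UNIV u \<and> (\<forall>x. trace (jacobian u (at x)) = 0)}"


subsection \<open>The Euler equations\<close>

definition time_interval :: "ereal \<Rightarrow> real set" where
  "time_interval T = {t. 0 \<le> t \<and> ereal t < T}"

text \<open>
  \<open>v t x\<close> is the velocity at time \<open>t\<close>, \<open>p\<close> the pressure and \<open>g\<close> its spatial gradient;
  \<open>jacobian (v t) (at x) *v v t x\<close> is \<open>(v \<cdot> \<nabla>)v\<close>. The time derivative is one-sided at \<open>t = 0\<close>.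
  For \<open>m > 5/2\<close>, every distributional solution that is continuous in time with values in
  the Sobolev space is a classical one with continuous pressure gradient.
\<close>

definition euler_solution ::
  "nat \<Rightarrow> real \<Rightarrow> (real^3 \<Rightarrow> real^3) \<Rightarrow> ereal \<Rightarrow> (real \<Rightarrow> real^3 \<Rightarrow> real^3) \<Rightarrow> bool" where
  "euler_solution m L v0 T v \<longleftrightarrow>
     v 0 = v0 \<and>
     (\<forall>t\<in>time_interval T. v t \<in> sobolev_solenoidal m L) \<and>
     (\<forall>t\<in>time_interval T.
        ((\<lambda>s. sobolev_norm m L (\<lambda>x. v s x - v t x)) \<longlongrightarrow> 0) (at t within time_interval T)) \<and>
     (\<exists>(p :: real \<Rightarrow> real^3 \<Rightarrow> real) (g :: real \<Rightarrow> real^3 \<Rightarrow> real^3).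
        (\<forall>t\<in>time_interval T. box_periodic L (p t) \<and> (\<forall>x. GDERIV (p t) x :> g t x)) \<and>
        continuous_on (time_interval T \<times> UNIV) (\<lambda>(t, x). g t x) \<and>
        (\<forall>t\<in>time_interval T. \<forall>x.
           ((\<lambda>s. v s x) has_vector_derivative - (jacobian (v t) (at x) *v v t x) - g t x)
             (at t within time_interval T)))"

definition unique_euler_solution :: "nat \<Rightarrow> real \<Rightarrow> (real^3 \<Rightarrow> real^3) \<Rightarrow> ereal \<Rightarrow> bool" where
  "unique_euler_solution m L v0 T \<longleftrightarrow>
     (\<exists>v. euler_solution m L v0 T v \<and>
       (\<forall>w. euler_solution m L v0 T w \<longrightarrow> (\<forall>t\<in>time_interval T. w t = v t)))"

definition max_time :: "nat \<Rightarrow> real \<Rightarrow> (real^3 \<Rightarrow> real^3) \<Rightarrow> ereal" where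
  "max_time m L v0 = Sup {T. 0 < T \<and> unique_euler_solution m L v0 T}"

text \<open>
  The solution operator, meaningful for \<open>0 \<le> t < max_time m L v0\<close>. The supremum in
  \<open>max_time\<close> is attained (solutions on smaller intervals glue by uniqueness), so the
  description below is proper there.
\<close>

definition sol_op :: "nat \<Rightarrow> real \<Rightarrow> real \<Rightarrow> (real^3 \<Rightarrow> real^3) \<Rightarrow> (real^3 \<Rightarrow> real^3)" where
  "sol_op m L t v0 = (THE u. \<exists>v. euler_solution m L v0 (max_time m L v0) v \<and> u = v t)"


subsection \<open>The deformation tensor\<close>

definition deformation :: "(real^3 \<Rightarrow> real^3) \<Rightarrow> real^3 \<Rightarrow> real^3^3" where
  "deformation f x = (1/2) *\<^sub>R (jacobian f (at x) + transpose (jacobian f (at x)))"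

text \<open>
  The eigenvalues of a symmetric matrix in decreasing order, repeated according to
  multiplicity, i.e. as roots of the characteristic polynomial.
\<close>

definition ordered_eigenvalues :: "real^3^3 \<Rightarrow> real^3" where
  "ordered_eigenvalues A = (THE l. l $ 1 \<ge> l $ 2 \<and> l $ 2 \<ge> l $ 3 \<and>
     (\<forall>z. det (mat z - A) = (z - l $ 1) * (z - l $ 2) * (z - l $ 3)))"

definition eig :: "3 \<Rightarrow> (real^3 \<Rightarrow> real^3) \<Rightarrow> real^3 \<Rightarrow> real" where
  "eig i f x = ordered_eigenvalues (deformation f x) $ i"

definition A_plus :: "nat \<Rightarrow> real \<Rightarrow> (real^3 \<Rightarrow> real^3) set" where
  "A_plus m L = {f \<in> sobolev_solenoidal m L. (INF x. eig 2 f x) > 0}"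

definition A_minus :: "nat \<Rightarrow> real \<Rightarrow> (real^3 \<Rightarrow> real^3) set" where
  "A_minus m L = {f \<in> sobolev_solenoidal m L. (SUP x. eig 2 f x) < 0}"

definition sign_change_times :: "nat \<Rightarrow> real \<Rightarrow> (real^3 \<Rightarrow> real^3) \<Rightarrow> real set" where
  "sign_change_times m L f = {t. 0 < t \<and> ereal t < max_time m L f \<and>
     (\<exists>x. if f \<in> A_plus m L then eig 2 (sol_op m L t f) x < 0
          else eig 2 (sol_op m L t f) x > 0)}"

definition sign_time :: "nat \<Rightarrow> real \<Rightarrow> (real^3 \<Rightarrow> real^3) \<Rightarrow> ereal" where
  "sign_time m L f =
     (if sign_change_times m L f = {} then max_time m L f
      else Inf (ereal ` sign_change_times m L f))"

definition lambda_main :: "nat \<Rightarrow> real \<Rightarrow> (real^3 \<Rightarrow> real^3) \<Rightarrow> real^3 \<Rightarrow> real \<Rightarrow> real" where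
  "lambda_main m L v0 x t =
     (if v0 \<in> A_plus m L then eig 1 (sol_op m L t v0) x else - eig 3 (sol_op m L t v0) x)"

text \<open>The convention that the ratio is \<open>0\<close> where the denominator vanishes is that of division.\<close>

definition eps_ratio :: "nat \<Rightarrow> real \<Rightarrow> (real^3 \<Rightarrow> real^3) \<Rightarrow> real^3 \<Rightarrow> real \<Rightarrow> real" where
  "eps_ratio m L v0 x t = \<bar>eig 2 (sol_op m L t v0) x\<bar> / lambda_main m L v0 x t"

end

theory Submission
  imports Defs
begin

text \<open>
  With \<open>A\<close> the velocity gradient and \<open>S\<close> its symmetric part, the enstrophy \<open>y(t) = \<integral> |S|\<^sup>2\<close> satisfies
  \<open>y' = -4 \<integral> det S\<close>. Since \<open>S\<close> is trace free, \<open>|det S| = \<epsilon> (1 + \<epsilon>) \<lambda>\<^sup>3\<close> and \<open>|S|\<^sup>2 \<le> 6 \<lambda>\<^sup>2\<close>,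
  so a lower bound \<open>e\<close> for \<open>\<epsilon>\<close> on \<open>(0, t)\<close> yields \<open>y' \<ge> \<kappa> e y\<^bsup>3/2\<^esup>\<close> for \<open>v0 \<in> A_plus\<close> and
  \<open>y' \<le> - \<kappa> e y\<^bsup>3/2\<^esup>\<close> for \<open>v0 \<in> A_minus\<close>. In the first case \<open>y\<close> would blow up, in the second it
  would fall below the positive lower bound which the conservation of energy and momentum and
  the Poincare inequality provide, unless \<open>e t \<le> K\<close>. As \<open>\<epsilon> \<le> 1\<close>, this gives \<open>e \<le> sqrt (K / t)\<close>.

  The solution is merely \<open>C\<^sup>1\<close> in space, so neither the vorticity equation nor integration by
  parts is available directly. Every identity is therefore first proved for finite
  differences, where it only uses that integrals over the cell are invariant under
  translations, and then transferred to the limit of step size zero.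
\<close>


section \<open>The cell, difference quotients and null Lagrangians\<close>

text \<open>The rate of the enstrophy first appears as minus the integral of tr(A^T A A). Two null
  Lagrangians bring it into the stated form: for trace-free A one has tr(A^T A A) = 4 det S - det A
  and |S|^2 = |A|^2 / 2 - \<open>minors2 A\<close>, and both \<open>det A\<close> and
  \<open>minors2 A\<close> integrate to zero over the torus. Differentiating the enstrophy in time
  directly would need second derivatives in space. Hence the identity for difference quotients is
  integrated over time before the step size tends to zero, and the derivative is recovered from the
  continuous integrand. Energy alone does not bound the enstrophy from below, since a constant mean
  flow carries energy but no strain; this is why the conserved momentum is subtracted. All
  regularity rests on one lattice sum: an integer m > 5/2 is at least 3, and the inverse square of
  \<open>weight\<close> is summable over the lattice in dimension three, which makes the Fourier
  series of a field and of its gradient absolutely convergent.\<close>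

lemma box_periodic_compose:
  assumes "box_periodic L f"
  shows "box_periodic L (\<lambda>x. F (f x))"
  using assms by (simp add: box_periodic_def)

lemma box_periodic_compose2:
  assumes "box_periodic L f" "box_periodic L g"
  shows "box_periodic L (\<lambda>x. F (f x) (g x))"
  using assms by (simp add: box_periodic_def)

lemma box_periodic_shift:
  assumes "box_periodic L f"
  shows "box_periodic L (\<lambda>x. f (x + a))"
proof -
  have "f (x + L *\<^sub>R axis i 1 + a) = f (x + a)" for x i
    using assms[unfolded box_periodic_def, rule_format, of "x + a" i] by (simp add: algebra_simps)
  then show ?thesis by (simp add: box_periodic_def)
qed

lemma box_periodic_nat:
  assumes "box_periodic L f"
  shows "f (x + (real n * L) *\<^sub>R axis i 1) = f x"
proof (induction n)
  case (Suc n)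
  have "x + (real (Suc n) * L) *\<^sub>R axis i 1 = (x + (real n * L) *\<^sub>R axis i 1) + L *\<^sub>R axis i 1"
    by (simp add: algebra_simps)
  then show ?case using Suc assms by (metis box_periodic_def)
qed simp

lemma box_periodic_int:
  assumes "box_periodic L f"
  shows "f (x + (of_int k * L) *\<^sub>R axis i 1) = f x"
proof (cases k)
  case (nonneg n)
  then show ?thesis using box_periodic_nat[OF assms, of x n i] by simp
next
  case (neg n)
  then show ?thesis
    using box_periodic_nat[OF assms, of "x + (of_int k * L) *\<^sub>R axis i 1" "Suc n" i]
    by (simp add: add.assoc flip: scaleR_add_left distrib_right)
qed

text \<open>The plane \<open>x $ i = L\<close> cuts the shifted cell into the part of the original
  cell with \<open>x $ i \<ge> s\<close> and the translate by one period of the part with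
  \<open>x $ i \<le> s\<close>; periodicity moves the latter back.\<close>

lemma cell_axis_shift:
  fixes f :: "real^3 \<Rightarrow> 'b::banach"
  assumes "continuous_on UNIV f" "box_periodic L f" "0 \<le> s" "s \<le> L"
  shows "integral (box_cell L) (\<lambda>x. f (x + s *\<^sub>R axis i 1)) = integral (box_cell L) f"
proof -
  let ?e = "axis i 1 :: real^3"
  define b1 where "b1 = (\<chi> j. if j = i then s else L)"
  define a2 where "a2 = (\<chi> j. if j = i then s else 0)"
  have e: "?e \<in> Basis" by (simp add: axis_in_Basis_iff)
  have ie: "x \<bullet> ?e = x $ i" for x by (simp add: inner_axis)
  have int: "f integrable_on cbox a b" for a b
    using assms(1) by (intro integrable_continuous) (auto intro: continuous_on_subset)
  have 1: "cbox 0 (vec L) \<inter> {x. x \<bullet> ?e \<le> s} = cbox 0 b1"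
    using assms(3,4)
    apply (auto simp: mem_box_cart b1_def inner_axis split: if_splits)
    by (metis order_trans)
  have 2: "cbox 0 (vec L) \<inter> {x. x \<bullet> ?e \<ge> s} = cbox a2 (vec L)"
    using assms(3,4)
    apply (auto simp: mem_box_cart a2_def inner_axis split: if_splits)
    by (metis order_trans)
  have 3: "cbox (s *\<^sub>R ?e) (vec L + s *\<^sub>R ?e) \<inter> {x. x \<bullet> ?e \<le> L} = cbox a2 (vec L)"
    using assms(3,4)
    apply (simp only: ie)
    apply (simp add: mem_box_cart a2_def axis_def set_eq_iff)
    apply (intro allI iffI conjI; (elim conjE)?)
    apply (smt (verit))+
    done
  have 4: "cbox (s *\<^sub>R ?e) (vec L + s *\<^sub>R ?e) \<inter> {x. x \<bullet> ?e \<ge> L} = cbox (0 + L *\<^sub>R ?e) (b1 + L *\<^sub>R ?e)"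
    using assms(3,4)
    apply (simp only: ie)
    apply (simp add: mem_box_cart b1_def axis_def set_eq_iff)
    apply (intro allI iffI conjI; (elim conjE)?)
    apply (smt (verit))+
    done
  have per: "(\<lambda>x. f (L *\<^sub>R ?e + x)) = f"
    using assms(2) by (auto simp: box_periodic_def add.commute)
  have 5: "integral (cbox (0 + L *\<^sub>R ?e) (b1 + L *\<^sub>R ?e)) f = integral (cbox 0 b1) f"
    using integral_shift_cbox_plus[of 0 b1 f "L *\<^sub>R ?e"] per by (simp add: o_def)
  have "integral (box_cell L) (\<lambda>x. f (x + s *\<^sub>R ?e)) = integral (cbox (s *\<^sub>R ?e) (vec L + s *\<^sub>R ?e)) f"
    using integral_shift_cbox_plus[of 0 "vec L" f "s *\<^sub>R ?e"] by (simp add: o_def box_cell_def add.commute)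
  also have "\<dots> = integral (cbox a2 (vec L)) f + integral (cbox 0 b1) f"
    using integral_split[OF int e, of "s *\<^sub>R ?e" "vec L + s *\<^sub>R ?e" L] 3 4 5 by simp
  also have "\<dots> = integral (box_cell L) f"
    using integral_split[OF int e, of 0 "vec L" s] 1 2 by (simp add: box_cell_def)
  finally show ?thesis .
qed

lemma cell_shift:
  fixes f :: "real^3 \<Rightarrow> 'b::banach"
  assumes "continuous_on UNIV f" "box_periodic L f" "L > 0"
  shows "integral (box_cell L) (\<lambda>x. f (x + a)) = integral (box_cell L) f"
proof -
  have ax: "integral (box_cell L) (\<lambda>x. g (x + r *\<^sub>R axis i 1)) = integral (box_cell L) g"
    if g: "continuous_on UNIV g" "box_periodic L g" for g :: "real^3 \<Rightarrow> 'b" and r i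
  proof -
    \<comment> \<open>Whole periods are split off, which leaves a shift between 0 and L as
      \<open>cell_axis_shift\<close> requires.\<close>
    define k where "k = \<lfloor>r / L\<rfloor>"
    define s where "s = r - of_int k * L"
    have s: "0 \<le> s" "s \<le> L"
      using assms(3) floor_divide_lower[of L r] floor_divide_upper[of L r] by (auto simp: s_def k_def algebra_simps)
    have "g (x + r *\<^sub>R axis i 1) = g (x + s *\<^sub>R axis i 1)" for x
      using box_periodic_int[OF g(2), of "x + s *\<^sub>R axis i 1" k i] by (simp add: s_def algebra_simps)
    then show ?thesis using cell_axis_shift[OF g s] by simp
  qed
  have c: "continuous_on UNIV (\<lambda>x. f (x + b))" for b
    by (rule continuous_on_compose2[OF assms(1)]) (auto intro!: continuous_intros)
  define a23 where "a23 = (a$2 *\<^sub>R axis 2 1 + a$3 *\<^sub>R axis 3 1 :: real^3)"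
  have a: "a = a$1 *\<^sub>R axis 1 1 + a23"
    by (simp add: vec_eq_iff forall_3 axis_def a23_def)
  have "integral (box_cell L) (\<lambda>x. f (x + a)) = integral (box_cell L) (\<lambda>x. f (x + a$1 *\<^sub>R axis 1 1 + a23))"
    by (metis a add.assoc)
  also have "\<dots> = integral (box_cell L) (\<lambda>x. f (x + a23))"
    by (rule ax[OF c box_periodic_shift[OF assms(2)]])
  also have "\<dots> = integral (box_cell L) (\<lambda>x. f (x + a$2 *\<^sub>R axis 2 1 + a$3 *\<^sub>R axis 3 1))"
    by (simp add: a23_def add.assoc)
  also have "\<dots> = integral (box_cell L) (\<lambda>x. f (x + a$3 *\<^sub>R axis 3 1))"
    by (rule ax[OF c box_periodic_shift[OF assms(2)]])
  also have "\<dots> = integral (box_cell L) f"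
    by (rule ax[OF assms(1,2)])
  finally show ?thesis .
qed

lemma cell_shift_diff:
  fixes f :: "real^3 \<Rightarrow> real"
  assumes "continuous_on UNIV f" "box_periodic L f" "L > 0"
  shows "integral (box_cell L) (\<lambda>x. f (x + a) - f x) = 0"
proof -
  have "continuous_on UNIV (\<lambda>x. f (x + a))"
    by (rule continuous_on_compose2[OF assms(1)]) (auto intro!: continuous_intros)
  then have "(\<lambda>x. f (x + a)) integrable_on box_cell L" "f integrable_on box_cell L"
    using assms(1) unfolding box_cell_def
    by (auto intro!: integrable_continuous intro: continuous_on_subset)
  then show ?thesis using cell_shift[OF assms] by (simp add: integral_diff)
qed

section \<open>Gradients as limits of difference quotients\<close>

lemma continuous_eq_at_0:
  fixes F G :: "real \<Rightarrow> real"
  assumes "continuous_on {0..1} F" "continuous_on {0..1} G" "\<And>h. 0 < h \<Longrightarrow> h \<le> 1 \<Longrightarrow> F h = G h"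
  shows "F 0 = G 0"
proof -
  have *: "at (0::real) within {0..1} \<noteq> bot"
    by (simp add: trivial_limit_within islimpt_Icc)
  have F: "(F \<longlongrightarrow> F 0) (at 0 within {0..1})" and G: "(G \<longlongrightarrow> G 0) (at 0 within {0..1})"
    using assms(1,2) by (auto simp: continuous_on_def)
  have "eventually (\<lambda>h. F h = G h) (at 0 within {0..1})"
    unfolding eventually_at_filter using assms(3) by (intro always_eventually) auto
  from Lim_transform_eventually[OF F this] show ?thesis
    using tendsto_unique[OF * _ G] by blast
qed

text \<open>The difference quotient of step \<open>h\<close> in direction \<open>d\<close>, written as an average of the gradient so
  that it extends continuously to \<open>h = 0\<close>.\<close>

definition grad_quot :: "(real^3 \<Rightarrow> real^3) \<Rightarrow> real^3 \<Rightarrow> real \<Rightarrow> real^3 \<Rightarrow> real" where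
  "grad_quot G d h x = integral {0..1} (\<lambda>s. G (x + (s * h) *\<^sub>R d) \<bullet> d)"

lemma grad_quot_0 [simp]: "grad_quot G d 0 x = G x \<bullet> d"
  by (simp add: grad_quot_def)

definition has_gradient :: "(real^3 \<Rightarrow> real) \<Rightarrow> (real^3 \<Rightarrow> real^3) \<Rightarrow> bool" where
  "has_gradient f G \<longleftrightarrow> continuous_on UNIV G \<and> (\<forall>x. (f has_derivative (\<lambda>h. G x \<bullet> h)) (at x))"

lemma has_gradientI:
  assumes "continuous_on UNIV G" "\<And>x. (f has_derivative D x) (at x)" "\<And>x h. D x h = G x \<bullet> h"
  shows "has_gradient f G"
proof -
  have "D x = (\<lambda>h. G x \<bullet> h)" for x using assms(3) by auto
  then show ?thesis using assms(1,2) by (simp add: has_gradient_def)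
qed

lemma has_gradientD:
  assumes "has_gradient f G"
  shows "continuous_on UNIV G" "(f has_derivative (\<lambda>h. G x \<bullet> h)) (at x)"
  using assms by (auto simp: has_gradient_def)

lemma has_gradient_continuous: "has_gradient f G \<Longrightarrow> continuous_on UNIV f"
  unfolding has_gradient_def
  by (meson continuous_at_imp_continuous_on has_derivative_continuous)

lemma grad_quot:
  assumes "has_gradient f G"
  shows "f (x + h *\<^sub>R d) - f x = h * grad_quot G d h x"
proof -
  let ?p = "\<lambda>s. x + (s * h) *\<^sub>R d"
  have c: "continuous_on UNIV G" using assms by (simp add: has_gradient_def)
  have "((\<lambda>s. f (?p s)) has_vector_derivative h * (G (?p s) \<bullet> d)) (at s within {0..1})" for s
  proof -
    have "(f has_derivative (\<lambda>h. G (?p s) \<bullet> h)) (at (?p s))"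
      using assms by (simp add: has_gradient_def)
    moreover have "(?p has_derivative (\<lambda>t. (t * h) *\<^sub>R d)) (at s within {0..1})"
      by (auto intro!: derivative_eq_intros)
    ultimately have "((\<lambda>s. f (?p s)) has_derivative (\<lambda>t. G (?p s) \<bullet> ((t * h) *\<^sub>R d))) (at s within {0..1})"
      by (rule has_derivative_compose[rotated])
    then show ?thesis by (simp add: has_vector_derivative_def mult_ac)
  qed
  then have "((\<lambda>s. h * (G (?p s) \<bullet> d)) has_integral f (?p 1) - f (?p 0)) {0..1}"
    by (intro fundamental_theorem_of_calculus) auto
  then have "integral {0..1} (\<lambda>s. h * (G (?p s) \<bullet> d)) = f (?p 1) - f (?p 0)"
    by (rule integral_unique)
  then show ?thesis by (simp add: grad_quot_def)
qed

text \<open>Joint continuity in time, step size and position, with step size 0 included: it makes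
  every integral built from quotients a continuous function of the step size.\<close>

lemma continuous_on_grad_quot:
  fixes \<tau> :: "'z::topological_space \<Rightarrow> 'a::topological_space"
  assumes G: "continuous_on (K \<times> UNIV) (\<lambda>(t, x). G t x)"
    and "continuous_on S \<tau>" "\<tau> ` S \<subseteq> K" "continuous_on S \<eta>" "continuous_on S \<xi>"
  shows "continuous_on S (\<lambda>z. grad_quot (G (\<tau> z)) d (\<eta> z) (\<xi> z))"
  unfolding grad_quot_def box_real[symmetric]
proof (rule integral_continuous_on_param)
  have *: "continuous_on (S \<times> cbox 0 1) (\<lambda>p. \<tau> (fst p))" "continuous_on (S \<times> cbox 0 1) (\<lambda>p. \<eta> (fst p))"
    "continuous_on (S \<times> cbox 0 1) (\<lambda>p. \<xi> (fst p))"
    by (rule continuous_on_compose2[OF assms(2)] continuous_on_compose2[OF assms(4)]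
      continuous_on_compose2[OF assms(5)]; auto intro!: continuous_intros)+
  have "continuous_on (S \<times> cbox 0 1) (\<lambda>p. (\<lambda>(t, x). G t x) (\<tau> (fst p), \<xi> (fst p) + (snd p * \<eta> (fst p)) *\<^sub>R d) \<bullet> d)"
    by (intro continuous_intros continuous_on_compose2[OF G] * ) (use assms(3) in auto)
  then show "continuous_on (S \<times> cbox 0 1)
     (\<lambda>(z, s). G (\<tau> z) (\<xi> z + (s * \<eta> z) *\<^sub>R d) \<bullet> d)"
    by (simp add: case_prod_beta)
qed

lemma continuous_on_grad_quot1:
  fixes \<eta> :: "'z::topological_space \<Rightarrow> real"
  assumes G: "has_gradient f G"
    and "continuous_on S \<eta>" "continuous_on S \<xi>"
  shows "continuous_on S (\<lambda>z. grad_quot G d (\<eta> z) (\<xi> z))"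
proof (rule continuous_on_grad_quot[where \<tau>="\<lambda>_. 0::real" and K=UNIV, of "\<lambda>_. G"])
  have "continuous_on UNIV G" using G by (simp add: has_gradient_def)
  then show "continuous_on (UNIV \<times> UNIV) (\<lambda>(t, y). G y)"
    unfolding case_prod_beta by (rule continuous_on_compose2) (auto intro!: continuous_intros)
qed (use assms in auto)

lemma cell_param:
  fixes F :: "real \<Rightarrow> real^3 \<Rightarrow> real"
  assumes "continuous_on UNIV (\<lambda>z. F (fst z) (snd z))"
  shows "continuous_on {0..1} (\<lambda>h. integral (box_cell L) (F h))"
  unfolding box_cell_def case_prod_beta
  by (rule integral_continuous_on_param) (use assms in \<open>auto simp: case_prod_beta intro: continuous_on_subset\<close>)

lemma cell_limit_0:
  fixes F :: "real \<Rightarrow> real^3 \<Rightarrow> real"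
  assumes "continuous_on UNIV (\<lambda>z. F (fst z) (snd z))" "\<And>h. h > 0 \<Longrightarrow> integral (box_cell L) (F h) = 0"
  shows "integral (box_cell L) (F 0) = 0"
  using continuous_eq_at_0[OF cell_param[OF assms(1)], of "\<lambda>_. 0"] assms(2) by auto

text \<open>For positive step size the quotient is a multiple of the difference between a translate
  of f and f itself, so its integral vanishes by translation invariance; continuity in the step size
  does the rest.\<close>

lemma integral_grad:
  assumes "has_gradient f G" "box_periodic L f" "L > 0"
  shows "integral (box_cell L) (\<lambda>x. G x \<bullet> d) = 0"
proof -
  have "integral (box_cell L) (grad_quot G d 0) = 0"
  proof (rule cell_limit_0)
    show "continuous_on UNIV (\<lambda>z. grad_quot G d (fst z) (snd z))"
      by (rule continuous_on_grad_quot1[OF assms(1)]) (auto intro!: continuous_intros)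
    fix h :: real assume "h > 0"
    then have "grad_quot G d h = (\<lambda>x. (1/h) * (f (x + h *\<^sub>R d) - f x))"
      using grad_quot[OF assms(1), of _ h d] by auto
    then show "integral (box_cell L) (grad_quot G d h) = 0"
      using cell_shift_diff[OF has_gradient_continuous[OF assms(1)] assms(2,3)] by simp
  qed
  then show ?thesis by (simp add: grad_quot_0[abs_def])
qed

lemma has_gradient_mult:
  assumes "has_gradient f F" "has_gradient g G"
  shows "has_gradient (\<lambda>x. f x * g x) (\<lambda>x. f x *\<^sub>R G x + g x *\<^sub>R F x)"
  unfolding has_gradient_def
proof (intro conjI allI)
  show "continuous_on UNIV (\<lambda>x. f x *\<^sub>R G x + g x *\<^sub>R F x)"
    using assms[THEN has_gradient_continuous] assms unfolding has_gradient_def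
    by (intro continuous_intros) auto
  fix x
  have "(f has_derivative (\<lambda>h. F x \<bullet> h)) (at x)" "(g has_derivative (\<lambda>h. G x \<bullet> h)) (at x)"
    using assms by (auto simp: has_gradient_def)
  then show "((\<lambda>x. f x * g x) has_derivative (\<lambda>h. (f x *\<^sub>R G x + g x *\<^sub>R F x) \<bullet> h)) (at x)"
    by (auto intro!: derivative_eq_intros simp: inner_add_left)
qed

lemma has_gradient_add:
  assumes "has_gradient f F" "has_gradient g G"
  shows "has_gradient (\<lambda>x. f x + g x) (\<lambda>x. F x + G x)"
  by (rule has_gradientI[OF _ has_derivative_add[OF assms[THEN has_gradientD(2)]]])
    (simp_all add: continuous_on_add assms[THEN has_gradientD(1)] inner_add_left)

lemma has_gradient_scale:
  assumes "has_gradient f F"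
  shows "has_gradient (\<lambda>x. c * f x) (\<lambda>x. c *\<^sub>R F x)"
  by (rule has_gradientI[OF _ has_derivative_mult_right[OF assms[THEN has_gradientD(2)]]])
    (simp_all add: continuous_on_scaleR assms[THEN has_gradientD(1)])

lemma continuous_on_shift:
  assumes "continuous_on UNIV f"
  shows "continuous_on UNIV (\<lambda>x. f (x + a :: real^3))"
  by (rule continuous_on_compose2[OF assms]) (auto intro!: continuous_intros)

lemma has_gradient_shift:
  assumes "has_gradient f F"
  shows "has_gradient (\<lambda>x. f (x + a)) (\<lambda>x. F (x + a))"
  unfolding has_gradient_def
proof (intro conjI allI)
  show "continuous_on UNIV (\<lambda>x. F (x + a))"
    using assms unfolding has_gradient_def by (intro continuous_on_shift) auto
  fix x
  have f: "(f has_derivative (\<lambda>h. F (x + a) \<bullet> h)) (at (x + a))" using assms by (auto simp: has_gradient_def)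
  have g: "((\<lambda>x. x + a) has_derivative (\<lambda>h. h)) (at x)" by (auto intro!: derivative_eq_intros)
  show "((\<lambda>x. f (x + a)) has_derivative (\<lambda>h. F (x + a) \<bullet> h)) (at x)"
    using has_derivative_compose[OF g f] by simp
qed

lemma has_gradient_shift_diff:
  assumes "has_gradient f F"
  shows "has_gradient (\<lambda>x. f (x + a) - f x) (\<lambda>x. F (x + a) - F x)"
  using has_gradient_add[OF has_gradient_shift[OF assms] has_gradient_scale[OF assms, of "-1"]] by simp

lemma continuous_integrable_cell [simp, intro]:
  fixes f :: "real^3 \<Rightarrow> 'b::banach"
  assumes "continuous_on UNIV f"
  shows "f integrable_on box_cell L"
  using assms unfolding box_cell_def by (auto intro!: integrable_continuous intro: continuous_on_subset)

section \<open>Null Lagrangians\<close>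

lemma shift_identity_2:
  fixes f g :: real
  shows "(fa - f) * (gab - ga) - (fb - f) * (gab - gb)
     = (fa * (gab - ga) - f * (gb - g)) - (fb * (gab - gb) - f * (ga - g))"
  by (simp add: algebra_simps)

text \<open>Formally f_a g_b - f_b g_a = (f g_b)_a - (f g_a)_b with subscripts for derivatives,
  which would need second derivatives of g. For finite differences the right side makes sense
  without them and consists of increments of periodic functions.\<close>

lemma null_lagrangian_2:
  assumes f: "has_gradient f F" "box_periodic L f" and g: "has_gradient g G" "box_periodic L g"
    and L: "L > 0"
  shows "integral (box_cell L) (\<lambda>x. (F x \<bullet> a) * (G x \<bullet> b) - (F x \<bullet> b) * (G x \<bullet> a)) = 0"
proof -
  note c = has_gradient_continuous[OF f(1)] has_gradient_continuous[OF g(1)]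
  \<comment> \<open>The second factor sits at the point reached by the step of the first. This
    offset makes the discrete identity exact for every h and disappears at
    \<open>h = 0\<close>.\<close>
  define D where "D h x = grad_quot F a h x * grad_quot G b h (x + h *\<^sub>R a)
      - grad_quot F b h x * grad_quot G a h (x + h *\<^sub>R b)" for h x
  have "integral (box_cell L) (D 0) = 0"
  proof (rule cell_limit_0)
    show "continuous_on UNIV (\<lambda>z. D (fst z) (snd z))"
      unfolding D_def
      by (intro continuous_intros continuous_on_grad_quot1[OF f(1)] continuous_on_grad_quot1[OF g(1)])
    fix h :: real assume h: "h > 0"
    define \<psi> where "\<psi> d x = f x * (g (x + h *\<^sub>R d) - g x)" for d x
    have c\<psi>: "continuous_on UNIV (\<psi> d)" and p\<psi>: "box_periodic L (\<psi> d)" for d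
      unfolding \<psi>_def
      by (intro continuous_intros c continuous_on_shift[OF c(2)]
          box_periodic_compose2[where F="(*)"] box_periodic_compose2[where F="(-)"]
          box_periodic_shift[OF g(2)] f(2) g(2))+
    have c\<psi>': "continuous_on UNIV (\<lambda>x. \<psi> d (x + e) - \<psi> d x)" for d e
      by (intro continuous_intros continuous_on_shift[OF c\<psi>] c\<psi>)
    have "D h = (\<lambda>x. (1/h\<^sup>2) * ((\<psi> b (x + h *\<^sub>R a) - \<psi> b x) - (\<psi> a (x + h *\<^sub>R b) - \<psi> a x)))"
    proof
      fix x
      have q: "h * grad_quot F d h y = f (y + h *\<^sub>R d) - f y" "h * grad_quot G d h y = g (y + h *\<^sub>R d) - g y" for d y
        using grad_quot[OF f(1), of y h d] grad_quot[OF g(1), of y h d] by auto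
      have s: "x + h *\<^sub>R b + h *\<^sub>R a = x + h *\<^sub>R a + h *\<^sub>R b" by simp
      have "h\<^sup>2 * D h x = (h * grad_quot F a h x) * (h * grad_quot G b h (x + h *\<^sub>R a))
          - (h * grad_quot F b h x) * (h * grad_quot G a h (x + h *\<^sub>R b))"
        unfolding D_def power2_eq_square by (simp add: algebra_simps)
      also have "\<dots> = (\<psi> b (x + h *\<^sub>R a) - \<psi> b x) - (\<psi> a (x + h *\<^sub>R b) - \<psi> a x)"
        unfolding q \<psi>_def s by (rule shift_identity_2)
      finally show "D h x = (1/h\<^sup>2) * ((\<psi> b (x + h *\<^sub>R a) - \<psi> b x) - (\<psi> a (x + h *\<^sub>R b) - \<psi> a x))"
        using h by (simp add: field_simps)

    qed
    then have "integral (box_cell L) (D h) = (1/h\<^sup>2) *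
        (integral (box_cell L) (\<lambda>x. \<psi> b (x + h *\<^sub>R a) - \<psi> b x) - integral (box_cell L) (\<lambda>x. \<psi> a (x + h *\<^sub>R b) - \<psi> a x))"
      using c\<psi>' by (simp add: integral_diff continuous_integrable_cell)
    then show "integral (box_cell L) (D h) = 0"
      by (simp add: cell_shift_diff[OF c\<psi> p\<psi> L])
  qed
  then show ?thesis by (simp add: D_def[abs_def])
qed

text \<open>Suffixes list the steps taken from the base point. Each bracket on the right is the
  increment, in one direction, of a product of f with a difference of g and an offset difference of
  k in the other two directions.\<close>

lemma shift_identity_3:
  fixes f g k :: real
  shows "(fa - f) * (gab - ga) * (kabc - kab) - (fa - f) * (gac - ga) * (kabc - kac)
     + (fb - f) * (gbc - gb) * (kabc - kbc) - (fb - f) * (gab - gb) * (kabc - kab)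
     + (fc - f) * (gac - gc) * (kabc - kac) - (fc - f) * (gbc - gc) * (kabc - kbc)
   = (fa * (gab - ga) * (kabc - kab) - f * (gb - g) * (kbc - kb))
     - (fa * (gac - ga) * (kabc - kac) - f * (gc - g) * (kbc - kc))
     + (fb * (gbc - gb) * (kabc - kbc) - f * (gc - g) * (kac - kc))
     - (fb * (gab - gb) * (kabc - kab) - f * (ga - g) * (kac - ka))
     + (fc * (gac - gc) * (kabc - kac) - f * (ga - g) * (kab - ka))
     - (fc * (gbc - gc) * (kabc - kbc) - f * (gb - g) * (kab - kb))"
proof -
  \<comment> \<open>The products with fa, fb and fc agree on both sides; what remains to compare is
    f times this identity in g and k.\<close>
  have inner: "(gab - ga) * (kabc - kab) - (gac - ga) * (kabc - kac)
     + (gbc - gb) * (kabc - kbc) - (gab - gb) * (kabc - kab)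
     + (gac - gc) * (kabc - kac) - (gbc - gc) * (kabc - kbc)
   = (gb - g) * (kbc - kb) - (gc - g) * (kbc - kc) + (gc - g) * (kac - kc)
     - (ga - g) * (kac - ka) + (ga - g) * (kab - ka) - (gb - g) * (kab - kb)"
    by algebra
  have split: "(a - f) * u * v = a * u * v - f * (u * v)" "f * u * v = f * (u * v)" for a u v :: real
    by algebra+
  have sum: "(a1 - p1) - (a2 - p2) + (a3 - p3) - (a4 - p4) + (a5 - p5) - (a6 - p6)
      = (a1 - r1) - (a2 - r2) + (a3 - r3) - (a4 - r4) + (a5 - r5) - (a6 - r6)"
    if "p1 - p2 + p3 - p4 + p5 - p6 = r1 - r2 + r3 - r4 + r5 - r6"
    for a1 a2 a3 a4 a5 a6 p1 p2 p3 p4 p5 p6 r1 r2 r3 r4 r5 r6 :: real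
    using that by linarith
  show ?thesis
    apply (simp only: split(1))
    apply (simp only: split(2))
    apply (rule sum)
    using arg_cong[OF inner, of "\<lambda>z. f * z"] apply (simp only: distrib_left right_diff_distrib[of f])
    done
qed

text \<open>The six terms of the determinant are discretised with different shifts, chosen such that their
  signed sum is a sum of increments, as for the cup product of cochains.\<close>

lemma null_lagrangian_3:
  assumes f: "has_gradient f F" "box_periodic L f" and g: "has_gradient g G" "box_periodic L g"
    and k: "has_gradient k K" "box_periodic L k" and L: "L > 0"
  shows "integral (box_cell L) (\<lambda>x.
      (F x \<bullet> a) * (G x \<bullet> b) * (K x \<bullet> c) - (F x \<bullet> a) * (G x \<bullet> c) * (K x \<bullet> b)
    + (F x \<bullet> b) * (G x \<bullet> c) * (K x \<bullet> a) - (F x \<bullet> b) * (G x \<bullet> a) * (K x \<bullet> c)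
    + (F x \<bullet> c) * (G x \<bullet> a) * (K x \<bullet> b) - (F x \<bullet> c) * (G x \<bullet> b) * (K x \<bullet> a)) = 0"
proof -
  note cc = has_gradient_continuous[OF f(1)] has_gradient_continuous[OF g(1)] has_gradient_continuous[OF k(1)]
  define E where "E a b c h x = grad_quot F a h x * grad_quot G b h (x + h *\<^sub>R a)
      * grad_quot K c h (x + h *\<^sub>R a + h *\<^sub>R b)" for a b c h x
  define D where "D h x = E a b c h x - E a c b h x + E b c a h x - E b a c h x + E c a b h x - E c b a h x" for h x
  have "integral (box_cell L) (D 0) = 0"
  proof (rule cell_limit_0)
    have "continuous_on UNIV (\<lambda>z. E a b c (fst z) (snd z))" for a b c
      unfolding E_def
      by (intro continuous_on_mult continuous_on_grad_quot1[OF f(1)] continuous_on_grad_quot1[OF g(1)]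
          continuous_on_grad_quot1[OF k(1)] continuous_intros)
    then show "continuous_on UNIV (\<lambda>z. D (fst z) (snd z))"
      unfolding D_def by (intro continuous_on_add continuous_on_diff)
    fix h :: real assume h: "h > 0"
    define \<psi> where "\<psi> d e x = f x * (g (x + h *\<^sub>R d) - g x) * (k (x + h *\<^sub>R d + h *\<^sub>R e) - k (x + h *\<^sub>R d))" for d e x
    have c\<psi>: "continuous_on UNIV (\<psi> d e)" for d e
      unfolding \<psi>_def add.assoc
      by (intro continuous_intros cc cc[THEN continuous_on_shift])
    have p\<psi>: "box_periodic L (\<psi> d e)" for d e
      unfolding \<psi>_def add.assoc
      by (intro box_periodic_compose2[where F="(*)"] box_periodic_compose2[where F="(-)"]
          box_periodic_shift[OF g(2)] box_periodic_shift[OF k(2)] f(2) g(2) k(2))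
    define \<Delta> where "\<Delta> a d e x = \<psi> d e (x + h *\<^sub>R a) - \<psi> d e x" for a d e x
    have c\<Delta>: "continuous_on UNIV (\<Delta> a d e)" for a d e
      unfolding \<Delta>_def by (intro continuous_intros continuous_on_shift[OF c\<psi>] c\<psi>)
    have i\<Delta>: "integral (box_cell L) (\<Delta> a d e) = 0" for a d e
      unfolding \<Delta>_def by (rule cell_shift_diff[OF c\<psi> p\<psi> L])
    have "D h = (\<lambda>x. (1/h^3) * (\<Delta> a b c x - \<Delta> a c b x + \<Delta> b c a x - \<Delta> b a c x + \<Delta> c a b x - \<Delta> c b a x))"
    proof
      fix x
      have q: "h * grad_quot F d h y = f (y + h *\<^sub>R d) - f y" "h * grad_quot G d h y = g (y + h *\<^sub>R d) - g y"
        "h * grad_quot K d h y = k (y + h *\<^sub>R d) - k y" for d y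
        using grad_quot[OF f(1), of y h d] grad_quot[OF g(1), of y h d] grad_quot[OF k(1), of y h d] by auto
      have E: "h^3 * E d e i h x = (f (x + h *\<^sub>R d) - f x) * (g (x + h *\<^sub>R d + h *\<^sub>R e) - g (x + h *\<^sub>R d))
        * (k (x + h *\<^sub>R d + h *\<^sub>R e + h *\<^sub>R i) - k (x + h *\<^sub>R d + h *\<^sub>R e))" for d e i
        unfolding q[symmetric] E_def by (simp add: power3_eq_cube mult_ac)
      have s: "x + h *\<^sub>R b + h *\<^sub>R a = x + h *\<^sub>R a + h *\<^sub>R b" "x + h *\<^sub>R c + h *\<^sub>R a = x + h *\<^sub>R a + h *\<^sub>R c"
        "x + h *\<^sub>R c + h *\<^sub>R b = x + h *\<^sub>R b + h *\<^sub>R c"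
        "x + h *\<^sub>R a + h *\<^sub>R c + h *\<^sub>R b = x + h *\<^sub>R a + h *\<^sub>R b + h *\<^sub>R c"
        "x + h *\<^sub>R b + h *\<^sub>R c + h *\<^sub>R a = x + h *\<^sub>R a + h *\<^sub>R b + h *\<^sub>R c" by simp_all
      have "h^3 * D h x = \<Delta> a b c x - \<Delta> a c b x + \<Delta> b c a x - \<Delta> b a c x + \<Delta> c a b x - \<Delta> c b a x"
        unfolding D_def distrib_left[of "h^3"] right_diff_distrib[of "h^3"] E \<Delta>_def \<psi>_def s
        by (rule shift_identity_3)
      then show "D h x = (1/h^3) * (\<Delta> a b c x - \<Delta> a c b x + \<Delta> b c a x - \<Delta> b a c x + \<Delta> c a b x - \<Delta> c b a x)"
        using h by (simp add: field_simps)
    qed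
    then have "integral (box_cell L) (D h) = (1/h^3) * integral (box_cell L) (\<lambda>x.
        \<Delta> a b c x - \<Delta> a c b x + \<Delta> b c a x - \<Delta> b a c x + \<Delta> c a b x - \<Delta> c b a x)"
      by (simp only: integral_mult_right)
    also have "integral (box_cell L) (\<lambda>x.
        \<Delta> a b c x - \<Delta> a c b x + \<Delta> b c a x - \<Delta> b a c x + \<Delta> c a b x - \<Delta> c b a x) = 0"
      using i\<Delta> continuous_integrable_cell[OF c\<Delta>]
      by (simp only: integral_diff integral_add integrable_add integrable_diff)
    finally show "integral (box_cell L) (D h) = 0" by simp
  qed
  then show ?thesis by (simp add: D_def[abs_def] E_def)
qed

section \<open>Eigenvalues of symmetric matrices\<close>

text \<open>For an eigenvector x the number z |x|^2 is the Hermitian form of S at x, which is real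
  because S is real and symmetric.\<close>

lemma symmetric_complex_root_real:
  fixes S :: "real^3^3" and z :: complex
  assumes sym: "transpose S = S" and root: "det (mat z - (\<chi> i j. complex_of_real (S$i$j))) = 0"
  shows "z \<in> \<real>"
proof -
  define B where "B = mat z - (\<chi> i j. complex_of_real (S$i$j))"
  have s: "S$2$1 = S$1$2" "S$3$1 = S$1$3" "S$3$2 = S$2$3"
    using sym by (simp_all add: transpose_def vec_eq_iff)
  have "\<not> invertible B" using root by (simp add: B_def invertible_det_nz)
  then obtain x where x: "B *v x = 0" "x \<noteq> 0"
    by (metis invertible_left_inverse matrix_left_invertible_ker)
  have r: "z * x$1 = S$1$1 * x$1 + S$1$2 * x$2 + S$1$3 * x$3"
    "z * x$2 = S$1$2 * x$1 + S$2$2 * x$2 + S$2$3 * x$3"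
    "z * x$3 = S$1$3 * x$1 + S$2$3 * x$2 + S$3$3 * x$3"
    using x(1) s
    by (auto simp: B_def matrix_vector_mult_def vec_eq_iff forall_3 sum_3 mat_def algebra_simps)
  define n where "n = (cmod (x$1))\<^sup>2 + (cmod (x$2))\<^sup>2 + (cmod (x$3))\<^sup>2"
  have n: "n > 0"
  proof -
    have "x$1 \<noteq> 0 \<or> x$2 \<noteq> 0 \<or> x$3 \<noteq> 0" using x(2) by (simp add: vec_eq_iff forall_3)
    then have "(cmod (x$1))\<^sup>2 > 0 \<or> (cmod (x$2))\<^sup>2 > 0 \<or> (cmod (x$3))\<^sup>2 > 0" by simp
    then show ?thesis unfolding n_def
      by (smt (verit) zero_le_power2)
  qed
  have "z * n = cnj (x$1) * (z * x$1) + cnj (x$2) * (z * x$2) + cnj (x$3) * (z * x$3)"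
    unfolding n_def of_real_add complex_norm_square by (simp add: algebra_simps)
  also have "Im \<dots> = 0" unfolding r by (simp add: algebra_simps)
  finally have "Im z = 0" using n by simp
  then show ?thesis by (simp add: complex_is_Real_iff)
qed

text \<open>The second elementary symmetric function of the eigenvalues; of a periodic velocity
  gradient it is a null Lagrangian.\<close>

definition minors2 :: "real^3^3 \<Rightarrow> real" where
  "minors2 S = S$1$1 * S$2$2 + S$1$1 * S$3$3 + S$2$2 * S$3$3 - S$1$2 * S$2$1 - S$1$3 * S$3$1 - S$2$3 * S$3$2"

lemma char_poly_3: "det (mat z - S) = z^3 - trace S * z\<^sup>2 + minors2 S * z - det S" for S :: "real^3^3"
  by (simp add: det_3 mat_def trace_def sum_3 minors2_def algebra_simps power2_eq_square power3_eq_cube)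

lemma char_poly_3_complex:
  fixes S :: "real^3^3"
  shows "det (mat z - (\<chi> i j. complex_of_real (S$i$j)))
    = z^3 - of_real (trace S) * z\<^sup>2 + of_real (minors2 S) * z - of_real (det S)"
  by (simp add: det_3 mat_def trace_def sum_3 minors2_def algebra_simps power2_eq_square power3_eq_cube)

lemma cubic_real_root:
  fixes a b c :: real
  shows "\<exists>r. r^3 - a * r\<^sup>2 + b * r - c = 0"
proof -
  \<comment> \<open>Chosen so that R^3 = R * R^2 dominates the three lower terms, each at most its
    coefficient times R^2; the cubic then has opposite weak signs at R and -R.\<close>
  define R where "R = 1 + \<bar>a\<bar> + \<bar>b\<bar> + \<bar>c\<bar>"
  let ?p = "\<lambda>r. r^3 - a * r\<^sup>2 + b * r - c"
  have R: "R \<ge> 1" by (simp add: R_def)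
  have a: "\<bar>a * R\<^sup>2\<bar> \<le> \<bar>a\<bar> * R\<^sup>2" by (simp add: abs_mult)
  have b: "\<bar>b * R\<bar> \<le> \<bar>b\<bar> * R\<^sup>2"
    using R by (simp add: abs_mult power2_eq_square mult_left_mono)
  have c: "\<bar>c\<bar> \<le> \<bar>c\<bar> * R\<^sup>2"
    using R by (simp add: mult_le_cancel_left1 power2_eq_square)
       (metis abs_ge_zero linorder_not_less mult_le_cancel_left1 mult_mono' one_le_power power2_eq_square)
  have d: "R^3 = R\<^sup>2 + \<bar>a\<bar> * R\<^sup>2 + \<bar>b\<bar> * R\<^sup>2 + \<bar>c\<bar> * R\<^sup>2"
    by (simp add: R_def power2_eq_square power3_eq_cube algebra_simps)
  have "R\<^sup>2 \<ge> 0" by simp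
  then have "?p R \<ge> 0" using a b c d by linarith
  moreover have "?p (-R) = -(R^3) - a * R\<^sup>2 - b * R - c" by simp
  then have "?p (-R) \<le> 0" using a b c d \<open>R\<^sup>2 \<ge> 0\<close> by linarith
  ultimately have "?p R \<ge> 0" "?p (-R) \<le> 0" by auto
  then show ?thesis
    using IVT'[of ?p "-R" 0 R] R by (force intro!: continuous_intros)
qed

lemma sorted_cubic_roots_unique:
  fixes l k :: "real^3"
  assumes "l$1 \<ge> l$2" "l$2 \<ge> l$3" "k$1 \<ge> k$2" "k$2 \<ge> k$3"
    and eq: "\<And>z. (z - l$1) * (z - l$2) * (z - l$3) = (z - k$1) * (z - k$2) * (z - k$3)"
  shows "l = k"
proof -
  \<comment> \<open>The largest root of each cubic is a root of the other, so neither can exceed the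
    other; the smallest roots are treated alike.\<close>
  have 1: "l$1 = k$1" using eq[of "l$1"] eq[of "k$1"] assms(1-4) by auto
  have 3: "l$3 = k$3" using eq[of "l$3"] eq[of "k$3"] assms(1-4) by auto
  \<comment> \<open>The point \<open>l$1 + 1\<close> lies above all roots, so the common outer
    factors are nonzero there and cancel.\<close>
  have "l$2 = k$2" using eq[of "l$1 + 1"] eq[of "l$2"] eq[of "k$2"] 1 3 assms(1-4) by auto
  then show ?thesis using 1 3 by (simp add: vec_eq_iff forall_3)
qed

lemma sort_triple:
  fixes a b c :: real
  obtains l :: "real^3" where "l$1 \<ge> l$2" "l$2 \<ge> l$3"
    "\<And>z. (z - a) * (z - b) * (z - c) = (z - l$1) * (z - l$2) * (z - l$3)"
proof -
  have v: "\<exists>l::real^3. l$1 = p \<and> l$2 = q \<and> l$3 = r" for p q r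
    by (rule exI[of _ "vector [p,q,r]"]) (simp add: vector_3)
  have "\<exists>p q r. p \<ge> q \<and> q \<ge> r \<and> (\<forall>z. (z - a) * (z - b) * (z - c) = (z - p) * (z - q) * (z - r))"
  proof -
    consider "a \<ge> b" "b \<ge> c" | "a \<ge> c" "c \<ge> b" | "b \<ge> a" "a \<ge> c" | "b \<ge> c" "c \<ge> a"
      | "c \<ge> a" "a \<ge> b" | "c \<ge> b" "b \<ge> a" by linarith
    then show ?thesis
    proof cases
      case 1 then show ?thesis by blast
    next
      case 2 then show ?thesis by (intro exI[of _ a] exI[of _ c] exI[of _ b]) simp
    next
      case 3 then show ?thesis by (intro exI[of _ b] exI[of _ a] exI[of _ c]) simp
    next
      case 4 then show ?thesis by (intro exI[of _ b] exI[of _ c] exI[of _ a]) simp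
    next
      case 5 then show ?thesis by (intro exI[of _ c] exI[of _ a] exI[of _ b]) simp
    next
      case 6 then show ?thesis by (intro exI[of _ c] exI[of _ b] exI[of _ a]) simp
    qed
  qed
  with v that show ?thesis by metis
qed

text \<open>Split off a real root. If the remaining quadratic had negative discriminant, it would
  supply a nonreal root of the characteristic polynomial, which
  \<open>symmetric_complex_root_real\<close> excludes.\<close>

lemma symmetric_char_poly_splits:
  fixes S :: "real^3^3"
  assumes sym: "transpose S = S"
  shows "\<exists>a b c. \<forall>z. det (mat z - S) = (z - a) * (z - b) * (z - c)"
proof -
  obtain r where r: "r^3 - trace S * r\<^sup>2 + minors2 S * r - det S = 0"
    using cubic_real_root by blast
  define p where "p = r - trace S"
  define q where "q = minors2 S + r * p"
  have fac: "z^3 - trace S * z\<^sup>2 + minors2 S * z - det S = (z - r) * (z\<^sup>2 + p * z + q)" for z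
    using r by (simp add: p_def q_def algebra_simps power2_eq_square power3_eq_cube)
  have disc: "p\<^sup>2 - 4 * q \<ge> 0"
  proof (rule ccontr)
    assume *: "\<not> p\<^sup>2 - 4 * q \<ge> 0"
    define \<beta> where "\<beta> = sqrt (q - p\<^sup>2 / 4)"
    have \<beta>: "\<beta> > 0" "\<beta>\<^sup>2 = q - p\<^sup>2 / 4" using * by (auto simp: \<beta>_def)
    define w where "w = Complex (- p / 2) \<beta>"
    have w: "w\<^sup>2 + of_real p * w + of_real q = 0"
      using \<beta>(2) by (simp add: w_def complex_eq_iff power2_eq_square algebra_simps)
    have "det S = trace S * 0 + (-(r * q)) * -1"
      using fac[of 0] by simp
    then have d: "det S = r * q" by simp
    have t: "trace S = r - p" "minors2 S = q - r * p" by (auto simp: p_def q_def)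
    have "w^3 - of_real (trace S) * w\<^sup>2 + of_real (minors2 S) * w - of_real (det S)
        = (w - of_real r) * (w\<^sup>2 + of_real p * w + of_real q)"
      unfolding d t by (simp add: algebra_simps power2_eq_square power3_eq_cube)
    then have "w \<in> \<real>"
      using symmetric_complex_root_real[OF sym, of w] w by (simp add: char_poly_3_complex)
    then show False using \<beta>(1) by (simp add: w_def complex_is_Real_iff)
  qed
  define s where "s = sqrt (p\<^sup>2 - 4 * q)"
  have s: "s\<^sup>2 = p\<^sup>2 - 4 * q" using disc by (simp add: s_def)
  have "z\<^sup>2 + p * z + q = (z - (- p + s) / 2) * (z - (- p - s) / 2)" for z
    using s by (simp add: field_simps power2_eq_square)
  then show ?thesis using fac by (auto simp: char_poly_3 mult.assoc)
qed

text \<open>Existence and uniqueness of the sorted roots make the definite description denote.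
  Values of the polynomial at 0, 1 and -1 give the symmetric functions, and for symmetric S the
  squared Frobenius norm is the squared trace minus twice \<open>minors2 S\<close>.\<close>

lemma ordered_eigenvalues_symmetric:
  fixes S :: "real^3^3"
  assumes sym: "transpose S = S"
  defines "l \<equiv> ordered_eigenvalues S"
  shows "l$1 \<ge> l$2" "l$2 \<ge> l$3" "l$1 + l$2 + l$3 = trace S" "l$1 * l$2 * l$3 = det S"
    "(l$1)\<^sup>2 + (l$2)\<^sup>2 + (l$3)\<^sup>2 = (\<Sum>i\<in>UNIV. \<Sum>j\<in>UNIV. (S$i$j)\<^sup>2)"
proof -
  let ?P = "\<lambda>l::real^3. l $ 1 \<ge> l $ 2 \<and> l $ 2 \<ge> l $ 3 \<and>
     (\<forall>z. det (mat z - S) = (z - l $ 1) * (z - l $ 2) * (z - l $ 3))"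
  obtain a b c where abc: "\<And>z. det (mat z - S) = (z - a) * (z - b) * (z - c)"
    using symmetric_char_poly_splits[OF sym] by blast
  obtain k :: "real^3" where k: "k$1 \<ge> k$2" "k$2 \<ge> k$3"
    "\<And>z. (z - a) * (z - b) * (z - c) = (z - k$1) * (z - k$2) * (z - k$3)"
    using sort_triple[of a b c] by blast
  have Pk: "?P k" using k abc by simp
  have "l = k" unfolding l_def ordered_eigenvalues_def
  proof (rule the_equality)
    show "?P k" by (rule Pk)
    show "m = k" if "?P m" for m
      using sorted_cubic_roots_unique[of m k] that Pk by auto
  qed
  then have Pl: "?P l" using Pk by simp
  then show "l$1 \<ge> l$2" "l$2 \<ge> l$3" by auto
  have e: "z^3 - trace S * z\<^sup>2 + minors2 S * z - det S = (z - l$1) * (z - l$2) * (z - l$3)" for z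
    using Pl char_poly_3[of z S] by simp
  from e[of 0] show d: "l$1 * l$2 * l$3 = det S" by simp
  have t: "l$1 + l$2 + l$3 = trace S" and m: "l$1 * l$2 + l$1 * l$3 + l$2 * l$3 = minors2 S"
    using e[of 1] e[of "-1"] d by (auto simp: algebra_simps)
  show "l$1 + l$2 + l$3 = trace S" by (rule t)
  have s: "S$2$1 = S$1$2" "S$3$1 = S$1$3" "S$3$2 = S$2$3"
    using sym by (simp_all add: transpose_def vec_eq_iff)
  have "(l$1)\<^sup>2 + (l$2)\<^sup>2 + (l$3)\<^sup>2 = (l$1 + l$2 + l$3)\<^sup>2 - 2 * (l$1 * l$2 + l$1 * l$3 + l$2 * l$3)"
    by (simp add: power2_eq_square algebra_simps)
  also have "\<dots> = (\<Sum>i\<in>UNIV. \<Sum>j\<in>UNIV. (S$i$j)\<^sup>2)"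
    unfolding t m by (simp add: trace_def minors2_def sum_3 s power2_eq_square algebra_simps)
  finally show "(l$1)\<^sup>2 + (l$2)\<^sup>2 + (l$3)\<^sup>2 = (\<Sum>i\<in>UNIV. \<Sum>j\<in>UNIV. (S$i$j)\<^sup>2)" .
qed

section \<open>Fourier series and the Sobolev embedding\<close>

definition wave :: "real \<Rightarrow> int^3 \<Rightarrow> real^3 \<Rightarrow> complex" where
  "wave L k x = cis (wave_vector L k \<bullet> x)"

lemma wave_vector_add: "wave_vector L (k + l) = wave_vector L k + wave_vector L l"
  by (simp add: wave_vector_def vec_eq_iff add_divide_distrib distrib_left)

lemma wave_vector_uminus: "wave_vector L (- k) = - wave_vector L k"
  by (simp add: wave_vector_def vec_eq_iff)

lemma wave_mult: "wave L k x * wave L l x = wave L (k + l) x"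
  by (simp add: wave_def wave_vector_add inner_add_left cis_mult)

lemma wave_0 [simp]: "wave L 0 x = 1"
  by (simp add: wave_def wave_vector_def inner_vec_def)

lemma norm_wave [simp]: "cmod (wave L k x) = 1"
  by (simp add: wave_def)

lemma continuous_on_wave: "continuous_on S (wave L k)"
  unfolding wave_def by (intro continuous_intros)

lemma wave_vector_axis: "wave_vector L k \<bullet> (r *\<^sub>R axis i 1) = 2 * pi * of_int (k $ i) * r / L"
  by (simp add: wave_vector_def inner_axis)

lemma wave_shift: "wave L k (x + a) = wave L k x * cis (wave_vector L k \<bullet> a)"
  by (simp add: wave_def inner_add_right cis_mult)

lemma box_periodic_wave: "L > 0 \<Longrightarrow> box_periodic L (wave L k)"
  unfolding box_periodic_def wave_shift wave_vector_axis by simp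

lemma box_volume: "L > 0 \<Longrightarrow> box_volume L = L ^ 3"
  by (simp add: box_volume_def box_cell_def content_cbox_cart interval_ne_empty_cart)

lemma integral_cell_const: "L > 0 \<Longrightarrow> integral (box_cell L) (\<lambda>_. c) = box_volume L *\<^sub>R c"
  by (simp add: box_cell_def box_volume_def)

text \<open>A shift by half a wavelength along an axis with \<open>k $ i \<noteq> 0\<close> reverses
  the sign of the wave but keeps its integral.\<close>

lemma wave_orthogonal:
  assumes "L > 0" "k \<noteq> 0"
  shows "integral (box_cell L) (wave L k) = 0"
proof -
  obtain i where i: "k $ i \<noteq> 0" using assms(2) by (auto simp: vec_eq_iff)
  have "wave_vector L k \<bullet> ((L / (2 * of_int (k $ i))) *\<^sub>R axis i 1) = pi"
    using i assms(1) by (simp only: wave_vector_axis) (simp add: field_simps)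
  then have "(\<lambda>x. wave L k (x + (L / (2 * of_int (k $ i))) *\<^sub>R axis i 1)) = (\<lambda>x. - wave L k x)"
    by (simp add: wave_shift)
  then have "integral (box_cell L) (\<lambda>x. - wave L k x) = integral (box_cell L) (wave L k)"
    using cell_shift[OF continuous_on_wave[of UNIV L k] box_periodic_wave[OF assms(1), of k] assms(1), where
        a = "(L / (2 * of_int (k $ i))) *\<^sub>R axis i 1"] by simp
  then show ?thesis by simp
qed

text \<open>Passes from the Lebesgue integral of the definition to the gauge integral in which all
  other identities are stated.\<close>

lemma fourier_coeff_eq:
  assumes "continuous_on UNIV f"
  shows "fourier_coeff L f k = integral (box_cell L) (\<lambda>x. of_real (f x) * wave L (- k) x) / of_real (box_volume L)"
proof -
  have "continuous_on (box_cell L) (\<lambda>x. of_real (f x) * cis (- (wave_vector L k \<bullet> x)))"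
    using assms by (intro continuous_intros) (auto intro: continuous_on_subset)
  then have "set_integrable lborel (box_cell L) (\<lambda>x. of_real (f x) * cis (- (wave_vector L k \<bullet> x)))"
    unfolding set_integrable_def box_cell_def by (intro borel_integrable_compact compact_cbox)
  from set_borel_integral_eq_integral(2)[OF this] show ?thesis
    by (simp add: fourier_coeff_def wave_def wave_vector_uminus)
qed

section \<open>Density of trigonometric polynomials and uniqueness of Fourier coefficients\<close>

inductive trig_poly :: "real \<Rightarrow> (real^3 \<Rightarrow> complex) \<Rightarrow> bool" for L where
  trig_poly_wave: "trig_poly L (\<lambda>x. c * wave L k x)"
| trig_poly_add: "trig_poly L p \<Longrightarrow> trig_poly L q \<Longrightarrow> trig_poly L (\<lambda>x. p x + q x)"

lemma trig_poly_mult: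
  assumes "trig_poly L p" "trig_poly L q"
  shows "trig_poly L (\<lambda>x. p x * q x)"
  using assms
proof (induction p)
  case (trig_poly_wave c k)
  then show ?case
  proof (induction q)
    case (trig_poly_wave d l)
    have "(\<lambda>x. c * wave L k x * (d * wave L l x)) = (\<lambda>x. c * d * wave L (k + l) x)"
      by (simp add: wave_mult[symmetric] mult_ac)
    then show ?case using trig_poly.trig_poly_wave[of L "c * d" "k + l"] by simp
  next
    case (trig_poly_add p q)
    then show ?case using trig_poly.trig_poly_add by (simp add: distrib_left)
  qed
next
  case (trig_poly_add p r)
  then show ?case using trig_poly.trig_poly_add by (simp add: distrib_right)
qed

lemma trig_poly_const: "trig_poly L (\<lambda>x. c)"
  using trig_poly_wave[of L c 0] by simp

lemma continuous_on_trig_poly: "trig_poly L p \<Longrightarrow> continuous_on S p"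
  by (induction rule: trig_poly.induct) (auto intro!: continuous_intros continuous_on_wave)

text \<open>Realises the torus as a compact set, where the Stone-Weierstrass theorem applies.\<close>

definition circle_map :: "real \<Rightarrow> real^3 \<Rightarrow> complex^3" where
  "circle_map L x = (\<chi> i. cis (2 * pi * x $ i / L))"

lemma continuous_on_circle_map: "continuous_on S (circle_map L)"
  unfolding circle_map_def divide_inverse by (intro continuous_intros)

lemma box_periodic_shift_lattice:
  assumes "box_periodic L f" "\<And>i. y $ i = x $ i + of_int (n i) * L"
  shows "f y = f x"
proof -
  have "y = x + (of_int (n 1) * L) *\<^sub>R axis 1 1 + (of_int (n 2) * L) *\<^sub>R axis 2 1 + (of_int (n 3) * L) *\<^sub>R axis 3 1"
    using assms(2) by (simp add: vec_eq_iff forall_3 axis_def)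
  then show ?thesis by (simp only: box_periodic_int[OF assms(1)])
qed

lemma circle_map_eq:
  assumes "circle_map L x = circle_map L y" "box_periodic L f" "L > 0"
  shows "f x = f y"
proof -
  have "\<exists>n::int. x $ i = y $ i + of_int n * L" for i
  proof -
    have "cis (2 * pi * x $ i / L) = cis (2 * pi * y $ i / L)"
      using assms(1) by (simp add: circle_map_def vec_eq_iff)
    then obtain n :: int where "2 * pi * x $ i / L = 2 * pi * y $ i / L + 2 * pi * of_int n"
      using sin_cos_eq_iff by (metis cis.sel mult.commute)
    then have "pi * (x $ i) = pi * (y $ i + of_int n * L)" using assms(3) by (simp add: field_simps)
    then show ?thesis by (intro exI[of _ n]) simp
  qed
  then obtain n :: "3 \<Rightarrow> int" where "\<And>i. x $ i = y $ i + of_int (n i) * L" by metis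
  then show ?thesis by (rule box_periodic_shift_lattice[OF assms(2)])
qed

lemma cell_reduce:
  fixes x :: "real^3"
  assumes "L > 0"
  obtains y n where "y \<in> box_cell L" "\<And>i. y $ i = x $ i + of_int (n i) * L"
proof -
  define n :: "3 \<Rightarrow> int" where "n i = - \<lfloor>x $ i / L\<rfloor>" for i
  define y where "y = (\<chi> i. x $ i + of_int (n i) * L)"
  have "0 \<le> y $ i \<and> y $ i \<le> L" for i
    using assms floor_divide_lower[of L "x $ i"] floor_divide_upper[of L "x $ i"]
    by (simp add: y_def n_def algebra_simps)
  then have "y \<in> box_cell L" by (simp add: box_cell_def mem_box_cart)
  then show ?thesis using that[of y n] by (simp add: y_def)
qed

lemma circle_map_reduce:
  assumes "L > 0"
  obtains y where "y \<in> box_cell L" "circle_map L y = circle_map L x"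
proof -
  obtain y n where y: "y \<in> box_cell L" "\<And>i. y $ i = x $ i + of_int (n i) * L"
    using cell_reduce[OF assms] by metis
  have "cis (2 * pi * y $ i / L) = cis (2 * pi * x $ i / L)" for i
  proof -
    have "2 * pi * y $ i / L = 2 * pi * x $ i / L + 2 * pi * of_int (n i)"
      using assms by (simp add: y(2) field_simps)
    then show ?thesis by (simp add: cis_multiple_2pi flip: cis_mult)
  qed
  then show ?thesis using that y(1) by (simp add: circle_map_def)
qed

lemma trig_poly_real_polynomial:
  assumes "real_polynomial_function p" "L > 0"
  shows "trig_poly L (\<lambda>x. of_real (p (circle_map L x)))"
  using assms(1)
proof induction
  case (linear f)
  interpret bounded_linear f by fact
  have w: "wave L (axis i 1) x = cis (2 * pi * x $ i / L)" "wave L (- axis i 1) x = cis (- (2 * pi * x $ i / L))" for i x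
  proof -
    have "wave_vector L (axis i 1) = (2 * pi / L) *\<^sub>R axis i 1"
      by (simp add: wave_vector_def vec_eq_iff axis_def)
    then show "wave L (axis i 1) x = cis (2 * pi * x $ i / L)" "wave L (- axis i 1) x = cis (- (2 * pi * x $ i / L))"
      by (simp_all add: wave_def wave_vector_uminus inner_axis')
  qed
  \<comment> \<open>A real-linear functional sees the real and imaginary parts of each coordinate
    separately; these are a cosine and a sine, written here through the two waves along axis
    i.\<close>
  define q where "q i x = of_real (f (axis i 1)) * ((1/2) * wave L (axis i 1) x + (1/2) * wave L (- axis i 1) x)
      + of_real (f (axis i \<i>)) * ((-\<i>/2) * wave L (axis i 1) x + (\<i>/2) * wave L (- axis i 1) x)" for i x
  have tq: "trig_poly L (q i)" for i
    unfolding q_def by (intro trig_poly_add trig_poly_mult trig_poly_wave trig_poly_const)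
  have "of_real (f (circle_map L x)) = q 1 x + q 2 x + q 3 x" for x
  proof -
    define z where "z = circle_map L x"
    have "z = (\<Sum>i\<in>UNIV. Re (z $ i) *\<^sub>R axis i 1 + Im (z $ i) *\<^sub>R axis i \<i>)"
      by (simp add: vec_eq_iff sum_3 forall_3 axis_def complex_eq_iff)
    then have "f z = f (\<Sum>i\<in>UNIV. Re (z $ i) *\<^sub>R axis i 1 + Im (z $ i) *\<^sub>R axis i \<i>)"
      by (rule arg_cong)
    moreover define r where "r i = Re (z $ i) * f (axis i 1) + Im (z $ i) * f (axis i \<i>)" for i
    ultimately have "f z = r 1 + r 2 + r 3"
      by (simp only: sum add scaleR real_scaleR_def sum_3)
    moreover have "of_real (r i) = q i x" for i
      by (simp add: r_def z_def circle_map_def q_def w complex_eq_iff)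
    ultimately show ?thesis unfolding z_def[symmetric] by simp
  qed
  then show ?case using tq by (auto intro!: trig_poly_add)
next
  case (const c)
  then show ?case using trig_poly_const by simp
next
  case (add f g)
  then show ?case using trig_poly_add by simp
next
  case (mult f g)
  then show ?case using trig_poly_mult by simp
qed

lemma trig_poly_dense:
  fixes u :: "real^3 \<Rightarrow> real"
  assumes u: "continuous_on UNIV u" "box_periodic L u" and L: "L > 0" and e: "e > 0"
  obtains p where "trig_poly L p" "\<And>x. cmod (of_real (u x) - p x) < e"
proof -
  define S where "S = circle_map L ` box_cell L"
  have S: "compact S" unfolding S_def box_cell_def
    by (intro compact_continuous_image continuous_on_circle_map compact_cbox)
  define g where "g z = u (SOME x. circle_map L x = z)" for z
  have g: "g (circle_map L x) = u x" for x
    unfolding g_def by (rule circle_map_eq[OF _ u(2) L]) (metis (mono_tags) someI)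
  have "continuous_on S g"
  \<comment> \<open>\<open>g\<close> is defined by choosing preimages, so its continuity comes from
    compactness: the preimage of a closed set is the image under \<open>circle_map L\<close> of a
    compact part of the cell.\<close>
  proof (subst continuous_on_closed_vimage)
    show "closed S" using S by (rule compact_imp_closed)
    show "\<forall>B. closed B \<longrightarrow> closed (g -` B \<inter> S)"
    proof (intro allI impI)
      fix B :: "real set" assume B: "closed B"
      have "g -` B \<inter> S = circle_map L ` (box_cell L \<inter> u -` B)"
        using g by (auto simp: S_def)
      moreover have "closed (u -` B)" using u(1) B by (simp add: continuous_closed_vimage continuous_on_eq_continuous_at)
      then have "compact (box_cell L \<inter> u -` B)" unfolding box_cell_def by (intro compact_Int_closed compact_cbox)
      ultimately show "closed (g -` B \<inter> S)"
        by (simp add: compact_imp_closed compact_continuous_image continuous_on_circle_map)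
    qed
  qed
  from Stone_Weierstrass_real_polynomial_function[OF S this e]
  obtain q where q: "real_polynomial_function q" "\<And>z. z \<in> S \<Longrightarrow> \<bar>g z - q z\<bar> < e" by blast
  have "cmod (of_real (u x) - of_real (q (circle_map L x))) < e" for x
  proof -
    obtain y where "y \<in> box_cell L" "circle_map L y = circle_map L x" using circle_map_reduce[OF L] by metis
    then have "circle_map L x \<in> S" by (metis S_def imageI)
    then show ?thesis using q(2)[of "circle_map L x"] g by (simp flip: of_real_diff)
  qed
  then show ?thesis using that trig_poly_real_polynomial[OF q(1) L] by blast
qed

lemma trig_poly_integral_0:
  assumes "trig_poly L p" "continuous_on UNIV d" "\<And>k. integral (box_cell L) (\<lambda>x. d x * wave L k x) = 0"
  shows "integral (box_cell L) (\<lambda>x. d x * p x) = 0"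
  using assms(1)
proof induction
  case (trig_poly_wave c k)
  have "(\<lambda>x. d x * (c * wave L k x)) = (\<lambda>x. c * (d x * wave L k x))" by auto
  then show ?case using assms(3)[of k] by simp
next
  case (trig_poly_add p q)
  have "(\<lambda>x. d x * p x) integrable_on box_cell L" "(\<lambda>x. d x * q x) integrable_on box_cell L"
    using trig_poly_add.hyps[THEN continuous_on_trig_poly] assms(2)
    by (intro continuous_integrable_cell continuous_on_mult; simp)+
  then show ?case using trig_poly_add.IH by (simp add: distrib_left integral_add)
qed

text \<open>A function orthogonal to all waves is orthogonal to trigonometric polynomials, hence to
  their uniform limits, which include every continuous periodic u.\<close>

lemma fourier_unique_real:
  fixes d :: "real^3 \<Rightarrow> complex" and u :: "real^3 \<Rightarrow> real"
  assumes d: "continuous_on UNIV d" "\<And>k. integral (box_cell L) (\<lambda>x. d x * wave L k x) = 0"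
    and u: "continuous_on UNIV u" "box_periodic L u" and L: "L > 0"
  shows "integral (box_cell L) (\<lambda>x. d x * of_real (u x)) = 0"
proof -
  define B where "B = integral (box_cell L) (\<lambda>x. cmod (d x))"
  have "cmod (integral (box_cell L) (\<lambda>x. d x * of_real (u x))) \<le> e * B" if e: "e > 0" for e
  proof -
    obtain p where p: "trig_poly L p" "\<And>x. cmod (of_real (u x) - p x) < e"
      using trig_poly_dense[OF u L e] by blast
    have i: "(\<lambda>x. d x * of_real (u x)) integrable_on box_cell L" "(\<lambda>x. d x * p x) integrable_on box_cell L"
      by (intro continuous_integrable_cell continuous_on_mult continuous_on_of_real d(1) u(1)
          continuous_on_trig_poly[OF p(1)])+
    have "integral (box_cell L) (\<lambda>x. d x * of_real (u x)) = integral (box_cell L) (\<lambda>x. d x * (of_real (u x) - p x))"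
      using trig_poly_integral_0[OF p(1) d] by (simp only: right_diff_distrib integral_diff[OF i] diff_zero)
    also have "cmod \<dots> \<le> integral (box_cell L) (\<lambda>x. e * cmod (d x))"
    proof (rule integral_norm_bound_integral)
      show "(\<lambda>x. d x * (of_real (u x) - p x)) integrable_on box_cell L"
        using integrable_diff[OF i] by (simp only: right_diff_distrib)
      show "(\<lambda>x. e * cmod (d x)) integrable_on box_cell L"
        using d(1) by (intro continuous_integrable_cell continuous_intros)
      show "cmod (d x * (of_real (u x) - p x)) \<le> e * cmod (d x)" for x
        using less_imp_le[OF p(2)[of x]] by (simp add: norm_mult mult_left_mono mult.commute[of e])
    qed
    finally show ?thesis by (simp add: B_def)
  qed
  note bound = this
  have "cmod (integral (box_cell L) (\<lambda>x. d x * of_real (u x))) \<le> 0"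
  proof (rule field_le_epsilon)
    fix e :: real assume e: "e > 0"
    \<comment> \<open>The approximation error is taken as \<open>e / (\<bar>B\<bar> + 1)\<close>;
      the summand 1 covers \<open>B = 0\<close>.\<close>
    have "B * e \<le> e * (\<bar>B\<bar> + 1)" using e by (simp add: mult.commute mult_left_mono)
    then have "e / (\<bar>B\<bar> + 1) * B \<le> e" by (simp add: field_simps)
    then show "cmod (integral (box_cell L) (\<lambda>x. d x * of_real (u x))) \<le> 0 + e"
      using bound[of "e / (\<bar>B\<bar> + 1)"] e by simp
  qed
  then show ?thesis by simp
qed

lemma cell_square_integral_0:
  fixes u :: "real^3 \<Rightarrow> real"
  assumes u: "continuous_on UNIV u" "box_periodic L u" and L: "L > 0"
    and "integral (box_cell L) (\<lambda>x. (u x)\<^sup>2) = 0"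
  shows "u x = 0"
proof -
  obtain y n where y: "y \<in> box_cell L" "\<And>i. y $ i = x $ i + of_int (n i) * L"
    using cell_reduce[OF L] by metis
  have "box 0 (vec L :: real^3) \<noteq> {}"
    using L by (simp add: interval_ne_empty_cart)
  then have "(u y)\<^sup>2 = 0"
    using has_integral_0_cbox_imp_0[of 0 "vec L :: real^3" "\<lambda>x. (u x)\<^sup>2" y]
      integrable_integral[OF continuous_integrable_cell[of "\<lambda>x. (u x)\<^sup>2" L]] assms(4) y(1)
      continuous_on_subset[OF u(1), of "cbox 0 (vec L)"] u(1)
    by (auto simp: box_cell_def intro!: continuous_on_power)
  then show ?thesis using box_periodic_shift_lattice[OF u(2) y(2)] by simp
qed

text \<open>Testing d against its own real and imaginary parts makes the integrals of their squares
  vanish.\<close>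

lemma fourier_unique:
  fixes d :: "real^3 \<Rightarrow> complex"
  assumes d: "continuous_on UNIV d" "box_periodic L d" "\<And>k. integral (box_cell L) (\<lambda>x. d x * wave L k x) = 0"
    and L: "L > 0"
  shows "d x = 0"
proof -
  have i: "(\<lambda>x. d x * of_real (u x)) integrable_on box_cell L" if "continuous_on UNIV u" for u :: "real^3 \<Rightarrow> real"
    using d(1) that by (intro continuous_integrable_cell continuous_intros)
  have c: "continuous_on UNIV (\<lambda>x. Re (d x))" "continuous_on UNIV (\<lambda>x. Im (d x))"
    using d(1) by (auto intro!: continuous_intros)
  have p: "box_periodic L (\<lambda>x. Re (d x))" "box_periodic L (\<lambda>x. Im (d x))"
    using d(2) by (auto simp: box_periodic_def)
  have "integral (box_cell L) (\<lambda>x. (Re (d x))\<^sup>2) = Re (integral (box_cell L) (\<lambda>x. d x * of_real (Re (d x))))"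
    using integral_linear[OF i[OF c(1)] bounded_linear_Re] by (simp add: o_def power2_eq_square)
  moreover have "integral (box_cell L) (\<lambda>x. (Im (d x))\<^sup>2) = Im (integral (box_cell L) (\<lambda>x. d x * of_real (Im (d x))))"
    using integral_linear[OF i[OF c(2)] bounded_linear_Im] by (simp add: o_def power2_eq_square)
  ultimately have "Re (d x) = 0" "Im (d x) = 0"
    using fourier_unique_real[OF d(1,3) c(1) p(1) L] fourier_unique_real[OF d(1,3) c(2) p(2) L]
      cell_square_integral_0[OF c(1) p(1) L] cell_square_integral_0[OF c(2) p(2) L] by auto
  then show ?thesis by (simp add: complex_eq_iff)
qed

section \<open>The lattice sum behind the Sobolev embedding\<close>

definition weight :: "real \<Rightarrow> int^3 \<Rightarrow> real" where
  "weight L k = 1 + (norm (wave_vector L k))\<^sup>2"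

lemma weight_ge_1: "weight L k \<ge> 1"
  by (simp add: weight_def)

text \<open>The exponent -2/3 is a third of -2, so that the product over three coordinates matches
  the inverse square of \<open>weight\<close>; the terms with j \<noteq> 0 are at most |j| to the
  power -4/3, which is still summable.\<close>

lemma int_symmetric_sum_bound:
  "\<exists>B. \<forall>N::int. (\<Sum>j\<in>{-N..N}. (1 + (real_of_int j)\<^sup>2) powr (-2/3)) \<le> B"
proof -
  define a where "a n = (1 + (real n)\<^sup>2) powr (-2/3)" for n
  have s: "summable a"
  proof (rule summable_comparison_test_ev)
    show "summable (\<lambda>n. real n powr (-4/3))" by (simp add: summable_real_powr_iff)
    show "\<forall>\<^sub>F n in sequentially. norm (a n) \<le> real n powr (-4/3)"
      using eventually_gt_at_top[of 0]
    proof eventually_elim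
      case (elim n)
      have "a n \<le> (real n powr 2) powr (-2/3)"
        unfolding a_def using elim by (intro powr_mono2') (auto simp: powr_numeral)
      also have "\<dots> = real n powr (-4/3)" by (subst powr_powr) simp
      finally show ?case by (simp add: a_def)
    qed
  qed
  have "(\<Sum>j\<in>{-N..N}. (1 + (real_of_int j)\<^sup>2) powr (-2/3)) \<le> 2 * suminf a" for N :: int
  proof -
    define A where "A = {..nat N}"
    have sub: "{-N..N} \<subseteq> int ` A \<union> (\<lambda>n. - int n) ` A"
    proof
      fix j assume "j \<in> {-N..N}"
      then have "nat \<bar>j\<bar> \<in> A" "j = int (nat \<bar>j\<bar>) \<or> j = - int (nat \<bar>j\<bar>)" by (auto simp: A_def)
      then show "j \<in> int ` A \<union> (\<lambda>n. - int n) ` A" by blast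
    qed
    let ?g = "\<lambda>j::int. (1 + (real_of_int j)\<^sup>2) powr (-2/3)"
    have "sum ?g {-N..N} \<le> sum ?g (int ` A \<union> (\<lambda>n. - int n) ` A)"
      by (rule sum_mono2[OF _ sub]) (auto simp: A_def)
    also have "\<dots> \<le> sum ?g (int ` A) + sum ?g ((\<lambda>n. - int n) ` A)"
      by (subst sum_Un) (auto simp: A_def intro!: sum_nonneg)
    also have "\<dots> = 2 * sum a A"
      by (simp add: sum.reindex inj_on_def a_def)
    also have "sum a A \<le> suminf a"
      using s by (intro sum_le_suminf) (auto simp: a_def A_def)
    finally show ?thesis by simp
  qed
  then show ?thesis by blast
qed

text \<open>Bounding the weight by a product over the coordinates reduces the sum over the lattice to the
  series of \<open>n\<^bsup>-4/3\<^esup>\<close>.\<close>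

lemma weight_product_bound:
  assumes "L > 0"
  shows "1 / (weight L k)\<^sup>2 \<le> 1 / (min 1 ((2 * pi / L)\<^sup>2))\<^sup>2 * (\<Prod>i\<in>UNIV. (1 + (real_of_int (k $ i))\<^sup>2) powr (-2/3))"
proof -
  \<comment> \<open>\<open>c\<close> absorbs the size of the box: it gives
    \<open>weight L k \<ge> c * (1 + s)\<close> with s the squared length of the integer
    vector.\<close>
  define c where "c = min 1 ((2 * pi / L)\<^sup>2)"
  define P where "P = (\<Prod>i\<in>UNIV. (1 + (real_of_int (k $ i))\<^sup>2) powr (-2/3))"
  define s where "s = (\<Sum>i\<in>UNIV. (real_of_int (k $ i))\<^sup>2)"
  have c: "c > 0" "c \<le> 1" "c \<le> (2 * pi / L)\<^sup>2" using assms by (auto simp: c_def)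
  have s: "s \<ge> 0" by (simp add: s_def sum_nonneg)
  have "(norm (wave_vector L k))\<^sup>2 = (2 * pi / L)\<^sup>2 * s"
    unfolding power2_norm_eq_inner
    by (simp add: inner_vec_def wave_vector_def s_def sum_distrib_left sum_divide_distrib power2_eq_square field_simps)
  moreover have "c * s \<le> (2 * pi / L)\<^sup>2 * s" using c(3) s by (rule mult_right_mono)
  ultimately have w: "weight L k \<ge> c * (1 + s)"
    using c by (simp add: weight_def distrib_left)
  have "1 / (1 + s)\<^sup>2 \<le> P"
  proof -
    have "(\<Prod>i\<in>(UNIV::3 set). (1 + s) powr (-2/3)) \<le> P" unfolding P_def
    proof (rule prod_mono)
      fix i :: 3
      have "(real_of_int (k $ i))\<^sup>2 \<le> s" unfolding s_def by (rule member_le_sum) auto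
      then show "0 \<le> (1 + s) powr (-2/3) \<and> (1 + s) powr (-2/3) \<le> (1 + (real_of_int (k $ i))\<^sup>2) powr (-2/3)"
        by (auto intro!: powr_mono2' simp: add_pos_nonneg)
    qed
    moreover have "(\<Prod>i\<in>(UNIV::3 set). (1 + s) powr (-2/3)) = (1 + s) powr (-2)"
      using s by (simp add: powr_power)
    moreover have "(1 + s) powr (-2) = 1 / (1 + s)\<^sup>2"
      using s by (simp add: powr_minus_divide powr_numeral)
    ultimately show ?thesis by simp
  qed
  then have "1 / c\<^sup>2 * (1 / (1 + s)\<^sup>2) \<le> 1 / c\<^sup>2 * P" using c by (intro mult_left_mono) auto
  moreover have "1 / (weight L k)\<^sup>2 \<le> 1 / (c * (1 + s))\<^sup>2"
    using w c(1) s weight_ge_1[of L k] by (intro divide_left_mono power_mono mult_pos_pos zero_less_power) auto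
  ultimately show ?thesis unfolding c_def[symmetric] P_def[symmetric] by (simp add: power_mult_distrib)
qed

text \<open>The terms decay like |k|^-4 in dimension three. Every finite set of frequencies lies in
  a cube, over which the product bound factors into three one-dimensional sums.\<close>

lemma weight_summable:
  assumes "L > 0"
  shows "(\<lambda>k. 1 / (weight L k)\<^sup>2) summable_on UNIV"
proof (rule nonneg_bdd_above_summable_on)
  let ?a = "\<lambda>j::int. (1 + (real_of_int j)\<^sup>2) powr (-2/3)"
  define C where "C = 1 / (min 1 ((2 * pi / L)\<^sup>2))\<^sup>2"
  have C: "C \<ge> 0" by (simp add: C_def)
  obtain B where B: "\<And>N::int. sum ?a {-N..N} \<le> B" using int_symmetric_sum_bound by blast
  have "sum (\<lambda>k. 1 / (weight L k)\<^sup>2) F \<le> C * B ^ 3" if F: "finite F" for F :: "(int^3) set"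
  proof -
    \<comment> \<open>The inserted 0 gives the maximum a meaning for empty F.\<close>
    define N where "N = Max (insert 0 ((\<lambda>(k, i). \<bar>k $ i\<bar>) ` (F \<times> (UNIV :: 3 set))))"
    have N: "\<bar>k $ i\<bar> \<le> N" if "k \<in> F" for k i
      unfolding N_def using that F by (intro Max_ge) (auto intro!: image_eqI[of _ _ "(k, i)"])
    let ?Q = "PiE UNIV (\<lambda>_. {-N..N}) :: (3 \<Rightarrow> int) set"
    have sub: "F \<subseteq> vec_lambda ` ?Q"
    proof
      fix k assume "k \<in> F"
      then have "vec_nth k \<in> ?Q" using N by (auto simp: abs_le_iff minus_le_iff)
      then show "k \<in> vec_lambda ` ?Q" by (metis imageI vec_nth_inverse)
    qed
    have fin: "finite ?Q" by (intro finite_PiE) auto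
    have "sum (\<lambda>k. 1 / (weight L k)\<^sup>2) F \<le> (\<Sum>k\<in>F. C * (\<Prod>i\<in>UNIV. ?a (k $ i)))"
      unfolding C_def by (intro sum_mono weight_product_bound assms)
    also have "\<dots> \<le> (\<Sum>k\<in>vec_lambda ` ?Q. C * (\<Prod>i\<in>UNIV. ?a (k $ i)))"
      using fin sub C by (intro sum_mono2) (auto intro!: mult_nonneg_nonneg prod_nonneg)
    also have "\<dots> = C * (\<Sum>q\<in>?Q. \<Prod>i\<in>UNIV. ?a (q i))"
      by (subst sum.reindex) (auto simp: inj_on_def sum_distrib_left vec_lambda_inject)
    also have "(\<Sum>q\<in>?Q. \<Prod>i\<in>UNIV. ?a (q i)) = (\<Prod>i\<in>(UNIV::3 set). sum ?a {-N..N})"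
      by (rule prod_sum_PiE[symmetric]) auto
    also have "\<dots> = (sum ?a {-N..N}) ^ 3" by simp
    also have "C * \<dots> \<le> C * B ^ 3"
      using B C by (intro mult_left_mono power_mono) (auto intro!: sum_nonneg)
    finally show ?thesis .
  qed
  then show "bdd_above (sum (\<lambda>k. 1 / (weight L k)\<^sup>2) ` {F. F \<subseteq> UNIV \<and> finite F})"
    by (intro bdd_aboveI[of _ "C * B ^ 3"]) auto
qed auto

text \<open>Unordered sums converge along finite sets; enumerating the lattice turns this into the
  sequential convergence under which limits are differentiated.\<close>

lemma filterlim_enum:
  "filterlim (\<lambda>n. from_nat_into (UNIV :: (int^3) set) ` {..<n}) (finite_subsets_at_top UNIV) sequentially"
  unfolding filterlim_finite_subsets_at_top
proof (intro allI impI)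
  fix X :: "(int^3) set" assume X: "finite X \<and> X \<subseteq> UNIV"
  define t where "t = to_nat_on (UNIV :: (int^3) set)"
  have t: "from_nat_into UNIV (t x) = x" for x :: "int^3" by (simp add: t_def)
  show "\<forall>\<^sub>F n in sequentially. finite (from_nat_into UNIV ` {..<n}) \<and> X \<subseteq> from_nat_into UNIV ` {..<n}
      \<and> from_nat_into UNIV ` {..<n} \<subseteq> UNIV"
    using eventually_gt_at_top[of "Max (insert 0 (t ` X))"]
  proof eventually_elim
    case (elim n)
    have "x \<in> from_nat_into UNIV ` {..<n}" if "x \<in> X" for x
    proof (rule image_eqI[of _ _ "t x"])
      show "t x \<in> {..<n}" using that X elim by (simp add: le_less_trans)
    qed (simp add: t)
    then show ?case by auto
  qed
qed

text \<open>The common majorant M makes the series and the series of gradients converge uniformly,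
  so differentiation may be carried out term by term and the resulting gradient is
  continuous.\<close>

lemma has_gradient_infsum:
  fixes f :: "int^3 \<Rightarrow> real^3 \<Rightarrow> real"
  assumes f: "\<And>k. has_gradient (f k) (G k)"
    and b: "\<And>k x. \<bar>f k x\<bar> \<le> M k" "\<And>k x. norm (G k x) \<le> M k"
    and s: "M summable_on UNIV"
  shows "has_gradient (\<lambda>x. \<Sum>\<^sub>\<infinity>k. f k x) (\<lambda>x. \<Sum>\<^sub>\<infinity>k. G k x)"
proof -
  have uf: "uniform_limit UNIV (\<lambda>X x. \<Sum>k\<in>X. f k x) (\<lambda>x. \<Sum>\<^sub>\<infinity>k. f k x) (finite_subsets_at_top UNIV)"
    by (rule Weierstrass_m_test_general[OF _ s]) (use b in auto)
  have uG: "uniform_limit UNIV (\<lambda>X x. \<Sum>k\<in>X. G k x) (\<lambda>x. \<Sum>\<^sub>\<infinity>k. G k x) (finite_subsets_at_top UNIV)"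
    by (rule Weierstrass_m_test_general[OF _ s]) (use b in auto)
  define A where "A n = from_nat_into (UNIV :: (int^3) set) ` {..<n}" for n
  have uf': "uniform_limit UNIV (\<lambda>n x. \<Sum>k\<in>A n. f k x) (\<lambda>x. \<Sum>\<^sub>\<infinity>k. f k x) sequentially"
    using filterlim_compose[OF uf filterlim_enum] by (simp add: A_def)
  have uG': "uniform_limit UNIV (\<lambda>n x. \<Sum>k\<in>A n. G k x) (\<lambda>x. \<Sum>\<^sub>\<infinity>k. G k x) sequentially"
    using filterlim_compose[OF uG filterlim_enum] by (simp add: A_def)
  have "\<exists>g. \<forall>x\<in>UNIV. (\<lambda>n. \<Sum>k\<in>A n. f k x) \<longlonglongrightarrow> g x \<and>
      (g has_derivative (\<lambda>h. (\<Sum>\<^sub>\<infinity>k. G k x) \<bullet> h)) (at x within UNIV)"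
  proof (rule has_derivative_sequence)
    show "((\<lambda>x. \<Sum>k\<in>A n. f k x) has_derivative (\<lambda>h. (\<Sum>k\<in>A n. G k x) \<bullet> h)) (at x within UNIV)" for n x
    proof -
      have "((\<lambda>x. \<Sum>k\<in>A n. f k x) has_derivative (\<lambda>h. \<Sum>k\<in>A n. G k x \<bullet> h)) (at x)"
        by (intro has_derivative_sum has_gradientD(2) f)
      then show ?thesis by (simp add: inner_sum_left)
    qed
    show "(\<lambda>n. \<Sum>k\<in>A n. f k 0) \<longlonglongrightarrow> (\<Sum>\<^sub>\<infinity>k. f k 0)"
      using tendsto_uniform_limitI[OF uf'] by simp
    fix e :: real assume "e > 0"
    from uniform_limitD[OF uG' this]
    show "\<forall>\<^sub>F n in sequentially. \<forall>x\<in>UNIV. \<forall>h.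
        norm ((\<Sum>k\<in>A n. G k x) \<bullet> h - (\<Sum>\<^sub>\<infinity>k. G k x) \<bullet> h) \<le> e * norm h"
    proof eventually_elim
      case (elim n)
      have "norm ((\<Sum>k\<in>A n. G k x) \<bullet> h - (\<Sum>\<^sub>\<infinity>k. G k x) \<bullet> h) \<le> e * norm h" for x h
      proof -
        have "norm ((\<Sum>k\<in>A n. G k x) \<bullet> h - (\<Sum>\<^sub>\<infinity>k. G k x) \<bullet> h)
            \<le> norm ((\<Sum>k\<in>A n. G k x) - (\<Sum>\<^sub>\<infinity>k. G k x)) * norm h"
          unfolding inner_diff_left[symmetric] real_norm_def by (rule Cauchy_Schwarz_ineq2)
        also have "\<dots> \<le> e * norm h"
          using elim[rule_format, of x] by (intro mult_right_mono) (auto simp: dist_norm)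
        finally show ?thesis .
      qed
      then show ?case by blast
    qed
  qed auto
  then obtain g where g: "\<And>x. (\<lambda>n. \<Sum>k\<in>A n. f k x) \<longlonglongrightarrow> g x"
      "\<And>x. (g has_derivative (\<lambda>h. (\<Sum>\<^sub>\<infinity>k. G k x) \<bullet> h)) (at x)" by auto
  have "g = (\<lambda>x. \<Sum>\<^sub>\<infinity>k. f k x)"
  proof
    fix x show "g x = (\<Sum>\<^sub>\<infinity>k. f k x)"
      using LIMSEQ_unique[OF g(1)] tendsto_uniform_limitI[OF uf', of x] by simp
  qed
  moreover have "continuous_on UNIV (\<lambda>x. \<Sum>\<^sub>\<infinity>k. G k x)"
    by (rule uniform_limit_theorem[OF _ uG'])
      (auto intro!: always_eventually continuous_on_sum has_gradientD(1)[OF f])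
  ultimately show ?thesis using g(2) by (simp add: has_gradient_def)
qed

lemma has_gradient_wave: "has_gradient (\<lambda>x. Re (c * wave L k x)) (\<lambda>x. Re (\<i> * c * wave L k x) *\<^sub>R wave_vector L k)"
proof (rule has_gradientI)
  show "continuous_on UNIV (\<lambda>x. Re (\<i> * c * wave L k x) *\<^sub>R wave_vector L k)"
    by (intro continuous_intros continuous_on_wave)
  fix x
  have "((\<lambda>x. wave_vector L k \<bullet> x) has_derivative (\<lambda>h. wave_vector L k \<bullet> h)) (at x)"
    by (auto intro!: derivative_eq_intros)
  then show "((\<lambda>x. Re (c * wave L k x)) has_derivative
      (\<lambda>h. Re (c * ((wave_vector L k \<bullet> h) *\<^sub>R (\<i> * wave L k x))))) (at x)"
    unfolding wave_def by (auto intro!: derivative_eq_intros simp: algebra_simps)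
  fix h
  show "Re (c * ((wave_vector L k \<bullet> h) *\<^sub>R (\<i> * wave L k x))) = (Re (\<i> * c * wave L k x) *\<^sub>R wave_vector L k) \<bullet> h"
    by (simp add: algebra_simps)
qed

text \<open>Absolute summability makes the series converge uniformly to a continuous F. Termwise
  integration shows that F has the coefficients of f, and uniqueness gives equality.\<close>

lemma fourier_expansion:
  assumes f: "continuous_on UNIV f" "box_periodic L f" and L: "L > 0"
    and s: "(\<lambda>k. cmod (fourier_coeff L f k)) summable_on UNIV"
  shows "of_real (f x) = (\<Sum>\<^sub>\<infinity>k. fourier_coeff L f k * wave L k x)"
proof -
  define c where "c = fourier_coeff L f"
  define F where "F x = (\<Sum>\<^sub>\<infinity>k. c k * wave L k x)" for x
  have uF: "uniform_limit UNIV (\<lambda>X x. \<Sum>k\<in>X. c k * wave L k x) F (finite_subsets_at_top UNIV)"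
    unfolding F_def by (rule Weierstrass_m_test_general[OF _ s]) (simp add: norm_mult c_def)
  have cF: "continuous_on UNIV F"
    by (rule uniform_limit_theorem[OF _ uF])
      (auto intro!: always_eventually continuous_intros continuous_on_wave)
  have pF: "box_periodic L F"
    using box_periodic_wave[OF L] by (simp add: F_def box_periodic_def)
  have V: "box_volume L > 0" using L by (simp add: box_volume)
  have int_F: "integral (box_cell L) (\<lambda>x. F x * wave L l x) = c (- l) * box_volume L" for l
  proof -
    have "uniform_limit (cbox 0 (vec L)) (\<lambda>X x. \<Sum>k\<in>X. c k * wave L k x * wave L l x)
        (\<lambda>x. \<Sum>\<^sub>\<infinity>k. c k * wave L k x * wave L l x) (finite_subsets_at_top UNIV)"
      by (rule Weierstrass_m_test_general[OF _ s]) (simp add: norm_mult c_def)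
    moreover have "(\<Sum>\<^sub>\<infinity>k. c k * wave L k x * wave L l x) = F x * wave L l x" for x
      unfolding F_def by (rule infsum_cmult_left')
    ultimately have u: "uniform_limit (cbox 0 (vec L)) (\<lambda>X x. \<Sum>k\<in>X. c k * wave L k x * wave L l x)
        (\<lambda>x. F x * wave L l x) (finite_subsets_at_top UNIV)" by simp
    have cont: "continuous_on S (\<lambda>x. c k * wave L k x * wave L l x)" for S k
      by (intro continuous_intros continuous_on_wave)
    have cs: "continuous_on (cbox 0 (vec L)) (\<lambda>x. \<Sum>k\<in>X. c k * wave L k x * wave L l x)" for X
      by (intro continuous_on_sum cont)
    obtain I J where I: "\<And>X. ((\<lambda>x. \<Sum>k\<in>X. c k * wave L k x * wave L l x) has_integral I X) (cbox 0 (vec L))"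
      and J: "((\<lambda>x. F x * wave L l x) has_integral J) (cbox 0 (vec L))"
      and lim: "(I \<longlongrightarrow> J) (finite_subsets_at_top UNIV)"
      using uniform_limit_integral_cbox[OF u cs finite_subsets_at_top_neq_bot] by blast
    \<comment> \<open>By orthogonality the integral of a partial sum no longer changes once X
      contains \<open>- l\<close>, so the limit is that value.\<close>
    have "\<forall>\<^sub>F X in finite_subsets_at_top UNIV. finite X \<and> {- l} \<subseteq> X \<and> X \<subseteq> UNIV"
      unfolding eventually_finite_subsets_at_top by (rule exI[of _ "{- l}"]) auto
    then have "\<forall>\<^sub>F X in finite_subsets_at_top UNIV. I X = c (- l) * box_volume L"
    proof eventually_elim
      case (elim X)
      have orth: "integral (box_cell L) (\<lambda>x. c k * wave L k x * wave L l x) = (if k = - l then c k * box_volume L else 0)" for k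
      proof -
        have "(\<lambda>x. c k * wave L k x * wave L l x) = (\<lambda>x. c k * wave L (k + l) x)"
          by (simp add: mult.assoc wave_mult)
        then have "integral (box_cell L) (\<lambda>x. c k * wave L k x * wave L l x) = c k * integral (box_cell L) (wave L (k + l))"
          by simp
        also have "integral (box_cell L) (wave L (k + l)) = (if k = - l then box_volume L else 0)"
        proof (cases "k = - l")
          case True
          then have "wave L (k + l) = (\<lambda>_. 1)" by auto
          then show ?thesis using True integral_cell_const[OF L, of "1::complex"] by (simp add: scaleR_conv_of_real)
        next
          case False
          then have "k + l \<noteq> 0" by (simp add: add_eq_0_iff2)
          then show ?thesis using False wave_orthogonal[OF L] by simp
        qed
        finally show ?thesis by simp
      qed
      have "I X = integral (box_cell L) (\<lambda>x. \<Sum>k\<in>X. c k * wave L k x * wave L l x)"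
        using I[of X] by (simp add: box_cell_def integral_unique)
      also have "\<dots> = (\<Sum>k\<in>X. integral (box_cell L) (\<lambda>x. c k * wave L k x * wave L l x))"
        using elim by (intro integral_sum continuous_integrable_cell cont) auto
      also have "\<dots> = c (- l) * box_volume L"
        unfolding orth using elim by (simp add: sum.delta)
      finally show ?case .
    qed
    then have "(I \<longlongrightarrow> c (- l) * box_volume L) (finite_subsets_at_top UNIV)"
      by (rule tendsto_eventually)
    with lim have "J = c (- l) * box_volume L"
      using tendsto_unique finite_subsets_at_top_neq_bot by blast
    then show ?thesis using J by (simp add: box_cell_def integral_unique)
  qed
  have int_f: "integral (box_cell L) (\<lambda>x. of_real (f x) * wave L l x) = c (- l) * box_volume L" for l
    using fourier_coeff_eq[OF f(1), of L "- l"] V by (simp add: c_def)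
  have "of_real (f x) - F x = 0"
  proof (rule fourier_unique[OF _ _ _ L])
    show "continuous_on UNIV (\<lambda>x. of_real (f x) - F x)"
      by (intro continuous_intros f(1) cF)
    show "box_periodic L (\<lambda>x. of_real (f x) - F x)"
      using f(2) pF by (simp add: box_periodic_def)
    fix l
    have "(\<lambda>x. of_real (f x) * wave L l x) integrable_on box_cell L" "(\<lambda>x. F x * wave L l x) integrable_on box_cell L"
      by (intro continuous_integrable_cell continuous_on_mult continuous_on_of_real f(1) cF continuous_on_wave)+
    then show "integral (box_cell L) (\<lambda>x. (of_real (f x) - F x) * wave L l x) = 0"
      by (simp add: left_diff_distrib integral_diff int_F int_f)
  qed
  then show ?thesis by (simp add: F_def c_def)
qed

text \<open>Cauchy-Schwarz for the product of weight^-1 and weight^(3/2) |c|, in the additive form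
  with a free parameter \<eta>; \<open>m \<ge> 3\<close> bounds weight^3 by weight^m. Keeping \<eta>
  free allows it to be chosen small before N tends to 0.\<close>

lemma sobolev_embedding:
  fixes f :: "real^3 \<Rightarrow> real"
  assumes f: "continuous_on UNIV f" "box_periodic L f" and L: "L > 0" and m: "m \<ge> 3"
    and s: "sobolev_term m L f summable_on UNIV"
  defines "A \<equiv> \<Sum>\<^sub>\<infinity>k. 1 / (weight L k)\<^sup>2" and "N \<equiv> \<Sum>\<^sub>\<infinity>k. sobolev_term m L f k"
  shows "\<exists>G. has_gradient f G \<and> (\<forall>\<eta>>0. \<forall>x. \<bar>f x\<bar> \<le> (\<eta> * A + N / \<eta>) / 2 \<and> norm (G x) \<le> (\<eta> * A + N / \<eta>) / 2)"
proof -
  define c where "c = fourier_coeff L f"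
  \<comment> \<open>One majorant for both series: \<open>sqrt (weight L k)\<close> is at least 1 and
    at least the length of the wave vector.\<close>
  define M where "M k = sqrt (weight L k) * cmod (c k)" for k
  have w: "weight L k > 0" "weight L k \<ge> 1" for k using weight_ge_1[of L k] by auto
  have M: "M k \<le> (\<eta> * (1 / (weight L k)\<^sup>2) + sobolev_term m L f k / \<eta>) / 2" if \<eta>: "\<eta> > 0" for k \<eta>
  proof -
    define a where "a = 1 / weight L k"
    define b where "b = weight L k * M k"
    have "0 \<le> (\<eta> * a - b)\<^sup>2" by simp
    then have "2 * \<eta> * (a * b) \<le> \<eta>\<^sup>2 * a\<^sup>2 + b\<^sup>2" by (simp add: power2_eq_square algebra_simps)
    then have "a * b \<le> (\<eta> * a\<^sup>2 + b\<^sup>2 / \<eta>) / 2" using \<eta> by (simp add: field_simps power2_eq_square)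
    moreover have "a * b = M k" using w(1)[of k] by (simp add: a_def b_def)
    moreover have "a\<^sup>2 = 1 / (weight L k)\<^sup>2" by (simp add: a_def power_divide)
    moreover have "b\<^sup>2 = weight L k ^ 3 * (cmod (c k))\<^sup>2"
      using w(1)[of k] by (simp add: b_def M_def power_mult_distrib power2_eq_square power3_eq_cube)
    moreover have "weight L k ^ 3 * (cmod (c k))\<^sup>2 \<le> sobolev_term m L f k"
      unfolding sobolev_term_def c_def weight_def[symmetric]
      using power_increasing[OF m w(2)[of k]] by (intro mult_right_mono) auto
    ultimately show ?thesis using \<eta> by (smt (verit) divide_right_mono)
  qed
  have sum_bound: "((\<lambda>k. (\<eta> * (1 / (weight L k)\<^sup>2) + sobolev_term m L f k / \<eta>) / 2) has_sum (\<eta> * A + N / \<eta>) / 2) UNIV" for \<eta>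
  proof -
    have h: "((\<lambda>k. 1 / (weight L k)\<^sup>2) has_sum A) UNIV" "(sobolev_term m L f has_sum N) UNIV"
      unfolding A_def N_def using weight_summable[OF L] s by (auto intro: has_sum_infsum)
    have "((\<lambda>k. (\<eta> * (1 / (weight L k)\<^sup>2) + sobolev_term m L f k * (1 / \<eta>)) * (1/2)) has_sum ((\<eta> * A + N * (1/\<eta>)) * (1/2))) UNIV"
      by (intro has_sum_cmult_left has_sum_add has_sum_cmult_right h)
    then show ?thesis by simp
  qed
  have M0: "M k \<ge> 0" for k using w(1)[of k] by (simp add: M_def)
  have sM: "M summable_on UNIV"
    by (rule summable_on_comparison_test[OF has_sum_imp_summable[OF sum_bound[of 1]]]) (use M[of 1] M0 in auto)
  have infM: "infsum M UNIV \<le> (\<eta> * A + N / \<eta>) / 2" if "\<eta> > 0" for \<eta>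
    using infsum_mono[OF sM has_sum_imp_summable[OF sum_bound] M[OF that]]
    unfolding infsumI[OF sum_bound] .
  have cM: "cmod (c k) \<le> M k" for k
    using w(2)[of k] by (simp add: M_def mult_le_cancel_right1)
  have \<kappa>M: "cmod (c k) * norm (wave_vector L k) \<le> M k" for k
  proof -
    have "norm (wave_vector L k) \<le> sqrt (weight L k)"
      by (rule real_le_rsqrt) (simp add: weight_def)
    then show ?thesis by (simp add: M_def mult.commute[of "sqrt (weight L k)"] mult_left_mono)
  qed
  have sc: "(\<lambda>k. cmod (c k)) summable_on UNIV"
    by (rule summable_on_comparison_test[OF sM]) (use cM in auto)
  define g where "g k x = Re (c k * wave L k x)" for k x
  define G where "G k x = Re (\<i> * c k * wave L k x) *\<^sub>R wave_vector L k" for k x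
  have b1: "\<bar>g k x\<bar> \<le> M k" for k x
    using abs_Re_le_cmod[of "c k * wave L k x"] cM[of k] by (simp add: g_def norm_mult)
  have b2: "norm (G k x) \<le> M k" for k x
  proof -
    have "norm (G k x) \<le> cmod (c k) * norm (wave_vector L k)"
      using abs_Re_le_cmod[of "\<i> * c k * wave L k x"] unfolding G_def norm_scaleR
      by (intro mult_right_mono) (auto simp: norm_mult)
    then show ?thesis using \<kappa>M[of k] by simp
  qed
  have hg: "has_gradient (\<lambda>x. \<Sum>\<^sub>\<infinity>k. g k x) (\<lambda>x. \<Sum>\<^sub>\<infinity>k. G k x)"
    by (rule has_gradient_infsum[OF _ b1 b2 sM]) (unfold g_def G_def, rule has_gradient_wave)
  have fg: "f x = (\<Sum>\<^sub>\<infinity>k. g k x)" for x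
  proof -
    have "(\<lambda>k. c k * wave L k x) summable_on UNIV"
      by (rule abs_summable_summable) (simp only: norm_mult norm_wave mult_1_right sc)
    then have "Re (\<Sum>\<^sub>\<infinity>k. c k * wave L k x) = (\<Sum>\<^sub>\<infinity>k. g k x)"
      unfolding g_def by (rule infsum_Re[symmetric])
    moreover have "of_real (f x) = (\<Sum>\<^sub>\<infinity>k. c k * wave L k x)"
      using fourier_expansion[OF f L] sc by (simp add: c_def)
    ultimately have "Re (of_real (f x)) = (\<Sum>\<^sub>\<infinity>k. g k x)" by simp
    then show ?thesis by simp
  qed
  have norm_le: "norm (infsum u UNIV) \<le> infsum M UNIV" if u: "\<And>k. norm (u k) \<le> M k"
    for u :: "int^3 \<Rightarrow> 'z::real_normed_vector"
  proof -
    have "(\<lambda>k. norm (u k)) summable_on UNIV"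
      by (rule summable_on_comparison_test[OF sM]) (use u in auto)
    from infsum_mono[OF this sM u] norm_infsum_bound[OF this] show ?thesis by (rule order_trans[rotated])
  qed
  have ng: "norm (\<Sum>\<^sub>\<infinity>k. G k x) \<le> infsum M UNIV" for x by (rule norm_le[OF b2])
  have nf: "\<bar>f x\<bar> \<le> infsum M UNIV" for x
    unfolding fg real_norm_def[symmetric] by (rule norm_le) (simp add: b1)
  have "f = (\<lambda>x. \<Sum>\<^sub>\<infinity>k. g k x)" using fg by (rule ext)
  then have "has_gradient f (\<lambda>x. \<Sum>\<^sub>\<infinity>k. G k x)" using hg by simp
  moreover have "\<forall>\<eta>>0. \<forall>x. \<bar>f x\<bar> \<le> (\<eta> * A + N / \<eta>) / 2 \<and> norm (\<Sum>\<^sub>\<infinity>k. G k x) \<le> (\<eta> * A + N / \<eta>) / 2"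
    using order_trans[OF nf infM] order_trans[OF ng infM] by blast
  ultimately show ?thesis by blast
qed

section \<open>Classical derivatives of Sobolev fields and their continuity in time\<close>

lemma has_gradient_unique:
  assumes "has_gradient f F" "has_gradient f G"
  shows "F x = G x"
proof -
  have "(\<lambda>h. F x \<bullet> h) = (\<lambda>h. G x \<bullet> h)"
    using has_derivative_unique[OF has_gradientD(2)[OF assms(1)] has_gradientD(2)[OF assms(2)]] .
  then have "(F x - G x) \<bullet> (F x - G x) = 0" by (metis inner_diff_left right_minus_eq)
  then show ?thesis by simp
qed

text \<open>Rows of A are gradients of components, so \<open>A x *v h\<close> is the derivative of u
  in direction h.\<close>

definition C1_field :: "(real^3 \<Rightarrow> real^3) \<Rightarrow> (real^3 \<Rightarrow> real^3^3) \<Rightarrow> bool" where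
  "C1_field u A \<longleftrightarrow> (\<forall>i. has_gradient (\<lambda>x. u x $ i) (\<lambda>x. A x $ i))"

lemma C1_field_jacobian:
  assumes "\<And>i. has_gradient (\<lambda>x. u x $ i) (G i)"
  shows "C1_field u (\<lambda>x. jacobian u (at x))"
proof -
  have "jacobian u (at x) = (\<chi> i. G i x)" for x
  proof -
    have "(u has_derivative (\<lambda>h. \<chi> i. G i x \<bullet> h)) (at x)"
    proof (rule iffD2[OF has_derivative_componentwise_within], rule ballI)
      fix b :: "real^3" assume "b \<in> Basis"
      then obtain i where "b = axis i 1" by (auto simp: Basis_vec_def)
      then show "((\<lambda>x. u x \<bullet> b) has_derivative (\<lambda>h. (\<chi> i. G i x \<bullet> h) \<bullet> b)) (at x)"
        using has_gradientD(2)[OF assms[of i]] by (simp add: inner_axis)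
    qed
    then have "frechet_derivative u (at x) = (\<lambda>h. \<chi> i. G i x \<bullet> h)"
      by (rule frechet_derivative_at[symmetric])
    then show ?thesis by (simp add: jacobian_def matrix_def vec_eq_iff inner_axis)
  qed
  then show ?thesis using assms by (simp add: C1_field_def)
qed

text \<open>The infinite sum in \<open>sobolev_norm\<close> takes the value 0 when it diverges, so a
  small norm of a difference says nothing until summability is known.\<close>

lemma sobolev_term_diff:
  assumes f: "continuous_on UNIV f" and g: "continuous_on UNIV g"
    and sf: "sobolev_term m L f summable_on UNIV" and sg: "sobolev_term m L g summable_on UNIV"
  shows "sobolev_term m L (\<lambda>x. f x - g x) summable_on UNIV"
proof (rule summable_on_comparison_test)
  show "(\<lambda>k. 2 * (sobolev_term m L f k + sobolev_term m L g k)) summable_on UNIV"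
    by (intro summable_on_cmult_right summable_on_add sf sg)
  fix k
  define w where "w = (1 + (norm (wave_vector L k))\<^sup>2) ^ m"
  have w: "w \<ge> 0" by (simp add: w_def)
  define a where "a = fourier_coeff L f k"
  define b where "b = fourier_coeff L g k"
  have "(\<lambda>x. of_real (f x) * wave L (- k) x) integrable_on box_cell L" "(\<lambda>x. of_real (g x) * wave L (- k) x) integrable_on box_cell L"
    by (intro continuous_integrable_cell continuous_on_mult continuous_on_of_real f g continuous_on_wave)+
  then have ab: "fourier_coeff L (\<lambda>x. f x - g x) k = a - b"
    using f g by (simp add: a_def b_def fourier_coeff_eq continuous_on_diff left_diff_distrib integral_diff diff_divide_distrib)
  have "(cmod (a - b))\<^sup>2 \<le> (cmod a + cmod b)\<^sup>2"
    by (intro power_mono norm_triangle_ineq4) auto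
  also have "\<dots> \<le> 2 * ((cmod a)\<^sup>2 + (cmod b)\<^sup>2)"
    using zero_le_power2[of "cmod a - cmod b"] by (simp add: power2_eq_square algebra_simps)
  finally have "(cmod (fourier_coeff L (\<lambda>x. f x - g x) k))\<^sup>2 \<le> 2 * ((cmod a)\<^sup>2 + (cmod b)\<^sup>2)"
    by (simp only: ab)
  then have "w * (cmod (fourier_coeff L (\<lambda>x. f x - g x) k))\<^sup>2 \<le> w * (2 * ((cmod a)\<^sup>2 + (cmod b)\<^sup>2))"
    using w by (rule mult_left_mono)
  then show "sobolev_term m L (\<lambda>x. f x - g x) k \<le> 2 * (sobolev_term m L f k + sobolev_term m L g k)"
    by (simp add: sobolev_term_def w_def a_def b_def algebra_simps)
  show "0 \<le> sobolev_term m L (\<lambda>x. f x - g x) k" by (simp add: sobolev_term_def)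
qed

lemma sobolev_solenoidalD:
  assumes "u \<in> sobolev_solenoidal m L"
  shows "continuous_on UNIV (\<lambda>x. u x $ i)" "box_periodic L u" "sobolev_term m L (\<lambda>x. u x $ i) summable_on UNIV"
    "trace (jacobian u (at x)) = 0"
  using assms by (auto simp: sobolev_solenoidal_def sobolev_def box_periodic_def vec_eq_iff intro!: continuous_intros)

lemma sobolev_solenoidal_C1:
  assumes u: "u \<in> sobolev_solenoidal m L" and "L > 0" "m \<ge> 3"
  shows "C1_field u (\<lambda>x. jacobian u (at x))"
proof -
  have "\<exists>G. has_gradient (\<lambda>x. u x $ i) G" for i
    using sobolev_embedding[OF sobolev_solenoidalD(1)[OF u] box_periodic_compose[OF sobolev_solenoidalD(2)[OF u]]
      assms(2,3) sobolev_solenoidalD(3)[OF u], of i] by blast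
  then show ?thesis using C1_field_jacobian by metis
qed

lemma sobolev_term_sum_le_norm:
  shows "(\<Sum>\<^sub>\<infinity>k. sobolev_term m L (\<lambda>x. u x $ i) k) \<le> (sobolev_norm m L u)\<^sup>2"
proof -
  have nn: "0 \<le> (\<Sum>\<^sub>\<infinity>k. sobolev_term m L (\<lambda>x. u x $ j) k)" for j
    by (rule infsum_nonneg) (simp add: sobolev_term_def)
  then have "(sobolev_norm m L u)\<^sup>2 = (\<Sum>j\<in>UNIV. \<Sum>\<^sub>\<infinity>k. sobolev_term m L (\<lambda>x. u x $ j) k)"
    unfolding sobolev_norm_def by (intro real_sqrt_pow2 sum_nonneg) auto
  then show ?thesis using member_le_sum[of i UNIV "\<lambda>j. \<Sum>\<^sub>\<infinity>k. sobolev_term m L (\<lambda>x. u x $ j) k"] nn by simp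
qed

text \<open>K is the lattice sum of \<open>weight\<close> and does not depend on the fields.
  Choosing \<eta> first and then the Sobolev distance small makes the fields uniformly close
  together with their first derivatives.\<close>

lemma sobolev_C1_bound:
  assumes "L > 0" "m \<ge> 3"
  shows "\<exists>K\<ge>0. \<forall>u w \<eta> x i. u \<in> sobolev_solenoidal m L \<longrightarrow> w \<in> sobolev_solenoidal m L \<longrightarrow> \<eta> > 0 \<longrightarrow>
     \<bar>u x $ i - w x $ i\<bar> \<le> \<eta> * K + (sobolev_norm m L (\<lambda>x. u x - w x))\<^sup>2 / \<eta> \<and>
     norm (jacobian u (at x) $ i - jacobian w (at x) $ i) \<le> \<eta> * K + (sobolev_norm m L (\<lambda>x. u x - w x))\<^sup>2 / \<eta>"
proof (intro exI conjI allI impI)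
  let ?K = "\<Sum>\<^sub>\<infinity>k. 1 / (weight L k)\<^sup>2"
  show K: "?K \<ge> 0" by (rule infsum_nonneg) simp
  fix u w \<eta> x i
  assume u: "u \<in> sobolev_solenoidal m L" and w: "w \<in> sobolev_solenoidal m L" and \<eta>: "\<eta> > (0::real)"
  define S where "S = (sobolev_norm m L (\<lambda>x. u x - w x))\<^sup>2"
  define N where "N = (\<Sum>\<^sub>\<infinity>k. sobolev_term m L (\<lambda>x. u x $ i - w x $ i) k)"
  have N: "0 \<le> N" "N \<le> S"
    using sobolev_term_sum_le_norm[of m L "\<lambda>x. u x - w x" i]
    by (auto simp: N_def S_def sobolev_term_def intro!: infsum_nonneg)
  have p: "box_periodic L (\<lambda>x. u x $ i - w x $ i)"
    using sobolev_solenoidalD(2)[OF u] sobolev_solenoidalD(2)[OF w] by (simp add: box_periodic_def)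
  obtain G where G: "has_gradient (\<lambda>x. u x $ i - w x $ i) G"
    and b: "\<And>\<eta> x. \<eta> > 0 \<Longrightarrow> \<bar>u x $ i - w x $ i\<bar> \<le> (\<eta> * ?K + N / \<eta>) / 2 \<and> norm (G x) \<le> (\<eta> * ?K + N / \<eta>) / 2"
    using sobolev_embedding[OF continuous_on_diff[OF sobolev_solenoidalD(1)[OF u] sobolev_solenoidalD(1)[OF w]] p assms
      sobolev_term_diff[OF sobolev_solenoidalD(1)[OF u] sobolev_solenoidalD(1)[OF w]
        sobolev_solenoidalD(3)[OF u] sobolev_solenoidalD(3)[OF w]]] unfolding N_def by blast
  have gu: "has_gradient (\<lambda>x. u x $ i) (\<lambda>x. jacobian u (at x) $ i)" and gw: "has_gradient (\<lambda>x. w x $ i) (\<lambda>x. jacobian w (at x) $ i)"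
    using sobolev_solenoidal_C1[OF u assms] sobolev_solenoidal_C1[OF w assms] by (auto simp: C1_field_def)
  have Gx: "G x = jacobian u (at x) $ i - jacobian w (at x) $ i"
    using has_gradient_unique[OF G has_gradient_add[OF gu has_gradient_scale[OF gw, of "-1"], simplified]] by simp
  have le: "(\<eta> * ?K + N / \<eta>) / 2 \<le> \<eta> * ?K + S / \<eta>"
  proof -
    have "N / \<eta> \<le> S / \<eta>" "0 \<le> S / \<eta>" "0 \<le> \<eta> * ?K" using N \<eta> K by (auto simp: divide_right_mono)
    moreover have "(X + Y) / 2 \<le> X + Z" if "Y \<le> Z" "0 \<le> Z" "0 \<le> X" for X Y Z :: real
      using that by (simp add: field_simps)
    ultimately show ?thesis by blast
  qed
  show "\<bar>u x $ i - w x $ i\<bar> \<le> \<eta> * ?K + (sobolev_norm m L (\<lambda>x. u x - w x))\<^sup>2 / \<eta>"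
    by (rule order_trans[OF conjunct1[OF b[OF \<eta>]] le[unfolded S_def]])
  show "norm (jacobian u (at x) $ i - jacobian w (at x) $ i) \<le> \<eta> * ?K + (sobolev_norm m L (\<lambda>x. u x - w x))\<^sup>2 / \<eta>"
    unfolding Gx[symmetric] by (rule order_trans[OF conjunct2[OF b[OF \<eta>]] le[unfolded S_def]])
qed

lemma continuous_on_time_space:
  fixes F :: "real \<Rightarrow> real^3 \<Rightarrow> 'b::metric_space"
  assumes "\<And>t. t \<in> I \<Longrightarrow> continuous_on UNIV (F t)"
    and u: "\<And>t e. t \<in> I \<Longrightarrow> e > 0 \<Longrightarrow> \<forall>\<^sub>F s in at t within I. \<forall>x. dist (F s x) (F t x) < e"
  shows "continuous_on (I \<times> UNIV) (\<lambda>(t, x). F t x)"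
  unfolding continuous_on_iff
proof (intro ballI allI impI, clarsimp)
  fix t x and e :: real assume t: "t \<in> I" and e: "e > 0"
  obtain d where d: "d > 0" "\<And>s y. s \<in> I \<Longrightarrow> dist s t < d \<Longrightarrow> dist (F s y) (F t y) < e / 2"
    using u[OF t, of "e/2"] e by (fastforce simp: eventually_at dist_commute)
  obtain d' where d': "d' > 0" "\<And>y. dist y x < d' \<Longrightarrow> dist (F t y) (F t x) < e / 2"
    using assms(1)[OF t] e unfolding continuous_on_iff by (metis UNIV_I half_gt_zero)
  show "\<exists>d>0. \<forall>s\<in>I. \<forall>y. dist (s, y) (t, x) < d \<longrightarrow> dist (F s y) (F t x) < e"
  proof (intro exI[of _ "min d d'"] conjI ballI allI impI)
    fix s y assume s: "s \<in> I" "dist (s, y) (t, x) < min d d'"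
    have "dist s t < d" "dist y x < d'"
      using s(2) dist_fst_le[of "(s, y)" "(t, x)"] dist_snd_le[of "(s, y)" "(t, x)"] by auto
    then show "dist (F s y) (F t x) < e"
      using d(2)[OF s(1)] d'(2) dist_triangle_half_r dist_triangle_half_l by (metis dist_commute)
  qed (use d d' in auto)
qed

lemma sobolev_time_continuous:
  fixes v :: "real \<Rightarrow> real^3 \<Rightarrow> real^3"
  assumes "L > 0" "m \<ge> 3"
    and v: "\<And>t. t \<in> I \<Longrightarrow> v t \<in> sobolev_solenoidal m L"
    and lim: "\<And>t. t \<in> I \<Longrightarrow> ((\<lambda>s. sobolev_norm m L (\<lambda>x. v s x - v t x)) \<longlongrightarrow> 0) (at t within I)"
  shows "continuous_on (I \<times> UNIV) (\<lambda>(t, x). v t x $ i)"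
    "continuous_on (I \<times> UNIV) (\<lambda>(t, x). jacobian (v t) (at x) $ i)"
proof -
  obtain K where K: "K \<ge> 0" "\<And>u w \<eta> x i. u \<in> sobolev_solenoidal m L \<Longrightarrow> w \<in> sobolev_solenoidal m L \<Longrightarrow> \<eta> > 0 \<Longrightarrow>
     \<bar>u x $ i - w x $ i\<bar> \<le> \<eta> * K + (sobolev_norm m L (\<lambda>x. u x - w x))\<^sup>2 / \<eta> \<and>
     norm (jacobian u (at x) $ i - jacobian w (at x) $ i) \<le> \<eta> * K + (sobolev_norm m L (\<lambda>x. u x - w x))\<^sup>2 / \<eta>"
    using sobolev_C1_bound[OF assms(1,2)] by blast
  have ev: "\<forall>\<^sub>F s in at t within I. \<forall>x. dist (v s x $ i) (v t x $ i) < e \<and>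
      dist (jacobian (v s) (at x) $ i) (jacobian (v t) (at x) $ i) < e" if t: "t \<in> I" and e: "e > 0" for t e
  proof -
    \<comment> \<open>This makes the fixed part \<open>\<eta> * K\<close> at most e/2; the other
      part falls below e/2 as s tends to t.\<close>
    define \<eta> where "\<eta> = e / (2 * (K + 1))"
    have \<eta>: "\<eta> > 0" using e K(1) by (simp add: \<eta>_def)
    have \<eta>K: "\<eta> * K \<le> e / 2" using e K(1) by (simp add: \<eta>_def field_simps)
    have "((\<lambda>s. (sobolev_norm m L (\<lambda>x. v s x - v t x))\<^sup>2 / \<eta>) \<longlongrightarrow> 0\<^sup>2 / \<eta>) (at t within I)"
      using \<eta> by (intro tendsto_intros lim t) auto
    then have "\<forall>\<^sub>F s in at t within I. (sobolev_norm m L (\<lambda>x. v s x - v t x))\<^sup>2 / \<eta> < e / 2"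
      using e by (intro order_tendstoD(2)) auto
    moreover have "\<forall>\<^sub>F s in at t within I. s \<in> I" by (simp add: eventually_at_filter)
    ultimately show ?thesis
    proof eventually_elim
      case (elim s)
      show ?case
      proof (intro allI conjI)
        fix x
        show "dist (v s x $ i) (v t x $ i) < e" "dist (jacobian (v s) (at x) $ i) (jacobian (v t) (at x) $ i) < e"
          using K(2)[OF v[OF elim(2)] v[OF t] \<eta>, of x i] \<eta>K elim(1)
          unfolding dist_norm real_norm_def by linarith+
      qed
    qed
  qed
  show "continuous_on (I \<times> UNIV) (\<lambda>(t, x). v t x $ i)"
  proof (rule continuous_on_time_space[where F = "\<lambda>t x. v t x $ i"])
    show "continuous_on UNIV (\<lambda>x. v t x $ i)" if "t \<in> I" for t
      using sobolev_solenoidalD(1)[OF v[OF that]] .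
    show "\<forall>\<^sub>F s in at t within I. \<forall>x. dist (v s x $ i) (v t x $ i) < e" if "t \<in> I" "e > 0" for t e
      using ev[OF that] by (rule eventually_mono) auto
  qed
  show "continuous_on (I \<times> UNIV) (\<lambda>(t, x). jacobian (v t) (at x) $ i)"
  proof (rule continuous_on_time_space[where F = "\<lambda>t x. jacobian (v t) (at x) $ i"])
    show "continuous_on UNIV (\<lambda>x. jacobian (v t) (at x) $ i)" if "t \<in> I" for t
      using sobolev_solenoidal_C1[OF v[OF that] assms(1,2)] by (auto simp: C1_field_def intro: has_gradientD(1))
    show "\<forall>\<^sub>F s in at t within I. \<forall>x. dist (jacobian (v s) (at x) $ i) (jacobian (v t) (at x) $ i) < e"
      if "t \<in> I" "e > 0" for t e
      using ev[OF that] by (rule eventually_mono) auto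
  qed
qed

section \<open>The maximal solution\<close>

lemma time_interval_mono: "T \<le> T' \<Longrightarrow> time_interval T \<subseteq> time_interval T'"
  by (auto simp: time_interval_def)

lemma ereal_le_less_trans: "x \<le> r \<Longrightarrow> ereal r < T \<Longrightarrow> ereal x < T"
  by (meson ereal_less_eq(3) le_less_trans)

lemma euler_solution_restrict:
  assumes "euler_solution m L v0 T' v" "T \<le> T'"
  shows "euler_solution m L v0 T v"
proof -
  note sub = time_interval_mono[OF assms(2)]
  obtain p g where pg: "\<forall>t\<in>time_interval T'. box_periodic L (p t) \<and> (\<forall>x. GDERIV (p t) x :> g t x)"
      "continuous_on (time_interval T' \<times> UNIV) (\<lambda>(t, x). g t x)"
      "\<forall>t\<in>time_interval T'. \<forall>x. ((\<lambda>s. v s x) has_vector_derivative - (jacobian (v t) (at x) *v v t x) - g t x)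
             (at t within time_interval T')"
    using assms(1) unfolding euler_solution_def by blast
  have "continuous_on (time_interval T \<times> UNIV) (\<lambda>(t, x). g t x)"
    by (rule continuous_on_subset[OF pg(2)]) (use sub in auto)
  then show ?thesis
    using assms(1) pg(1,3) sub unfolding euler_solution_def
    by (blast intro: tendsto_within_subset has_vector_derivative_within_subset)
qed

text \<open>The intervals are open on the right, so near t the longer one agrees with the shorter
  one, and limits and derivatives carry over.\<close>

lemma time_interval_at_within:
  assumes "t \<in> time_interval T" "T \<le> T'"
  shows "at t within time_interval T' = at t within time_interval T"
proof -
  have "ereal t < T" using assms(1) by (simp add: time_interval_def)
  then obtain r where r: "ereal t < ereal r" "ereal r < T" using ereal_dense2 by blast
  have "time_interval T' \<inter> {..<r} = time_interval T \<inter> {..<r}"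
    using ereal_le_less_trans[OF less_imp_le r(2)] assms(2)
    by (auto simp: time_interval_def intro: less_le_trans)
  then show ?thesis
    by (intro at_within_nhd[of t "{..<r}"]) (use r(1) in auto)
qed

lemma time_interval_not_bot:
  assumes "t \<in> time_interval T"
  shows "at t within time_interval T \<noteq> bot"
proof -
  have "0 \<le> t" "ereal t < T" using assms by (auto simp: time_interval_def)
  then obtain r where r: "t < r" "ereal r < T" using ereal_dense2[of "ereal t" T] by auto
  have "{t..r} \<subseteq> time_interval T"
    using ereal_le_less_trans[OF _ r(2)] \<open>0 \<le> t\<close> by (auto simp: time_interval_def)
  moreover have "at t within {t..r} \<noteq> bot"
    using r by (simp add: trivial_limit_within islimpt_Icc)
  ultimately show ?thesis using at_le[of "{t..r}" "time_interval T" t] by (auto simp: le_bot)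
qed

text \<open>A solution on the longer of two intervals restricts to the shorter one, where uniqueness forces
  agreement; hence the supremum is attained. The pressure may be chosen separately at each time,
  since its gradient is determined by the velocity.\<close>

lemma euler_solution_max_time:
  assumes "max_time m L v0 > 0"
  obtains v where "euler_solution m L v0 (max_time m L v0) v"
    "\<And>w t. euler_solution m L v0 (max_time m L v0) w \<Longrightarrow> t \<in> time_interval (max_time m L v0) \<Longrightarrow> w t = v t"
proof -
  let ?M = "max_time m L v0"
  define S where "S = {T. 0 < T \<and> unique_euler_solution m L v0 T}"
  have M: "?M = Sup S" by (simp add: max_time_def S_def)
  define V where "V T = (SOME v. euler_solution m L v0 T v \<and>
       (\<forall>w. euler_solution m L v0 T w \<longrightarrow> (\<forall>t\<in>time_interval T. w t = v t)))" for T
  have V: "euler_solution m L v0 T (V T)" "\<And>w t. euler_solution m L v0 T w \<Longrightarrow> t \<in> time_interval T \<Longrightarrow> w t = V T t"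
    if "T \<in> S" for T
  proof -
    have "\<exists>v. euler_solution m L v0 T v \<and>
       (\<forall>w. euler_solution m L v0 T w \<longrightarrow> (\<forall>t\<in>time_interval T. w t = v t))"
      using that unfolding S_def unique_euler_solution_def by blast
    from someI_ex[OF this, folded V_def] show "euler_solution m L v0 T (V T)"
      "\<And>w t. euler_solution m L v0 T w \<Longrightarrow> t \<in> time_interval T \<Longrightarrow> w t = V T t" by blast+
  qed
  have VV: "V T t = V T' t" if "T \<in> S" "T' \<in> S" "t \<in> time_interval T" "t \<in> time_interval T'" for T T' t
  proof (cases "T \<le> T'")
    case True
    show ?thesis
      using V(2)[OF that(1) euler_solution_restrict[OF V(1)[OF that(2)] True] that(3)] by simp
  next
    case False
    then have "T' \<le> T" by simp
    from V(2)[OF that(2) euler_solution_restrict[OF V(1)[OF that(1)] this] that(4)] show ?thesis .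
  qed
  define \<tau> where "\<tau> t = (SOME T. T \<in> S \<and> t \<in> time_interval T)" for t
  have \<tau>: "\<tau> t \<in> S \<and> t \<in> time_interval (\<tau> t)" if "t \<in> time_interval ?M" for t
  proof -
    have "\<exists>T. T \<in> S \<and> t \<in> time_interval T"
      using that unfolding M time_interval_def by (auto simp: less_Sup_iff)
    then show ?thesis unfolding \<tau>_def by (rule someI_ex)
  qed
  have leM: "T \<le> ?M" if "T \<in> S" for T unfolding M using that by (rule Sup_upper)
  define v where "v t = V (\<tau> t) t" for t
  have vV: "v t = V T t" if "T \<in> S" "t \<in> time_interval T" for T t
    unfolding v_def using VV \<tau> that time_interval_mono[OF leM[OF that(1)]] by blast
  have ev: "\<forall>\<^sub>F s in at t within time_interval T. v s = V T s" if "T \<in> S" for t T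
    unfolding eventually_at_filter using vV[OF that] by (intro always_eventually) auto
  obtain P G where
    PG: "\<And>T t. T \<in> S \<Longrightarrow> t \<in> time_interval T \<Longrightarrow> box_periodic L (P T t) \<and> (\<forall>x. GDERIV (P T t) x :> G T t x)"
      "\<And>T. T \<in> S \<Longrightarrow> continuous_on (time_interval T \<times> UNIV) (\<lambda>(t, x). G T t x)"
      "\<And>T t x. T \<in> S \<Longrightarrow> t \<in> time_interval T \<Longrightarrow>
         ((\<lambda>s. V T s x) has_vector_derivative - (jacobian (V T t) (at x) *v V T t x) - G T t x)
             (at t within time_interval T)"
  proof -
    have "\<forall>T\<in>S. \<exists>p g. (\<forall>t\<in>time_interval T. box_periodic L (p t) \<and> (\<forall>x. GDERIV (p t) x :> g t x)) \<and>
        continuous_on (time_interval T \<times> UNIV) (\<lambda>(t, x). g t x) \<and>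
        (\<forall>t\<in>time_interval T. \<forall>x.
           ((\<lambda>s. V T s x) has_vector_derivative - (jacobian (V T t) (at x) *v V T t x) - g t x)
             (at t within time_interval T))"
      using V(1) unfolding euler_solution_def by blast
    then show ?thesis using that by metis
  qed
  have der: "((\<lambda>s. v s x) has_vector_derivative - (jacobian (v t) (at x) *v v t x) - G T t x)
             (at t within time_interval ?M)" if "T \<in> S" "t \<in> time_interval T" for T t x
  proof -
    have "((\<lambda>s. v s x) has_vector_derivative - (jacobian (v t) (at x) *v v t x) - G T t x)
             (at t within time_interval T)"
    proof (rule has_vector_derivative_transform[OF that(2)])
      show "v s x = V T s x" if "s \<in> time_interval T" for s using vV[OF \<open>T \<in> S\<close> that] by simp
      show "((\<lambda>s. V T s x) has_vector_derivative - (jacobian (v t) (at x) *v v t x) - G T t x)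
             (at t within time_interval T)"
        using PG(3)[OF that, of x] unfolding vV[OF that] .
    qed
    then show ?thesis using time_interval_at_within[OF that(2) leM[OF that(1)]] by simp
  qed
  define g where "g t = G (\<tau> t) t" for t
  \<comment> \<open>The time derivative of the velocity is unique, also one-sidedly at 0, so the
    pressure gradients of all admissible T agree at t whatever choice \<tau> makes.\<close>
  have gG: "g t x = G T t x" if "T \<in> S" "t \<in> time_interval T" for T t x
  proof -
    have tM: "t \<in> time_interval ?M" using time_interval_mono[OF leM[OF that(1)]] that(2) by auto
    have "- (jacobian (v t) (at x) *v v t x) - G T t x = - (jacobian (v t) (at x) *v v t x) - G (\<tau> t) t x"
      using vector_derivative_unique_within[OF time_interval_not_bot[OF tM] der[OF that] der] \<tau>[OF tM] by blast
    then show ?thesis by (simp add: g_def)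
  qed
  \<comment> \<open>The choice \<tau> may jump with t; near a given point one T is fixed, and there
    g coincides with the continuous \<open>G T\<close>.\<close>
  have cg: "continuous_on (time_interval ?M \<times> UNIV) (\<lambda>(t, x). g t x)"
    unfolding continuous_on_def
  proof
    fix z assume z: "z \<in> time_interval ?M \<times> (UNIV :: (real^3) set)"
    define T where "T = \<tau> (fst z)"
    have T: "T \<in> S" "fst z \<in> time_interval T" using \<tau> z by (auto simp: T_def)
    have "ereal (fst z) < T" using T(2) by (simp add: time_interval_def)
    then obtain r where r: "ereal (fst z) < ereal r" "ereal r < T" using ereal_dense2 by blast
    have "time_interval ?M \<inter> {..<r} = time_interval T \<inter> {..<r}"
      using ereal_le_less_trans[OF less_imp_le r(2)] leM[OF T(1)]
      by (auto simp: time_interval_def intro: less_le_trans)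
    then have eq: "time_interval ?M \<times> UNIV \<inter> ({..<r} \<times> UNIV) - {z} = time_interval T \<times> UNIV \<inter> ({..<r} \<times> UNIV) - {z}"
      by (simp only: Times_Int_Times)
    have at: "at z within (time_interval ?M \<times> UNIV) = at z within (time_interval T \<times> UNIV)"
      by (rule at_within_nhd[OF _ _ eq]) (use r(1) in \<open>auto intro!: open_Times simp: mem_Times_iff\<close>)
    have "((\<lambda>(t, x). G T t x) \<longlongrightarrow> (\<lambda>(t, x). G T t x) z) (at z within (time_interval T \<times> UNIV))"
      by (rule PG(2)[OF T(1), unfolded continuous_on_def, rule_format]) (simp add: mem_Times_iff T(2))
    moreover have "\<forall>\<^sub>F y in at z within (time_interval T \<times> UNIV). (\<lambda>(t, x). G T t x) y = (\<lambda>(t, x). g t x) y"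
      unfolding eventually_at_filter by (intro always_eventually) (clarsimp simp: gG[OF T(1)])
    ultimately have "((\<lambda>(t, x). g t x) \<longlongrightarrow> (\<lambda>(t, x). G T t x) z) (at z within (time_interval T \<times> UNIV))"
      by (rule Lim_transform_eventually)
    moreover have "(\<lambda>(t, x). G T t x) z = (\<lambda>(t, x). g t x) z"
      using gG[OF T] by (simp add: case_prod_beta)
    ultimately show "((\<lambda>(t, x). g t x) \<longlongrightarrow> (\<lambda>(t, x). g t x) z) (at z within (time_interval ?M \<times> UNIV))"
      unfolding at by simp
  qed
  have "euler_solution m L v0 ?M v" unfolding euler_solution_def
  proof (intro conjI ballI)
    obtain T where "T \<in> S" using assms unfolding M by (metis less_Sup_iff)
    moreover then have "0 \<in> time_interval T" by (auto simp: S_def time_interval_def zero_ereal_def)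
    ultimately show "v 0 = v0" using vV V(1) unfolding euler_solution_def by metis
  next
    fix t assume t: "t \<in> time_interval ?M"
    note T = \<tau>[OF t, THEN conjunct1] \<tau>[OF t, THEN conjunct2]
    have E: "euler_solution m L v0 (\<tau> t) (V (\<tau> t))" by (rule V(1)[OF T(1)])
    show "v t \<in> sobolev_solenoidal m L"
      using E T(2) vV[OF T] unfolding euler_solution_def by simp
    have "((\<lambda>s. sobolev_norm m L (\<lambda>x. V (\<tau> t) s x - V (\<tau> t) t x)) \<longlongrightarrow> 0) (at t within time_interval (\<tau> t))"
      using E T(2) unfolding euler_solution_def by simp
    then have "((\<lambda>s. sobolev_norm m L (\<lambda>x. v s x - v t x)) \<longlongrightarrow> 0) (at t within time_interval (\<tau> t))"
      by (rule Lim_transform_eventually) (use ev[OF T(1), of t] vV[OF T] in \<open>auto elim: eventually_mono\<close>)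
    then show "((\<lambda>s. sobolev_norm m L (\<lambda>x. v s x - v t x)) \<longlongrightarrow> 0) (at t within time_interval ?M)"
      using time_interval_at_within[OF T(2) leM[OF T(1)]] by simp
  next
    show "\<exists>p g. (\<forall>t\<in>time_interval ?M. box_periodic L (p t) \<and> (\<forall>x. GDERIV (p t) x :> g t x)) \<and>
        continuous_on (time_interval ?M \<times> UNIV) (\<lambda>(t, x). g t x) \<and>
        (\<forall>t\<in>time_interval ?M. \<forall>x.
           ((\<lambda>s. v s x) has_vector_derivative - (jacobian (v t) (at x) *v v t x) - g t x)
             (at t within time_interval ?M))"
    proof (intro exI[of _ "\<lambda>t. P (\<tau> t) t"] exI[of _ g] conjI ballI allI cg)
      fix t x assume t: "t \<in> time_interval ?M"
      show "box_periodic L (P (\<tau> t) t)" "GDERIV (P (\<tau> t) t) x :> g t x"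
        using PG(1) \<tau>[OF t] by (auto simp: g_def)
      show "((\<lambda>s. v s x) has_vector_derivative - (jacobian (v t) (at x) *v v t x) - g t x)
             (at t within time_interval ?M)"
        unfolding g_def using der \<tau>[OF t] by blast
    qed
  qed
  moreover have "w t = v t" if w: "euler_solution m L v0 ?M w" and t: "t \<in> time_interval ?M" for w t
    using V(2)[OF _ euler_solution_restrict[OF w leM]] \<tau>[OF t] by (simp add: v_def)
  ultimately show ?thesis using that by blast
qed

lemma sol_op_eq:
  assumes "max_time m L v0 > 0"
  obtains v where "euler_solution m L v0 (max_time m L v0) v"
    "\<And>t. t \<in> time_interval (max_time m L v0) \<Longrightarrow> sol_op m L t v0 = v t"
proof -
  obtain v where v: "euler_solution m L v0 (max_time m L v0) v"
    "\<And>w t. euler_solution m L v0 (max_time m L v0) w \<Longrightarrow> t \<in> time_interval (max_time m L v0) \<Longrightarrow> w t = v t"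
    using euler_solution_max_time[OF assms] by metis
  have "sol_op m L t v0 = v t" if "t \<in> time_interval (max_time m L v0)" for t
    unfolding sol_op_def
  proof (rule the_equality)
    show "\<exists>w. euler_solution m L v0 (max_time m L v0) w \<and> v t = w t" using v(1) by blast
    show "u = v t" if "\<exists>w. euler_solution m L v0 (max_time m L v0) w \<and> u = w t" for u
      using that v(2) \<open>t \<in> _\<close> by blast
  qed
  then show ?thesis using that v(1) by blast
qed

section \<open>Energy, enstrophy and the Poincare inequality\<close>

lemma continuous_on_matrix_vector_mult:
  fixes M :: "'a::topological_space \<Rightarrow> real^3^3"
  assumes "continuous_on S M" "continuous_on S w"
  shows "continuous_on S (\<lambda>z. M z *v w z)"
proof -
  have "(\<lambda>z. M z *v w z) = (\<lambda>z. \<chi> j. M z $ j \<bullet> w z)"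
    by (simp add: fun_eq_iff vec_eq_iff matrix_vector_mul_component)
  moreover have "continuous_on S (\<lambda>z. \<chi> j. M z $ j \<bullet> w z)"
    by (intro continuous_intros assms)
  ultimately show ?thesis by (simp only:)
qed

lemma C1_field_continuous:
  assumes "C1_field w B"
  shows "continuous_on UNIV w" "continuous_on UNIV B"
proof -
  have "has_gradient (\<lambda>x. w x $ i) (\<lambda>x. B x $ i)" for i using assms by (simp add: C1_field_def)
  then have "continuous_on UNIV (\<lambda>x. \<chi> i. w x $ i)" "continuous_on UNIV (\<lambda>x. \<chi> i. B x $ i)"
    by (auto intro!: continuous_on_vec_lambda intro: has_gradient_continuous has_gradientD(1) simp del: vec_lambda_eta)
  then show "continuous_on UNIV w" "continuous_on UNIV B" by simp_all
qed

lemma C1_field_shift: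
  assumes "C1_field w B"
  shows "C1_field (\<lambda>x. w (x + a)) (\<lambda>x. B (x + a))"
  using assms has_gradient_shift unfolding C1_field_def by blast

lemma C1_field_diff:
  assumes "C1_field w B" "C1_field u D"
  shows "C1_field (\<lambda>x. w x - u x) (\<lambda>x. B x - D x)"
  unfolding C1_field_def
proof
  fix i
  have "has_gradient (\<lambda>x. w x $ i + (-1) * u x $ i) (\<lambda>x. B x $ i + (-1) *\<^sub>R D x $ i)"
    using assms unfolding C1_field_def by (intro has_gradient_add has_gradient_scale) auto
  then show "has_gradient (\<lambda>x. (w x - u x) $ i) (\<lambda>x. (B x - D x) $ i)" by simp
qed

lemma has_gradient_half_square:
  assumes "C1_field w B"
  shows "has_gradient (\<lambda>x. (w x \<bullet> w x) / 2) (\<lambda>x. \<Sum>j\<in>UNIV. w x $ j *\<^sub>R B x $ j)"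
proof -
  have j: "has_gradient (\<lambda>x. (1/2) * (w x $ j * w x $ j)) (\<lambda>x. (1/2) *\<^sub>R (w x $ j *\<^sub>R B x $ j + w x $ j *\<^sub>R B x $ j))" for j
    using assms unfolding C1_field_def by (intro has_gradient_scale has_gradient_mult) auto
  have e: "(1/2) *\<^sub>R (z + z) = z" for z :: "real^3" by (simp flip: scaleR_2)
  have "has_gradient (\<lambda>x. (1/2) * (w x $ 1 * w x $ 1) + (1/2) * (w x $ 2 * w x $ 2) + (1/2) * (w x $ 3 * w x $ 3))
     (\<lambda>x. w x $ 1 *\<^sub>R B x $ 1 + w x $ 2 *\<^sub>R B x $ 2 + w x $ 3 *\<^sub>R B x $ 3)"
    using has_gradient_add[OF has_gradient_add[OF j[of 1] j[of 2]] j[of 3]] unfolding e .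
  then show ?thesis by (simp add: sum_3 inner_vec_def add_divide_distrib)
qed

text \<open>Turns u . (z . grad) u into z . grad (|u|^2 / 2), the form in which
  \<open>transport_integral_0\<close> applies.\<close>

lemma inner_half_square_gradient: "z \<bullet> (\<Sum>j\<in>UNIV. u $ j *\<^sub>R B $ j) = u \<bullet> (B *v z)" for B :: "real^3^3"
  by (simp add: inner_sum_right inner_vec_def[of u] matrix_vector_mul_component inner_commute)

text \<open>For divergence-free w the integrand w . grad f is the divergence of f w, and each of its
  three terms integrates to zero by \<open>integral_grad\<close>.\<close>

lemma transport_integral_0:
  assumes w: "C1_field w B" "\<And>x. trace (B x) = 0" "box_periodic L w"
    and f: "has_gradient f F" "box_periodic L f" and L: "L > 0"
  shows "integral (box_cell L) (\<lambda>x. w x \<bullet> F x) = 0"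
proof -
  define D where "D i x = (w x $ i *\<^sub>R F x + f x *\<^sub>R B x $ i) \<bullet> axis i 1" for i x
  have g: "has_gradient (\<lambda>x. w x $ i * f x) (\<lambda>x. w x $ i *\<^sub>R F x + f x *\<^sub>R B x $ i)" for i
    using w(1) f(1) unfolding C1_field_def by (intro has_gradient_mult) auto
  have p: "box_periodic L (\<lambda>x. w x $ i * f x)" for i
    using w(3) f(2) by (simp add: box_periodic_def)
  have "continuous_on UNIV (D i)" for i
    unfolding D_def by (intro continuous_intros has_gradientD(1)[OF g])
  then have int: "D i integrable_on box_cell L" for i by simp
  have "w x \<bullet> F x = (\<Sum>i\<in>UNIV. D i x)" for x
  proof -
    have "(\<Sum>i\<in>UNIV. D i x) = w x \<bullet> F x + f x * trace (B x)"
      by (simp add: D_def inner_axis inner_vec_def[of "w x"] trace_def sum.distrib sum_distrib_left)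
    then show ?thesis using w(2) by simp
  qed
  then have "integral (box_cell L) (\<lambda>x. w x \<bullet> F x) = (\<Sum>i\<in>UNIV. integral (box_cell L) (D i))"
    using int by (simp add: integral_sum)
  moreover have "integral (box_cell L) (D i) = 0" for i
    unfolding D_def by (rule integral_grad[OF g p L])
  ultimately show ?thesis by simp
qed

text \<open>The Sobolev space is left behind here: only first derivatives in space and joint
  continuity enter. Time derivatives are relative to I, which includes the one-sided one at time
  0.\<close>

locale euler_flow =
  fixes L :: real and I :: "real set" and v :: "real \<Rightarrow> real^3 \<Rightarrow> real^3" and A :: "real \<Rightarrow> real^3 \<Rightarrow> real^3^3"
    and p :: "real \<Rightarrow> real^3 \<Rightarrow> real" and g :: "real \<Rightarrow> real^3 \<Rightarrow> real^3"
  assumes L: "L > 0" and I: "convex I"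
    and v: "t \<in> I \<Longrightarrow> C1_field (v t) (A t)"
    and per: "t \<in> I \<Longrightarrow> box_periodic L (v t)"
    and div: "t \<in> I \<Longrightarrow> trace (A t x) = 0"
    and p: "t \<in> I \<Longrightarrow> has_gradient (p t) (g t)" "t \<in> I \<Longrightarrow> box_periodic L (p t)"
    and cont: "continuous_on (I \<times> UNIV) (\<lambda>(t, x). v t x)" "continuous_on (I \<times> UNIV) (\<lambda>(t, x). A t x)"
      "continuous_on (I \<times> UNIV) (\<lambda>(t, x). g t x)"
    and euler: "t \<in> I \<Longrightarrow> ((\<lambda>s. v s x) has_vector_derivative - (A t x *v v t x) - g t x) (at t within I)"
begin

lemma cont_comp:
  assumes "continuous_on S \<tau>" "\<tau> ` S \<subseteq> I" "continuous_on S \<xi>"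
  shows "continuous_on S (\<lambda>z. v (\<tau> z) (\<xi> z))" "continuous_on S (\<lambda>z. A (\<tau> z) (\<xi> z))"
    "continuous_on S (\<lambda>z. g (\<tau> z) (\<xi> z))"
  using continuous_on_compose2[OF cont(1), of S "\<lambda>z. (\<tau> z, \<xi> z)"]
    continuous_on_compose2[OF cont(2), of S "\<lambda>z. (\<tau> z, \<xi> z)"]
    continuous_on_compose2[OF cont(3), of S "\<lambda>z. (\<tau> z, \<xi> z)"] assms
  by (auto intro!: continuous_on_Pair)

text \<open>The advection of the increment by \<open>v (x + \<eta>)\<close> and the pressure drop out of the integral because
  \<open>v\<close> and the increment are divergence free; no second derivative of \<open>v\<close> occurs.\<close>

lemma increment_energy:
  fixes \<eta> :: "real^3"
  assumes t: "t \<in> I"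
  defines "\<delta> \<equiv> \<lambda>t x. v t (x + \<eta>) - v t x"
  shows "((\<lambda>s. integral (box_cell L) (\<lambda>x. (\<delta> s x \<bullet> \<delta> s x) / 2)) has_vector_derivative
     - integral (box_cell L) (\<lambda>x. \<delta> t x \<bullet> (A t x *v \<delta> t x))) (at t within I)"
proof -
  define a where "a t x = - (A t x *v v t x) - g t x" for t x
  define f where "f s x = (\<delta> s x \<bullet> \<delta> s x) / 2" for s x
  define f' where "f' s x = \<delta> s x \<bullet> (a s (x + \<eta>) - a s x)" for s x
  have "((\<lambda>s. integral (cbox 0 (vec L)) (f s)) has_vector_derivative integral (cbox 0 (vec L)) (f' t)) (at t within I)"
  proof (rule leibniz_rule_vector_derivative[OF _ _ _ t I])
    fix s x assume s: "s \<in> I"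
    have d: "((\<lambda>s. \<delta> s x) has_vector_derivative (a s (x + \<eta>) - a s x)) (at s within I)"
      unfolding \<delta>_def a_def by (intro has_vector_derivative_diff euler s)
    show "((\<lambda>s. f s x) has_vector_derivative f' s x) (at s within I)"
      unfolding f_def f'_def
      using has_vector_derivative_divide[OF bounded_bilinear.has_vector_derivative[OF bounded_bilinear_inner d d], of 2]
      by (simp add: inner_commute)
  next
    fix s assume s: "s \<in> I"
    show "f s integrable_on cbox 0 (vec L)"
      unfolding f_def \<delta>_def box_cell_def[symmetric]
      by (intro continuous_integrable_cell continuous_intros continuous_on_shift[OF C1_field_continuous(1)[OF v[OF s]]]
        C1_field_continuous(1)[OF v[OF s]]) simp
  next
    have "continuous_on (I \<times> cbox 0 (vec L)) (\<lambda>z. f' (fst z) (snd z))"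
      unfolding f'_def \<delta>_def a_def
      by (intro continuous_intros cont_comp continuous_on_matrix_vector_mult) auto
    then show "continuous_on (I \<times> cbox 0 (vec L)) (\<lambda>(s, x). f' s x)" by (simp add: case_prod_beta)
  qed
  moreover have "integral (box_cell L) (f' t) = - integral (box_cell L) (\<lambda>x. \<delta> t x \<bullet> (A t x *v \<delta> t x))"
  proof -
    note vt = v[OF t] C1_field_shift[OF v[OF t], of \<eta>]
    have d: "C1_field (\<delta> t) (\<lambda>x. A t (x + \<eta>) - A t x)" unfolding \<delta>_def by (rule C1_field_diff[OF vt(2,1)])
    have pv: "box_periodic L (\<lambda>x. v t (x + \<eta>))" by (rule box_periodic_shift[OF per[OF t]])
    have pd: "box_periodic L (\<delta> t)" unfolding \<delta>_def
      by (rule box_periodic_compose2[where F="(-)"], rule pv, rule per[OF t])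
    have td: "trace (A t (x + \<eta>) - A t x) = 0" for x
      using div[OF t, of x] div[OF t, of "x + \<eta>"] by (simp add: trace_def sum_subtractf)
    \<comment> \<open>\<open>T1\<close> transports half the squared increment by the shifted
      velocity, \<open>T3\<close> transports the pressure increment by \<delta>, and
      \<open>T2\<close> is the stretching term that survives.\<close>
    define T1 where "T1 x = v t (x + \<eta>) \<bullet> (\<Sum>j\<in>UNIV. \<delta> t x $ j *\<^sub>R (A t (x + \<eta>) - A t x) $ j)" for x
    define T2 where "T2 x = \<delta> t x \<bullet> (A t x *v \<delta> t x)" for x
    define T3 where "T3 x = \<delta> t x \<bullet> (g t (x + \<eta>) - g t x)" for x
    have i1: "integral (box_cell L) T1 = 0" unfolding T1_def
      by (rule transport_integral_0[OF vt(2) div[OF t] pv has_gradient_half_square[OF d] _ L])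
        (use pd in \<open>simp add: box_periodic_def\<close>)
    have i3: "integral (box_cell L) T3 = 0" unfolding T3_def
      by (rule transport_integral_0[OF d td pd has_gradient_shift_diff[OF p(1)[OF t]] _ L])
        (rule box_periodic_compose2[where F="(-)"], rule box_periodic_shift, rule p(2)[OF t], rule p(2)[OF t])
    have c: "continuous_on UNIV (\<delta> t)" "continuous_on UNIV (\<lambda>x. A t (x + \<eta>) - A t x)" 
      "continuous_on UNIV (\<lambda>x. v t (x + \<eta>))" "continuous_on UNIV (A t)"
      using C1_field_continuous[OF d] C1_field_continuous[OF vt(2)] C1_field_continuous[OF vt(1)] by auto
    have "continuous_on UNIV T1" unfolding T1_def inner_half_square_gradient
      by (intro continuous_intros continuous_on_matrix_vector_mult c)
    moreover have "continuous_on UNIV T2" unfolding T2_def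
      by (intro continuous_intros continuous_on_matrix_vector_mult c)
    moreover have "continuous_on UNIV T3" unfolding T3_def
      by (intro continuous_intros c has_gradientD(1)[OF has_gradient_shift_diff[OF p(1)[OF t]]])
    ultimately have int: "T1 integrable_on box_cell L" "T2 integrable_on box_cell L" "T3 integrable_on box_cell L"
      by auto
    have "f' t x = - (T1 x + T2 x + T3 x)" for x
    proof -
      have "A t (x + \<eta>) *v v t (x + \<eta>) - A t x *v v t x
         = (A t (x + \<eta>) - A t x) *v v t (x + \<eta>) + A t x *v \<delta> t x"
        by (simp add: \<delta>_def matrix_vector_mult_diff_rdistrib matrix_vector_mult_diff_distrib)
      then have "a t (x + \<eta>) - a t x = - ((A t (x + \<eta>) - A t x) *v v t (x + \<eta>) + A t x *v \<delta> t x + (g t (x + \<eta>) - g t x))"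
        by (simp add: a_def algebra_simps)
      then show ?thesis
        unfolding f'_def T1_def inner_half_square_gradient T2_def T3_def
        by (simp add: inner_add_right inner_diff_right)
    qed
    then have "integral (box_cell L) (f' t) = integral (box_cell L) (\<lambda>x. - (T1 x + T2 x + T3 x))" by presburger
    also have "\<dots> = - (integral (box_cell L) T1 + integral (box_cell L) T2 + integral (box_cell L) T3)"
      using int by (simp only: integral_neg integral_add integrable_add)
    finally show ?thesis using i1 i3 by (simp add: T2_def[abs_def])
  qed
  ultimately show ?thesis by (simp add: f_def[abs_def] box_cell_def)
qed

lemma energy_derivative:
  assumes t: "t \<in> I"
  shows "((\<lambda>s. integral (box_cell L) (\<lambda>x. (v s x \<bullet> v s x) / 2)) has_vector_derivative 0) (at t within I)"
proof -
  define a where "a t x = - (A t x *v v t x) - g t x" for t x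
  define f where "f s x = (v s x \<bullet> v s x) / 2" for s x
  define f' where "f' s x = v s x \<bullet> a s x" for s x
  have "((\<lambda>s. integral (cbox 0 (vec L)) (f s)) has_vector_derivative integral (cbox 0 (vec L)) (f' t)) (at t within I)"
  proof (rule leibniz_rule_vector_derivative[OF _ _ _ t I])
    fix s x assume s: "s \<in> I"
    have d: "((\<lambda>s. v s x) has_vector_derivative a s x) (at s within I)"
      unfolding a_def by (intro euler s)
    show "((\<lambda>s. f s x) has_vector_derivative f' s x) (at s within I)"
      unfolding f_def f'_def
      using has_vector_derivative_divide[OF bounded_bilinear.has_vector_derivative[OF bounded_bilinear_inner d d], of 2]
      by (simp add: inner_commute)
  next
    fix s assume s: "s \<in> I"
    show "f s integrable_on cbox 0 (vec L)"
      unfolding f_def box_cell_def[symmetric]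
      by (intro continuous_integrable_cell continuous_intros C1_field_continuous(1)[OF v[OF s]]) simp
  next
    have "continuous_on (I \<times> cbox 0 (vec L)) (\<lambda>z. f' (fst z) (snd z))"
      unfolding f'_def a_def
      by (intro continuous_intros cont_comp continuous_on_matrix_vector_mult) auto
    then show "continuous_on (I \<times> cbox 0 (vec L)) (\<lambda>(s, x). f' s x)" by (simp add: case_prod_beta)
  qed
  moreover have "integral (box_cell L) (f' t) = 0"
  proof -
    define T1 where "T1 x = v t x \<bullet> (\<Sum>j\<in>UNIV. v t x $ j *\<^sub>R A t x $ j)" for x
    define T3 where "T3 x = v t x \<bullet> g t x" for x
    have i1: "integral (box_cell L) T1 = 0" unfolding T1_def
      by (rule transport_integral_0[OF v[OF t] div[OF t] per[OF t] has_gradient_half_square[OF v[OF t]] _ L])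
        (use per[OF t] in \<open>simp add: box_periodic_def\<close>)
    have i3: "integral (box_cell L) T3 = 0" unfolding T3_def
      by (rule transport_integral_0[OF v[OF t] div[OF t] per[OF t] p(1)[OF t] p(2)[OF t] L])
    note c = C1_field_continuous[OF v[OF t]]
    have "continuous_on UNIV T1" unfolding T1_def inner_half_square_gradient
      by (intro continuous_intros continuous_on_matrix_vector_mult c)
    moreover have "continuous_on UNIV T3" unfolding T3_def
      by (intro continuous_intros c has_gradientD(1)[OF p(1)[OF t]])
    ultimately have int: "T1 integrable_on box_cell L" "T3 integrable_on box_cell L"
      by auto
    have "f' t = (\<lambda>x. - (T1 x + T3 x))"
      unfolding f'_def T1_def inner_half_square_gradient T3_def a_def
      by (simp add: fun_eq_iff inner_diff_right)
    then show ?thesis using i1 i3 int by (simp only: integral_neg integral_add)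
  qed
  ultimately show ?thesis by (simp add: f_def[abs_def] box_cell_def)
qed

lemma momentum_derivative:
  assumes t: "t \<in> I"
  shows "((\<lambda>s. integral (box_cell L) (v s)) has_vector_derivative 0) (at t within I)"
proof -
  define a where "a t x = - (A t x *v v t x) - g t x" for t x
  have "((\<lambda>s. integral (cbox 0 (vec L)) (v s)) has_vector_derivative integral (cbox 0 (vec L)) (a t)) (at t within I)"
  proof (rule leibniz_rule_vector_derivative[OF _ _ _ t I])
    show "((\<lambda>s. v s x) has_vector_derivative a s x) (at s within I)" if "s \<in> I" for s x
      unfolding a_def by (rule euler[OF that])
    show "v s integrable_on cbox 0 (vec L)" if "s \<in> I" for s
      unfolding box_cell_def[symmetric]
      by (intro continuous_integrable_cell C1_field_continuous(1)[OF v[OF that]])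
    have "continuous_on (I \<times> cbox 0 (vec L)) (\<lambda>z. a (fst z) (snd z))"
      unfolding a_def by (intro continuous_intros cont_comp continuous_on_matrix_vector_mult) auto
    then show "continuous_on (I \<times> cbox 0 (vec L)) (\<lambda>(s, x). a s x)" by (simp add: case_prod_beta)
  qed
  moreover have "integral (box_cell L) (a t) = 0"
  proof -
    note c = C1_field_continuous[OF v[OF t]]
    have ca: "continuous_on UNIV (a t)"
      unfolding a_def by (intro continuous_intros continuous_on_matrix_vector_mult c has_gradientD(1)[OF p(1)[OF t]])
    have "integral (box_cell L) (a t) $ i = 0" for i
    proof -
      have "integral (box_cell L) (a t) $ i = integral (box_cell L) (\<lambda>x. a t x $ i)"
        using ca by simp
      also have "(\<lambda>x. a t x $ i) = (\<lambda>x. - (v t x \<bullet> A t x $ i + g t x \<bullet> axis i 1))"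
        by (simp add: fun_eq_iff a_def matrix_vector_mul_component inner_axis inner_commute[of "v t _"])
      also have "integral (box_cell L) \<dots> = - (integral (box_cell L) (\<lambda>x. v t x \<bullet> A t x $ i) + integral (box_cell L) (\<lambda>x. g t x \<bullet> axis i 1))"
      proof -
        have "(\<lambda>x. v t x \<bullet> A t x $ i) integrable_on box_cell L" "(\<lambda>x. g t x \<bullet> axis i 1) integrable_on box_cell L"
          by (intro continuous_integrable_cell continuous_intros c has_gradientD(1)[OF p(1)[OF t]])+
        then show ?thesis by (simp only: integral_neg integral_add)
      qed
      also have "integral (box_cell L) (\<lambda>x. v t x \<bullet> A t x $ i) = 0"
        by (rule transport_integral_0[OF v[OF t] div[OF t] per[OF t] _ _ L, where f = "\<lambda>x. v t x $ i"])
          (use v[OF t] per[OF t] in \<open>auto simp: C1_field_def box_periodic_def\<close>)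
      also have "integral (box_cell L) (\<lambda>x. g t x \<bullet> axis i 1) = 0"
        by (rule integral_grad[OF p(1)[OF t] p(2)[OF t] L])
      finally show ?thesis by simp
    qed
    then show ?thesis by (simp add: vec_eq_iff)
  qed
  ultimately show ?thesis by (simp add: box_cell_def)
qed

end

text \<open>The left side is tr(M^T M M). With W the antisymmetric part of M it equals tr S^3 - tr(S
  W^2). Trace-free matrices satisfy tr N^3 = 3 det N, whence det M = det S + tr(S W^2); this is the
  origin of the factor 4.\<close>

lemma matrix_identity_cubic:
  fixes M :: "real^3^3"
  assumes "trace M = 0"
  defines "S \<equiv> (1/2) *\<^sub>R (M + transpose M)"
  shows "(\<Sum>i\<in>UNIV. (M *v axis i 1) \<bullet> (M *v (M *v axis i 1))) = 4 * det S - det M"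
proof -
  have s: "S$i$j = (M$i$j + M$j$i) / 2" for i j by (simp add: S_def transpose_def)
  have m: "(M *v axis i 1) $ j = M $ j $ i" for i j
    by (simp add: matrix_vector_mul_component inner_axis)
  have 33: "M$3$3 = - M$1$1 - M$2$2" using assms(1) by (simp add: trace_def sum_3)
  have mm: "(M *v (M *v axis i 1)) $ j = (\<Sum>l\<in>UNIV. M $ j $ l * M $ l $ i)" for i j
    by (simp add: matrix_vector_mul_component[of M "M *v _"] inner_vec_def m)
  show ?thesis
    unfolding det_3 s inner_vec_def m mm sum_3 33 by (simp add: field_simps)
qed

text \<open>The left side is (|M|^2 + tr M^2) / 2, and tr M^2 = -2 \<open>minors2 M\<close> for
  trace-free M.\<close>

lemma matrix_identity_quadratic:
  fixes M :: "real^3^3"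
  assumes "trace M = 0"
  defines "S \<equiv> (1/2) *\<^sub>R (M + transpose M)"
  shows "(\<Sum>i\<in>UNIV. \<Sum>j\<in>UNIV. (S$i$j)\<^sup>2) = (\<Sum>i\<in>UNIV. \<Sum>j\<in>UNIV. (M$i$j)\<^sup>2) / 2 - minors2 M"
proof -
  have s: "S$i$j = (M$i$j + M$j$i) / 2" for i j by (simp add: S_def transpose_def)
  have 33: "M$3$3 = - M$1$1 - M$2$2" using assms(1) by (simp add: trace_def sum_3)
  show ?thesis
    by (simp add: sum_3 minors2_def s 33 power2_eq_square) (simp add: field_simps)
qed

lemma integral_minors2:
  assumes w: "C1_field w B" "box_periodic L w" and L: "L > 0"
  shows "integral (box_cell L) (\<lambda>x. minors2 (B x)) = 0"
proof -
  have g: "has_gradient (\<lambda>x. w x $ i) (\<lambda>x. B x $ i)" and p: "box_periodic L (\<lambda>x. w x $ i)" for i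
    using w by (auto simp: C1_field_def box_periodic_def)
  define D where "D i j x = (B x $ i \<bullet> axis i 1) * (B x $ j \<bullet> axis j 1) - (B x $ i \<bullet> axis j 1) * (B x $ j \<bullet> axis i 1)" for i j x
  have i: "integral (box_cell L) (D i j) = 0" for i j
    unfolding D_def by (rule null_lagrangian_2[OF g p g p L])
  have "continuous_on UNIV (D i j)" for i j
    unfolding D_def by (intro continuous_intros has_gradientD(1)[OF g])
  then have int: "D i j integrable_on box_cell L" for i j by simp
  have "(\<lambda>x. minors2 (B x)) = (\<lambda>x. D 1 2 x + D 1 3 x + D 2 3 x)"
    by (simp add: fun_eq_iff minors2_def D_def inner_axis)
  then show ?thesis using int i by (simp only: integral_add integrable_add)
qed

lemma integral_det:
  assumes w: "C1_field w B" "box_periodic L w" and L: "L > 0"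
  shows "integral (box_cell L) (\<lambda>x. det (B x)) = 0"
proof -
  have g: "has_gradient (\<lambda>x. w x $ i) (\<lambda>x. B x $ i)" and p: "box_periodic L (\<lambda>x. w x $ i)" for i
    using w by (auto simp: C1_field_def box_periodic_def)
  have "(\<lambda>x. det (B x)) = (\<lambda>x.
      (B x $ 1 \<bullet> axis 1 1) * (B x $ 2 \<bullet> axis 2 1) * (B x $ 3 \<bullet> axis 3 1) - (B x $ 1 \<bullet> axis 1 1) * (B x $ 2 \<bullet> axis 3 1) * (B x $ 3 \<bullet> axis 2 1)
    + (B x $ 1 \<bullet> axis 2 1) * (B x $ 2 \<bullet> axis 3 1) * (B x $ 3 \<bullet> axis 1 1) - (B x $ 1 \<bullet> axis 2 1) * (B x $ 2 \<bullet> axis 1 1) * (B x $ 3 \<bullet> axis 3 1)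
    + (B x $ 1 \<bullet> axis 3 1) * (B x $ 2 \<bullet> axis 1 1) * (B x $ 3 \<bullet> axis 2 1) - (B x $ 1 \<bullet> axis 3 1) * (B x $ 2 \<bullet> axis 2 1) * (B x $ 3 \<bullet> axis 1 1))"
    by (simp add: fun_eq_iff det_3 inner_axis)
  then show ?thesis using null_lagrangian_3[OF g p g p g p L, where a = "axis 1 1" and b = "axis 2 1" and c = "axis 3 1"] by (simp only:)
qed

section \<open>The enstrophy as a limit of difference quotient energies\<close>

definition sym_part :: "real^3^3 \<Rightarrow> real^3^3" where
  "sym_part M = (1/2) *\<^sub>R (M + transpose M)"

definition frob2 :: "real^3^3 \<Rightarrow> real" where
  "frob2 M = (\<Sum>i\<in>UNIV. \<Sum>j\<in>UNIV. (M$i$j)\<^sup>2)"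

lemma continuous_on_frob2: "continuous_on S M \<Longrightarrow> continuous_on S (\<lambda>z. frob2 (M z))"
  unfolding frob2_def by (intro continuous_intros)

lemma continuous_on_det3:
  fixes M :: "'a::topological_space \<Rightarrow> real^3^3"
  shows "continuous_on S M \<Longrightarrow> continuous_on S (\<lambda>z. det (M z))"
  unfolding det_3 by (intro continuous_intros)

lemma continuous_on_sym_part: "continuous_on S M \<Longrightarrow> continuous_on S (\<lambda>z. sym_part (M z))"
  unfolding sym_part_def transpose_def by (intro continuous_intros)

context euler_flow
begin

definition enstrophy :: "real \<Rightarrow> real" where
  "enstrophy t = integral (box_cell L) (\<lambda>x. frob2 (sym_part (A t x)))"

text \<open>The two densities differ by the null Lagrangian \<open>minors2\<close>. The form with
  the full gradient is the one that difference quotients of the velocity approximate.\<close>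

lemma enstrophy_eq:
  assumes t: "t \<in> I"
  shows "enstrophy t = integral (box_cell L) (\<lambda>x. frob2 (A t x)) / 2"
proof -
  note c = C1_field_continuous(2)[OF v[OF t]]
  have i: "(\<lambda>x. frob2 (A t x)) integrable_on box_cell L" "(\<lambda>x. minors2 (A t x)) integrable_on box_cell L"
    unfolding minors2_def by (intro continuous_integrable_cell continuous_on_frob2 continuous_intros c)+
  have "(\<lambda>x. frob2 (sym_part (A t x))) = (\<lambda>x. (1/2) * frob2 (A t x) - minors2 (A t x))"
    using matrix_identity_quadratic[OF div[OF t]] by (simp add: frob2_def sym_part_def fun_eq_iff)
  then have "enstrophy t = integral (box_cell L) (\<lambda>x. (1/2) * frob2 (A t x)) - integral (box_cell L) (\<lambda>x. minors2 (A t x))"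
    unfolding enstrophy_def using i by (simp only: integral_diff integrable_on_mult_right)
  then show ?thesis using integral_minors2[OF v[OF t] per[OF t] L] by simp
qed

definition quot :: "3 \<Rightarrow> real \<Rightarrow> real \<Rightarrow> real^3 \<Rightarrow> real^3" where
  "quot i h t x = (\<chi> j. grad_quot (\<lambda>x. A t x $ j) (axis i 1) h x)"

lemma quot_0: "quot i 0 t x = A t x *v axis i 1"
  by (simp add: quot_def vec_eq_iff matrix_vector_mul_component)

lemma quot_eq:
  assumes "t \<in> I"
  shows "h *\<^sub>R quot i h t x = v t (x + h *\<^sub>R axis i 1) - v t x"
proof -
  have "has_gradient (\<lambda>x. v t x $ j) (\<lambda>x. A t x $ j)" for j
    using v[OF assms] by (simp add: C1_field_def)
  from grad_quot[OF this] show ?thesis by (simp add: quot_def vec_eq_iff)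
qed

lemma continuous_on_quot:
  assumes "continuous_on S \<tau>" "\<tau> ` S \<subseteq> I" "continuous_on S \<eta>" "continuous_on S \<xi>"
  shows "continuous_on S (\<lambda>z. quot i (\<eta> z) (\<tau> z) (\<xi> z))"
proof -
  have "continuous_on (I \<times> UNIV) (\<lambda>(t, x). A t x $ j)" for j
    using continuous_on_component[OF cont(2), of j] by (simp add: case_prod_beta)
  then show ?thesis unfolding quot_def
    by (intro continuous_on_vec_lambda continuous_on_grad_quot[where K = I and G = "\<lambda>t x. A t x $ _"] assms)
qed

definition quot_energy :: "real \<Rightarrow> real \<Rightarrow> real" where
  "quot_energy h t = integral (box_cell L) (\<lambda>x. \<Sum>i\<in>UNIV. (quot i h t x \<bullet> quot i h t x) / 2)"

definition quot_rate :: "real \<Rightarrow> real \<Rightarrow> real" where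
  "quot_rate h t = - integral (box_cell L) (\<lambda>x. \<Sum>i\<in>UNIV. quot i h t x \<bullet> (A t x *v quot i h t x))"

text \<open>\<open>increment_energy\<close> divided by the square of h and summed over the three
  axes.\<close>

lemma quot_energy_derivative:
  assumes t: "t \<in> I" and h: "h \<noteq> 0"
  shows "(quot_energy h has_vector_derivative quot_rate h t) (at t within I)"
proof -
  define \<delta> where "\<delta> i t x = v t (x + h *\<^sub>R axis i 1) - v t x" for i t x
  have q: "quot i h s x = (1/h) *\<^sub>R \<delta> i s x" if "s \<in> I" for i s x
    using quot_eq[OF that, of h i x] h by (simp add: \<delta>_def flip: \<open>h *\<^sub>R quot i h s x = _\<close>)
  have c\<delta>: "continuous_on UNIV (\<delta> i s)" if "s \<in> I" for i s
    unfolding \<delta>_def using C1_field_continuous(1)[OF v[OF that]]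
    by (intro continuous_intros continuous_on_shift[of "v s"])
  have e: "quot_energy h s = (\<Sum>i\<in>UNIV. (1/h\<^sup>2) * integral (box_cell L) (\<lambda>x. (\<delta> i s x \<bullet> \<delta> i s x) / 2))" if "s \<in> I" for s
  proof -
    have "(\<lambda>x. (1/h\<^sup>2) * ((\<delta> i s x \<bullet> \<delta> i s x) / 2)) integrable_on box_cell L" for i
      by (intro continuous_integrable_cell continuous_intros c\<delta> that) simp
    then have "(\<Sum>i\<in>UNIV. integral (box_cell L) (\<lambda>x. (1/h\<^sup>2) * ((\<delta> i s x \<bullet> \<delta> i s x) / 2)))
       = integral (box_cell L) (\<lambda>x. \<Sum>i\<in>UNIV. (1/h\<^sup>2) * ((\<delta> i s x \<bullet> \<delta> i s x) / 2))"
      by (simp only: integral_sum finite)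
    also have "\<dots> = quot_energy h s"
      unfolding quot_energy_def q[OF that] by (simp add: power2_eq_square)
    finally show ?thesis by (simp only: integral_mult_right)
  qed
  have r: "quot_rate h t = (\<Sum>i\<in>UNIV. (1/h\<^sup>2) * - integral (box_cell L) (\<lambda>x. \<delta> i t x \<bullet> (A t x *v \<delta> i t x)))"
  proof -
    have "(\<lambda>x. (1/h\<^sup>2) * (\<delta> i t x \<bullet> (A t x *v \<delta> i t x))) integrable_on box_cell L" for i
      by (intro continuous_integrable_cell continuous_intros continuous_on_matrix_vector_mult c\<delta> t C1_field_continuous(2)[OF v[OF t]])
    then have "(\<Sum>i\<in>UNIV. integral (box_cell L) (\<lambda>x. (1/h\<^sup>2) * (\<delta> i t x \<bullet> (A t x *v \<delta> i t x))))
       = integral (box_cell L) (\<lambda>x. \<Sum>i\<in>UNIV. (1/h\<^sup>2) * (\<delta> i t x \<bullet> (A t x *v \<delta> i t x)))"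
      by (simp only: integral_sum finite)
    also have "\<dots> = - quot_rate h t"
      unfolding quot_rate_def q[OF t] by (simp add: power2_eq_square matrix_vector_mult_scaleR)
    finally show ?thesis by (simp only: integral_mult_right mult_minus_right sum_negf minus_equation_iff)
  qed
  have "((\<lambda>s. \<Sum>i\<in>UNIV. (1/h\<^sup>2) * integral (box_cell L) (\<lambda>x. (\<delta> i s x \<bullet> \<delta> i s x) / 2)) has_vector_derivative
     (\<Sum>i\<in>UNIV. (1/h\<^sup>2) * - integral (box_cell L) (\<lambda>x. \<delta> i t x \<bullet> (A t x *v \<delta> i t x)))) (at t within I)"
    unfolding \<delta>_def by (intro has_vector_derivative_sum has_vector_derivative_mult_right increment_energy t)
  from has_vector_derivative_transform[OF t e this] show ?thesis unfolding r .
qed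

lemma cell_param_time:
  fixes F :: "real \<Rightarrow> real \<Rightarrow> real^3 \<Rightarrow> real"
  assumes "continuous_on (X \<times> UNIV) (\<lambda>z. F (fst (fst z)) (snd (fst z)) (snd z))"
  shows "continuous_on X (\<lambda>z. integral (box_cell L) (F (fst z) (snd z)))"
  unfolding box_cell_def
  by (rule integral_continuous_on_param) (use assms in \<open>auto simp: case_prod_beta intro: continuous_on_subset\<close>)

lemma continuous_on_quot_energy: "continuous_on (UNIV \<times> I) (\<lambda>z. quot_energy (fst z) (snd z))"
  unfolding quot_energy_def
  by (rule cell_param_time) (intro continuous_intros continuous_on_quot; auto)

lemma continuous_on_quot_rate: "continuous_on (UNIV \<times> I) (\<lambda>z. quot_rate (fst z) (snd z))"
  unfolding quot_rate_def
  by (intro continuous_on_minus, rule cell_param_time)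
    (intro continuous_intros continuous_on_quot continuous_on_matrix_vector_mult cont_comp; auto)

text \<open>The differential identity is known for nonzero h only. Integrated over time, both sides
  are continuous in h, so it persists at h = 0.\<close>

lemma quot_energy_increment:
  assumes "a \<in> I" "b \<in> I" "a \<le> b"
  shows "quot_energy 0 b - quot_energy 0 a = integral {a..b} (quot_rate 0)"
proof (rule continuous_eq_at_0[where F = "\<lambda>h. quot_energy h b - quot_energy h a" and G = "\<lambda>h. integral {a..b} (quot_rate h)"])
  have sub: "{a..b} \<subseteq> I"
    using closed_segment_subset[OF assms(1,2) I] assms(3) by (simp add: closed_segment_eq_real_ivl)
  have c: "continuous_on {0..1} (\<lambda>h. quot_energy h t)" if "t \<in> I" for t
  proof -
    have "continuous_on {0..1} (\<lambda>h::real. (h, t))" by (intro continuous_intros)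
    from continuous_on_compose2[OF continuous_on_quot_energy this] that show ?thesis by auto
  qed
  show "continuous_on {0..1} (\<lambda>h. quot_energy h b - quot_energy h a)"
    by (intro continuous_intros c assms)
  show "continuous_on {0..1} (\<lambda>h. integral {a..b} (quot_rate h))"
    unfolding box_real[symmetric]
  proof (rule integral_continuous_on_param)
    show "continuous_on (cbox 0 1 \<times> cbox a b) (\<lambda>(h, t). quot_rate h t)"
      using continuous_on_subset[OF continuous_on_quot_rate, of "cbox 0 1 \<times> cbox a b"] sub by (auto simp: case_prod_beta)
  qed
  fix h :: real assume "0 < h" "h \<le> 1"
  then have "(quot_energy h has_vector_derivative quot_rate h t) (at t within {a..b})" if "t \<in> {a..b}" for t
    using that sub by (intro has_vector_derivative_within_subset[OF quot_energy_derivative]) auto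
  then have "(quot_rate h has_integral quot_energy h b - quot_energy h a) {a..b}"
    by (rule fundamental_theorem_of_calculus[OF assms(3)])
  then show "quot_energy h b - quot_energy h a = integral {a..b} (quot_rate h)"
    by (simp add: integral_unique)
qed

lemma enstrophy_quot: "t \<in> I \<Longrightarrow> quot_energy 0 t = enstrophy t"
proof -
  assume t: "t \<in> I"
  have m: "quot i 0 t x $ j = A t x $ j $ i" for i j x
    by (simp add: quot_0 matrix_vector_mul_component inner_axis)
  have "(\<Sum>i\<in>UNIV. (quot i 0 t x \<bullet> quot i 0 t x) / 2) = (1/2) * frob2 (A t x)" for x
    by (simp add: m inner_vec_def frob2_def sum_3 power2_eq_square) (simp add: field_simps)
  then have "quot_energy 0 t = integral (box_cell L) (\<lambda>x. (1/2) * frob2 (A t x))"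
    unfolding quot_energy_def by (simp only:)
  then show ?thesis unfolding enstrophy_eq[OF t] by simp
qed

lemma quot_rate_det: 
  assumes t: "t \<in> I" 
  shows "quot_rate 0 t = - 4 * integral (box_cell L) (\<lambda>x. det (sym_part (A t x)))"
proof -
  note c = C1_field_continuous(2)[OF v[OF t]]
  have i: "(\<lambda>x. det (sym_part (A t x))) integrable_on box_cell L" "(\<lambda>x. det (A t x)) integrable_on box_cell L"
    by (intro continuous_integrable_cell continuous_on_det3 continuous_on_sym_part c)+
  have "(\<lambda>x. \<Sum>i\<in>UNIV. quot i 0 t x \<bullet> (A t x *v quot i 0 t x)) = (\<lambda>x. 4 * det (sym_part (A t x)) - det (A t x))"
    unfolding quot_0 sym_part_def by (rule ext, rule matrix_identity_cubic[OF div[OF t]])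
  then have "quot_rate 0 t = - (integral (box_cell L) (\<lambda>x. 4 * det (sym_part (A t x))) - integral (box_cell L) (\<lambda>x. det (A t x)))"
    unfolding quot_rate_def using i by (simp only: integral_diff integrable_on_mult_right)
  then show ?thesis using integral_det[OF v[OF t] per[OF t] L] by simp
qed

text \<open>The rate at step size 0 is continuous in time, so the integrated identity can be
  differentiated again.\<close>

lemma enstrophy_derivative:
  assumes "t \<in> {a..b}" "{a..b} \<subseteq> I"
  shows "(enstrophy has_vector_derivative - 4 * integral (box_cell L) (\<lambda>x. det (sym_part (A t x)))) (at t within {a..b})"
proof -
  have ab: "a \<in> I" "t \<in> I" using assms by auto
  have c: "continuous_on {a..b} (quot_rate 0)"
  proof -
    have "continuous_on {a..b} (\<lambda>t::real. (0::real, t))" by (intro continuous_intros)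
    from continuous_on_compose2[OF continuous_on_quot_rate this] assms(2) show ?thesis by auto
  qed
  have d: "((\<lambda>u. enstrophy a + integral {a..u} (quot_rate 0)) has_vector_derivative quot_rate 0 t) (at t within {a..b})"
    using has_vector_derivative_add[OF has_vector_derivative_const integral_has_vector_derivative[OF c assms(1)]] by simp
  have e: "enstrophy s = enstrophy a + integral {a..s} (quot_rate 0)" if "s \<in> {a..b}" for s
    using quot_energy_increment[of a s] enstrophy_quot ab(1) that assms(2) by (auto simp: subset_iff)
  from has_vector_derivative_transform[OF assms(1) e d] show ?thesis
    unfolding quot_rate_det[OF ab(2)] .
qed

end

section \<open>The Poincare inequality by averaging increments\<close>

lemma cell_swap:
  fixes f :: "'b::euclidean_space \<Rightarrow> real^3 \<Rightarrow> real"
  assumes "continuous_on UNIV (\<lambda>z. f (fst z) (snd z))"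
  shows "integral (box_cell L) (\<lambda>x. integral (cbox a b) (\<lambda>s. f s x)) = integral (cbox a b) (\<lambda>s. integral (box_cell L) (f s))"
proof -
  have "continuous_on UNIV (\<lambda>z::(real^3) \<times> 'b. (snd z, fst z))" by (intro continuous_intros)
  from continuous_on_compose2[OF assms this] have "continuous_on UNIV (\<lambda>(x, s). f s x)"
    by (simp add: case_prod_beta)
  then show ?thesis unfolding box_cell_def
    by (intro integral_swap_continuous) (rule continuous_on_subset, auto)
qed

text \<open>Cauchy-Schwarz on the unit interval, obtained by expanding the nonnegative integral of
  the squared deviation from the mean.\<close>

lemma square_integral_le:
  fixes f :: "real \<Rightarrow> real"
  assumes f: "continuous_on {0..1} f"
  shows "(integral {0..1} f)\<^sup>2 \<le> integral {0..1} (\<lambda>s. (f s)\<^sup>2)"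
proof -
  define c where "c = integral {0..1} f"
  have i: "f integrable_on {0..1}" "(\<lambda>s. (f s)\<^sup>2) integrable_on {0..1}"
    using f by (auto intro!: integrable_continuous_real continuous_intros)
  have "0 \<le> integral {0..1} (\<lambda>s. (f s - c)\<^sup>2)"
    by (rule integral_nonneg) (use f in \<open>auto intro!: integrable_continuous_real continuous_intros\<close>)
  also have "(\<lambda>s. (f s - c)\<^sup>2) = (\<lambda>s. (f s)\<^sup>2 - (2 * c) * f s + c\<^sup>2)"
    by (simp add: fun_eq_iff power2_eq_square algebra_simps)
  also have "integral {0..1} \<dots> = integral {0..1} (\<lambda>s. (f s)\<^sup>2) - (2 * c) * integral {0..1} f + c\<^sup>2"
  proof -
    have j: "(\<lambda>s. (2 * c) * f s) integrable_on {0..1}" by (rule integrable_on_mult_right[OF i(1)])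
    have k: "(\<lambda>s. c\<^sup>2) integrable_on {0..(1::real)}" by (rule integrable_const_ivl)
    show ?thesis
      unfolding integral_add[OF integrable_diff[OF i(2) j] k] integral_diff[OF i(2) j] by simp
  qed
  finally show ?thesis by (simp add: c_def power2_eq_square)
qed

lemma has_gradient_periodic:
  assumes "has_gradient f F" "box_periodic L f"
  shows "box_periodic L F"
  unfolding box_periodic_def
proof (intro allI)
  fix x i
  have "(\<lambda>x. f (x + L *\<^sub>R axis i 1)) = f" using assms(2) by (auto simp: box_periodic_def)
  then show "F (x + L *\<^sub>R axis i 1) = F x"
    using has_gradient_unique[OF has_gradient_shift[OF assms(1), of "L *\<^sub>R axis i 1"], of F x] assms(1) by simp
qed

text \<open>The increment is the average of the directional derivative along the segment from x to x
  + a. After squaring inside the average and exchanging integrals, translation invariance removes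
  the position on the segment.\<close>

lemma increment_le_gradient:
  assumes f: "has_gradient f F" "box_periodic L f" and L: "L > 0"
  shows "integral (box_cell L) (\<lambda>x. (f (x + a) - f x)\<^sup>2) \<le> (norm a)\<^sup>2 * integral (box_cell L) (\<lambda>x. F x \<bullet> F x)"
proof -
  note cF = has_gradientD(1)[OF f(1)]
  define G where "G s x = (F (x + s *\<^sub>R a) \<bullet> a)\<^sup>2" for s x
  have cFz: "continuous_on UNIV (\<lambda>z. F (snd z + fst z *\<^sub>R a))"
    by (rule continuous_on_compose2[OF cF]) (auto intro!: continuous_intros)
  have cFs: "continuous_on S (\<lambda>s. F (x + s *\<^sub>R a))" for x S
    by (rule continuous_on_compose2[OF cF]) (auto intro!: continuous_intros)
  have cG: "continuous_on UNIV (\<lambda>z. G (fst z) (snd z))"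
    unfolding G_def by (intro continuous_intros cFz)
  have p: "box_periodic L (\<lambda>x. (F x \<bullet> a)\<^sup>2)"
    using has_gradient_periodic[OF f] by (rule box_periodic_compose)
  have c: "continuous_on UNIV (\<lambda>x. (F x \<bullet> a)\<^sup>2)" by (intro continuous_intros cF)
  have "(f (x + a) - f x)\<^sup>2 \<le> integral {0..1} (\<lambda>s. G s x)" for x
  proof -
    have "f (x + a) - f x = integral {0..1} (\<lambda>s. F (x + s *\<^sub>R a) \<bullet> a)"
      using grad_quot[OF f(1), of x 1 a] by (simp add: grad_quot_def)
    then show ?thesis unfolding G_def by (simp only: square_integral_le[OF continuous_on_inner[OF cFs continuous_on_const]])
  qed
  moreover have "continuous_on UNIV (\<lambda>x. integral {0..1} (\<lambda>s. G s x))"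
  proof -
    have "continuous_on UNIV (\<lambda>z::(real^3) \<times> real. (snd z, fst z))" by (intro continuous_intros)
    from continuous_on_compose2[OF cG this] have "continuous_on UNIV (\<lambda>(x, s). G s x)"
      by (simp add: case_prod_beta)
    then show ?thesis unfolding box_real[symmetric]
      by (intro integral_continuous_on_param) (rule continuous_on_subset, auto)
  qed
  moreover have "continuous_on UNIV (\<lambda>x. (f (x + a) - f x)\<^sup>2)"
    by (intro continuous_intros continuous_on_shift[of f] has_gradient_continuous[OF f(1)])
  ultimately have "integral (box_cell L) (\<lambda>x. (f (x + a) - f x)\<^sup>2) \<le> integral (box_cell L) (\<lambda>x. integral {0..1} (\<lambda>s. G s x))"
    by (intro integral_le continuous_integrable_cell)
  also have "\<dots> = integral {0..1} (\<lambda>s. integral (box_cell L) (G s))"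
    using cell_swap[OF cG, of L 0 1] by simp
  also have "(\<lambda>s. integral (box_cell L) (G s)) = (\<lambda>s. integral (box_cell L) (\<lambda>x. (F x \<bullet> a)\<^sup>2))"
    unfolding G_def using cell_shift[OF c p L] by auto
  also have "integral {0..1} \<dots> = integral (box_cell L) (\<lambda>x. (F x \<bullet> a)\<^sup>2)" by simp
  also have "\<dots> \<le> integral (box_cell L) (\<lambda>x. (norm a)\<^sup>2 * (F x \<bullet> F x))"
  proof (rule integral_le)
    show "(F x \<bullet> a)\<^sup>2 \<le> (norm a)\<^sup>2 * (F x \<bullet> F x)" for x
      using Cauchy_Schwarz_ineq[of "F x" a] by (simp add: power2_norm_eq_inner mult.commute)
    show "(\<lambda>x. (F x \<bullet> a)\<^sup>2) integrable_on box_cell L" "(\<lambda>x. (norm a)\<^sup>2 * (F x \<bullet> F x)) integrable_on box_cell L"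
      by (intro continuous_integrable_cell continuous_intros cF)+
  qed
  finally show ?thesis by simp
qed

lemma increment_le_frob2:
  assumes w: "C1_field w B" "box_periodic L w" and L: "L > 0"
  shows "integral (box_cell L) (\<lambda>x. (w (x + a) - w x) \<bullet> (w (x + a) - w x)) \<le> (norm a)\<^sup>2 * integral (box_cell L) (\<lambda>x. frob2 (B x))"
proof -
  have g: "has_gradient (\<lambda>x. w x $ j) (\<lambda>x. B x $ j)" and p: "box_periodic L (\<lambda>x. w x $ j)" for j
    using w by (auto simp: C1_field_def box_periodic_def)
  have i1: "(\<lambda>x. (w (x + a) $ j - w x $ j)\<^sup>2) integrable_on box_cell L" for j
    by (intro continuous_integrable_cell continuous_intros continuous_on_shift[of "\<lambda>x. w x $ j"] has_gradient_continuous[OF g])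
  have i2: "(\<lambda>x. B x $ j \<bullet> B x $ j) integrable_on box_cell L" for j
    by (intro continuous_integrable_cell continuous_intros has_gradientD(1)[OF g])
  have "integral (box_cell L) (\<lambda>x. (w (x + a) - w x) \<bullet> (w (x + a) - w x))
      = (\<Sum>j\<in>UNIV. integral (box_cell L) (\<lambda>x. (w (x + a) $ j - w x $ j)\<^sup>2))"
    using i1 by (subst integral_sum[symmetric]) (auto simp: inner_vec_def power2_eq_square)
  also have "\<dots> \<le> (\<Sum>j\<in>UNIV. (norm a)\<^sup>2 * integral (box_cell L) (\<lambda>x. B x $ j \<bullet> B x $ j))"
    by (intro sum_mono increment_le_gradient g p L)
  also have "\<dots> = (norm a)\<^sup>2 * integral (box_cell L) (\<lambda>x. \<Sum>j\<in>UNIV. B x $ j \<bullet> B x $ j)"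
    using i2 by (simp add: sum_distrib_left integral_sum)
  also have "(\<lambda>x. \<Sum>j\<in>UNIV. B x $ j \<bullet> B x $ j) = (\<lambda>x. frob2 (B x))"
    by (simp add: frob2_def inner_vec_def power2_eq_square)
  finally show ?thesis .
qed

text \<open>The statistical variance of w over the cell, multiplied by the squared volume. It is
  composed of energy and momentum, hence conserved by the flow.\<close>

definition variance :: "real \<Rightarrow> (real^3 \<Rightarrow> real^3) \<Rightarrow> real" where
  "variance L w = box_volume L * integral (box_cell L) (\<lambda>x. w x \<bullet> w x) - integral (box_cell L) w \<bullet> integral (box_cell L) w"

text \<open>The two-point formula for the variance: translation invariance makes both square terms
  the energy, and exchanging the integrals turns the mixed term into the squared momentum.\<close>

lemma variance_eq_increments:
  assumes w: "continuous_on UNIV w" "box_periodic L w" and L: "L > 0"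
  shows "integral (box_cell L) (\<lambda>a. integral (box_cell L) (\<lambda>x. (w (x + a) - w x) \<bullet> (w (x + a) - w x))) = 2 * variance L w"
proof -
  define E where "E = integral (box_cell L) (\<lambda>x. w x \<bullet> w x)"
  define M where "M = integral (box_cell L) w"
  have cw: "continuous_on UNIV (\<lambda>z. w (snd z + fst z))"
    by (rule continuous_on_compose2[OF w(1)]) (auto intro!: continuous_intros)
  have cw2: "continuous_on UNIV (\<lambda>z::(real^3) \<times> (real^3). w (snd z))"
    by (rule continuous_on_compose2[OF w(1)]) (auto intro!: continuous_intros)
  have sh: "continuous_on UNIV (\<lambda>x. w (x + a))" for a by (rule continuous_on_shift[OF w(1)])
  define P where "P a = integral (box_cell L) (\<lambda>x. w (x + a) \<bullet> w x)" for a
  have exp: "integral (box_cell L) (\<lambda>x. (w (x + a) - w x) \<bullet> (w (x + a) - w x)) = 2 * E - 2 * P a" for a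
  proof -
    have i: "(\<lambda>x. w (x + a) \<bullet> w (x + a)) integrable_on box_cell L" "(\<lambda>x. w x \<bullet> w x) integrable_on box_cell L"
      "(\<lambda>x. w (x + a) \<bullet> w x) integrable_on box_cell L"
      by (intro continuous_integrable_cell continuous_intros sh w(1))+
    have "(\<lambda>x. (w (x + a) - w x) \<bullet> (w (x + a) - w x)) = (\<lambda>x. w (x + a) \<bullet> w (x + a) + w x \<bullet> w x - 2 * (w (x + a) \<bullet> w x))"
      by (simp add: fun_eq_iff inner_diff_left inner_diff_right inner_commute)
    then have "integral (box_cell L) (\<lambda>x. (w (x + a) - w x) \<bullet> (w (x + a) - w x))
        = integral (box_cell L) (\<lambda>x. w (x + a) \<bullet> w (x + a)) + E - 2 * P a"
      unfolding E_def P_def using i by (simp add: integral_add integral_diff integrable_add integrable_on_mult_right)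
    also have "integral (box_cell L) (\<lambda>x. w (x + a) \<bullet> w (x + a)) = E"
      unfolding E_def
      by (rule cell_shift[OF _ _ L, where f = "\<lambda>x. w x \<bullet> w x"])
        (intro continuous_intros w(1), use w(2) in \<open>simp add: box_periodic_def\<close>)
    finally show ?thesis by simp
  qed
  have cP: "continuous_on UNIV (\<lambda>z. w (snd z + fst z) \<bullet> w (snd z))" by (intro continuous_intros cw cw2)
  have Pc: "continuous_on UNIV P" unfolding P_def box_cell_def
    by (rule integral_continuous_on_param) (use cP in \<open>auto simp: case_prod_beta intro: continuous_on_subset\<close>)
  have "integral (box_cell L) P = integral (box_cell L) (\<lambda>x. integral (box_cell L) (\<lambda>a. w (x + a) \<bullet> w x))"
    unfolding P_def using cell_swap[where f = "\<lambda>a x. w (x + a) \<bullet> w x" and L = L and a = 0 and b = "vec L :: real^3"] cP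
    by (simp add: box_cell_def)
  also have "(\<lambda>x. integral (box_cell L) (\<lambda>a. w (x + a) \<bullet> w x)) = (\<lambda>x. M \<bullet> w x)"
  proof
    fix x
    have "integral (box_cell L) (\<lambda>a. w (a + x) \<bullet> w x) = integral (box_cell L) (\<lambda>a. w (a + x)) \<bullet> w x"
      using sh by simp
    then show "integral (box_cell L) (\<lambda>a. w (x + a) \<bullet> w x) = M \<bullet> w x"
      using cell_shift[OF w L, of x] by (simp add: add.commute M_def)
  qed
  also have "integral (box_cell L) (\<lambda>x. M \<bullet> w x) = M \<bullet> M"
    using integral_component_eq[OF continuous_integrable_cell[OF w(1)], of L M] by (simp add: inner_commute M_def)
  finally have P: "integral (box_cell L) P = M \<bullet> M" .
  have "integral (box_cell L) (\<lambda>a. 2 * E - 2 * P a) = box_volume L * (2 * E) - 2 * (M \<bullet> M)"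
    using continuous_integrable_cell[OF Pc] continuous_integrable_cell[OF continuous_on_const] P
      integral_cell_const[OF L, of "2 * E"]
    by (simp add: integral_diff integrable_on_mult_right)
  then show ?thesis unfolding exp by (simp add: variance_def E_def M_def algebra_simps)
qed

lemma continuous_on_increments:
  fixes w :: "real^3 \<Rightarrow> real^3"
  assumes "continuous_on UNIV w"
  shows "continuous_on UNIV (\<lambda>a. integral (box_cell L) (\<lambda>x. (w (x + a) - w x) \<bullet> (w (x + a) - w x)))"
proof -
  have cw: "continuous_on UNIV (\<lambda>z. w (snd z + fst z))"
    by (rule continuous_on_compose2[OF assms]) (auto intro!: continuous_intros)
  have cw2: "continuous_on UNIV (\<lambda>z::(real^3) \<times> (real^3). w (snd z))"
    by (rule continuous_on_compose2[OF assms]) (auto intro!: continuous_intros)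
  have "continuous_on UNIV (\<lambda>z. (w (snd z + fst z) - w (snd z)) \<bullet> (w (snd z + fst z) - w (snd z)))"
    by (intro continuous_intros cw cw2)
  then show ?thesis unfolding box_cell_def
    by (intro integral_continuous_on_param) (auto simp: case_prod_beta intro: continuous_on_subset)
qed

text \<open>\<open>increment_le_frob2\<close> is averaged over all shifts a in the cell, where |a|^2
  is at most 3 L^2.\<close>

lemma poincare:
  assumes w: "C1_field w B" "box_periodic L w" and L: "L > 0"
  shows "2 * variance L w \<le> box_volume L * (3 * L\<^sup>2) * integral (box_cell L) (\<lambda>x. frob2 (B x))"
proof -
  note c = C1_field_continuous[OF w(1)]
  define F where "F = integral (box_cell L) (\<lambda>x. frob2 (B x))"
  have F: "F \<ge> 0" unfolding F_def
    by (intro integral_nonneg continuous_integrable_cell continuous_on_frob2 c) (simp add: frob2_def sum_nonneg)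
  have "2 * variance L w = integral (box_cell L) (\<lambda>a. integral (box_cell L) (\<lambda>x. (w (x + a) - w x) \<bullet> (w (x + a) - w x)))"
    by (rule variance_eq_increments[OF c(1) w(2) L, symmetric])
  also have "\<dots> \<le> integral (box_cell L) (\<lambda>_::real^3. 3 * L\<^sup>2 * F)"
  proof (rule integral_le)
    show "(\<lambda>a. integral (box_cell L) (\<lambda>x. (w (x + a) - w x) \<bullet> (w (x + a) - w x))) integrable_on box_cell L"
      by (rule continuous_integrable_cell[OF continuous_on_increments[OF c(1)]])
    show "(\<lambda>_::real^3. 3 * L\<^sup>2 * F) integrable_on box_cell L" by (rule continuous_integrable_cell) simp
    fix a :: "real^3" assume a: "a \<in> box_cell L"
    have "(norm a)\<^sup>2 = (a$1)\<^sup>2 + (a$2)\<^sup>2 + (a$3)\<^sup>2"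
      unfolding power2_norm_eq_inner by (simp add: inner_vec_def sum_3 power2_eq_square)
    moreover have "(a$i)\<^sup>2 \<le> L\<^sup>2" for i
      using a by (intro power_mono) (auto simp: box_cell_def mem_box_cart)
    ultimately have "(norm a)\<^sup>2 \<le> 3 * L\<^sup>2" by (smt (verit))
    then have "(norm a)\<^sup>2 * F \<le> 3 * L\<^sup>2 * F" using F by (rule mult_right_mono)
    then show "integral (box_cell L) (\<lambda>x. (w (x + a) - w x) \<bullet> (w (x + a) - w x)) \<le> 3 * L\<^sup>2 * F"
      using increment_le_frob2[OF w L, of a] by (simp add: F_def)
  qed
  also have "\<dots> = box_volume L * (3 * L\<^sup>2) * F" by (simp only: integral_cell_const[OF L] real_scaleR_def mult.assoc)
  finally show ?thesis by (simp add: F_def)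
qed

text \<open>By the two-point formula, vanishing variance would annihilate all increments; w would be
  constant and its gradient zero everywhere.\<close>

lemma variance_pos:
  assumes w: "C1_field w B" "box_periodic L w" and L: "L > 0" and B: "B x0 \<noteq> 0"
  shows "variance L w > 0"
proof (rule ccontr)
  assume n: "\<not> variance L w > 0"
  note c = C1_field_continuous[OF w(1)]
  define \<Phi> where "\<Phi> a = integral (box_cell L) (\<lambda>x. (w (x + a) - w x) \<bullet> (w (x + a) - w x))" for a
  have cd: "continuous_on UNIV (\<lambda>x. w (x + a) - w x)" for a
    by (intro continuous_intros continuous_on_shift[of w] c)
  have \<Phi>0: "\<Phi> a \<ge> 0" for a unfolding \<Phi>_def
    by (intro integral_nonneg continuous_integrable_cell continuous_intros cd) simp
  have c\<Phi>: "continuous_on UNIV \<Phi>" unfolding \<Phi>_def by (rule continuous_on_increments[OF c(1)])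
  have "integral (box_cell L) \<Phi> = 2 * variance L w"
    unfolding \<Phi>_def by (rule variance_eq_increments[OF c(1) w(2) L])
  moreover have "integral (box_cell L) \<Phi> \<ge> 0" using \<Phi>0 c\<Phi> by (intro integral_nonneg) auto
  ultimately have "(\<Phi> has_integral 0) (cbox 0 (vec L))"
    using n integrable_integral[OF continuous_integrable_cell[OF c\<Phi>, of L]] by (simp add: box_cell_def)
  moreover have "box 0 (vec L :: real^3) \<noteq> {}" using L by (simp add: interval_ne_empty_cart)
  ultimately have "\<Phi> a = 0" if "a \<in> box_cell L" for a
    using has_integral_0_cbox_imp_0[of 0 "vec L" \<Phi> a] c\<Phi> \<Phi>0 that
    by (auto simp: box_cell_def intro: continuous_on_subset)
  then have \<Phi>z: "\<Phi> a = 0" if "a \<in> box_cell L" for a using that by blast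
  have z: "norm (w (x + a) - w x) = 0" if a: "a \<in> box_cell L" for a x
  proof (rule cell_square_integral_0[OF _ _ L, where u = "\<lambda>x. norm (w (x + a) - w x)"])
    show "continuous_on UNIV (\<lambda>x. norm (w (x + a) - w x))" by (rule continuous_on_norm[OF cd])
    show "box_periodic L (\<lambda>x. norm (w (x + a) - w x))"
      by (rule box_periodic_compose2[OF box_periodic_shift[OF w(2)] w(2), where F = "\<lambda>p q. norm (p - q)"])
    show "integral (box_cell L) (\<lambda>x. (norm (w (x + a) - w x))\<^sup>2) = 0"
      using \<Phi>z[OF a] by (simp only: \<Phi>_def power2_norm_eq_inner)
  qed
  have "w x = w 0" for x
  proof -
    obtain y n where y: "y \<in> box_cell L" "\<And>i. y $ i = x $ i + of_int (n i) * L"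
      using cell_reduce[OF L] by metis
    show ?thesis using z[OF y(1), of 0] box_periodic_shift_lattice[OF w(2) y(2)] by simp
  qed
  then have "w = (\<lambda>_. w 0)" by (rule ext)
  have "B x0 $ i = 0" for i
  proof -
    have "(\<lambda>x. w x $ i) = (\<lambda>_. w 0 $ i)" using \<open>w = (\<lambda>_. w 0)\<close> by (rule arg_cong[of _ _ "\<lambda>f x. f x $ i"])
    then have 1: "has_gradient (\<lambda>_. w 0 $ i) (\<lambda>x. B x $ i)"
      using w(1) unfolding C1_field_def by metis
    have 2: "has_gradient (\<lambda>_. w 0 $ i) (\<lambda>_. 0)"
      by (rule has_gradientI[where D = "\<lambda>_ _. 0"]) (auto intro!: derivative_eq_intros)
    show ?thesis by (rule has_gradient_unique[OF 1 2])
  qed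
  then show False using B by (simp add: vec_eq_iff)
qed

text \<open>The tangent to the cubic as a function of \<open>s\<^sup>2\<close>. Integrated with \<open>r\<close> the root mean square of \<open>s\<close>,
  it gives Jensen's inequality.\<close>

lemma cubic_tangent:
  fixes r s :: real
  assumes "r \<ge> 0" "s \<ge> 0"
  shows "s ^ 3 \<ge> 3/2 * r * s\<^sup>2 - r ^ 3 / 2"
proof -
  have "s ^ 3 - (3/2 * r * s\<^sup>2 - r ^ 3 / 2) = (s - r)\<^sup>2 * (s + r / 2)"
    by (simp add: power2_eq_square power3_eq_cube field_simps)
  moreover have "\<dots> \<ge> 0" using assms by simp
  ultimately show ?thesis by linarith
qed

text \<open>a and b stand for \<lambda> and |\<lambda>2|; the trace condition gives the third
  eigenvalue the modulus a + b, and F is the squared norm of S. From e a \<le> b the product is at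
  least e a^3, and F \<le> 6 a^2 with the tangent at r replaces a^3 by an expression linear in F,
  which can be integrated.\<close>

lemma eigenvalue_product_bound:
  fixes a b e r F :: real
  assumes b: "0 \<le> b" "b \<le> a" and e: "0 \<le> e" "e \<le> b / a" and r: "r \<ge> 0"
    and F: "F = a\<^sup>2 + b\<^sup>2 + (a + b)\<^sup>2"
  shows "e * (r / 4 * F - r ^ 3 / 2) \<le> a * b * (a + b)"
proof -
  have a: "a \<ge> 0" using b by linarith
  \<comment> \<open>For \<open>a = 0\<close> the quotient is 0 by convention, but then b vanishes as
    well.\<close>
  have eb: "e * a \<le> b"
  proof (cases "a = 0")
    case False
    then show ?thesis using e(2) a by (simp add: field_simps)
  qed (use b in auto)
  have "F = 2 * a\<^sup>2 + 2 * (b * (a + b))" unfolding F by (simp add: power2_eq_square algebra_simps)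
  moreover have "b * (a + b) \<le> a * (a + a)" using b a by (intro mult_mono) auto
  ultimately have "F \<le> 6 * a\<^sup>2" by (simp add: power2_eq_square)
  then have "r / 4 * F \<le> r / 4 * (6 * a\<^sup>2)" using r by (intro mult_left_mono) auto
  then have "r / 4 * F - r ^ 3 / 2 \<le> a ^ 3" using cubic_tangent[OF r a] by (simp add: field_simps)
  then have "e * (r / 4 * F - r ^ 3 / 2) \<le> e * a ^ 3" using e(1) by (rule mult_left_mono)
  also have "\<dots> = (e * a) * a * a" by (simp add: power3_eq_cube)
  also have "\<dots> \<le> b * a * a" using eb a by (intro mult_right_mono) auto
  also have "\<dots> \<le> b * a * (a + b)" using a b by (intro mult_left_mono) auto
  finally show ?thesis by (simp add: mult.commute)
qed

text \<open>The function y^(-1/2) decreases at rate at least c/2 and stays positive, so c t / 2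
  cannot exceed its initial value.\<close>

lemma riccati_growth_bound:
  fixes y y' :: "real \<Rightarrow> real"
  assumes t: "t > 0" and d: "\<And>s. s \<in> {0..t} \<Longrightarrow> (y has_vector_derivative y' s) (at s within {0..t})"
    and r: "\<And>s. s \<in> {0<..<t} \<Longrightarrow> y' s \<ge> c * (y s * sqrt (y s))"
    and y0: "y 0 > 0" and nn: "\<And>s. s \<in> {0..t} \<Longrightarrow> y s \<ge> 0" and c: "c \<ge> 0"
  shows "c * t \<le> 2 / sqrt (y 0)"
proof -
  \<comment> \<open>Monotonicity comes first because the reciprocal square root needs y > 0 on the
    whole interval, while only y \<ge> 0 is assumed there.\<close>
  have mono: "y s \<ge> y 0" if s: "s \<in> {0..t}" for s
  proof (cases "s = 0")
    case False
    have "\<exists>x\<in>{0<..<s}. y s - y 0 = (s - 0) * y' x"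
    proof -
      have "\<exists>x\<in>{0<..<s}. y s - y 0 = (\<lambda>h. h * y' x) (s - 0)"
      proof (rule mvt_simple)
        show "0 < s" using s False by auto
        fix x assume "0 \<le> x" "x \<le> s"
        then show "(y has_derivative (\<lambda>h. h * y' x)) (at x within {0..s})"
          using has_vector_derivative_within_subset[OF d[of x], of "{0..s}"] s
          by (auto simp: has_vector_derivative_def)
      qed
      then show ?thesis by simp
    qed
    then obtain x where x: "x \<in> {0<..<s}" "y s - y 0 = (s - 0) * y' x" by blast
    have "0 \<le> c * (y x * sqrt (y x))" using c nn[of x] x(1) s by auto
    also have "\<dots> \<le> y' x" using r[of x] x(1) s by auto
    finally have "0 \<le> y' x" .
    then have "0 \<le> s * y' x" using s by simp
    then show ?thesis using x(2) by simp
  qed simp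
  have pos: "y s > 0" if "s \<in> {0..t}" for s using mono[OF that] y0 by linarith
  define z where "z s = 1 / sqrt (y s)" for s
  define z' where "z' s = - y' s / (2 * (y s * sqrt (y s)))" for s
  have dz: "(z has_derivative (\<lambda>h. h * z' s)) (at s within {0..t})" if s: "s \<in> {0..t}" for s
  proof -
    have "(y has_field_derivative y' s) (at s within {0..t})"
      using d[OF s] by (simp add: has_real_derivative_iff_has_vector_derivative)
    then have "(z has_field_derivative z' s) (at s within {0..t})"
      unfolding z_def z'_def using pos[OF s]
      by (auto intro!: derivative_eq_intros simp: field_simps)
    moreover have "(\<lambda>h. h * z' s) = (*) (z' s)" by (simp add: fun_eq_iff)
    ultimately show ?thesis by (simp only: has_field_derivative_def)
  qed
  have "\<exists>x\<in>{0<..<t}. z t - z 0 = (\<lambda>h. h * z' x) (t - 0)"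
    by (rule mvt_simple[OF t]) (use dz in auto)
  then obtain x where x: "x \<in> {0<..<t}" "z t - z 0 = t * z' x" by auto
  have "c * (y x * sqrt (y x)) \<le> y' x" using r[OF x(1)] .
  moreover have p: "y x * sqrt (y x) > 0" using pos[of x] x(1) by auto
  ultimately have "c / 2 \<le> - z' x" unfolding z'_def by (simp add: field_simps)
  then have "t * (c / 2) \<le> t * (- z' x)" using t by (intro mult_left_mono) auto
  also have "\<dots> = z 0 - z t" using x(2) by simp
  also have "\<dots> \<le> z 0" using pos[of t] t by (simp add: z_def)
  finally show ?thesis by (simp add: z_def mult.commute)
qed

text \<open>With y \<ge> k the loss per unit time is at least c k^(3/2), and the total loss cannot
  exceed y 0. One application of the mean value theorem suffices.\<close>

lemma decay_bound:
  fixes y y' :: "real \<Rightarrow> real"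
  assumes t: "t > 0" and d: "\<And>s. s \<in> {0..t} \<Longrightarrow> (y has_vector_derivative y' s) (at s within {0..t})"
    and r: "\<And>s. s \<in> {0<..<t} \<Longrightarrow> y' s \<le> - (c * (y s * sqrt (y s)))"
    and y: "\<And>s. s \<in> {0..t} \<Longrightarrow> y s \<ge> k" and k: "k > 0" and c: "c \<ge> 0"
  shows "c * t \<le> y 0 / (k * sqrt k)"
proof -
  have "\<exists>x\<in>{0<..<t}. y t - y 0 = (\<lambda>h. h * y' x) (t - 0)"
    by (rule mvt_simple[OF t]) (use d in \<open>auto simp: has_vector_derivative_def\<close>)
  then obtain x where x: "x \<in> {0<..<t}" "y t - y 0 = t * y' x" by auto
  have yx: "y x \<ge> k" using y[of x] x(1) by auto
  have "k * sqrt k \<le> y x * sqrt (y x)" using yx k by (intro mult_mono) auto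
  then have "c * (k * sqrt k) \<le> c * (y x * sqrt (y x))" using c by (rule mult_left_mono)
  also have "\<dots> \<le> - y' x" using r[OF x(1)] by simp
  finally have "t * (c * (k * sqrt k)) \<le> t * (- y' x)" using t by (intro mult_left_mono) auto
  also have "\<dots> = y 0 - y t" using x(2) by simp
  also have "\<dots> \<le> y 0" using y[of t] k t by auto
  finally have "(c * t) * (k * sqrt k) \<le> y 0" by (simp add: mult_ac)
  then show ?thesis using k by (simp add: pos_le_divide_eq)
qed

section \<open>Differential inequality and lower bound for the enstrophy\<close>

lemma euler_flow_solution:
  assumes L: "L > 0" and m: "m \<ge> 3" and e: "euler_solution m L v0 T v"
  obtains p g where "euler_flow L (time_interval T) v (\<lambda>t x. jacobian (v t) (at x)) p g"
proof -
  let ?I = "time_interval T"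
  obtain p g where pg: "\<And>t. t \<in> ?I \<Longrightarrow> box_periodic L (p t)" "\<And>t x. t \<in> ?I \<Longrightarrow> GDERIV (p t) x :> g t x"
        "continuous_on (?I \<times> UNIV) (\<lambda>(t, x). g t x)"
        "\<And>t x. t \<in> ?I \<Longrightarrow> ((\<lambda>s. v s x) has_vector_derivative - (jacobian (v t) (at x) *v v t x) - g t x)
             (at t within ?I)"
    and v: "\<And>t. t \<in> ?I \<Longrightarrow> v t \<in> sobolev_solenoidal m L"
    and lim: "\<And>t. t \<in> ?I \<Longrightarrow> ((\<lambda>s. sobolev_norm m L (\<lambda>x. v s x - v t x)) \<longlongrightarrow> 0) (at t within ?I)"
    using e unfolding euler_solution_def by blast
  have cv: "continuous_on (?I \<times> UNIV) (\<lambda>(t, x). v t x)"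
  proof -
    have "continuous_on (?I \<times> UNIV) (\<lambda>z. v (fst z) (snd z) $ i)" for i
      using sobolev_time_continuous(1)[OF L m v lim, where i = i] by (simp add: case_prod_beta)
    then have "continuous_on (?I \<times> UNIV) (\<lambda>z. \<chi> i. v (fst z) (snd z) $ i)" by (rule continuous_on_vec_lambda)
    then show ?thesis by (simp add: case_prod_beta)
  qed
  have cA: "continuous_on (?I \<times> UNIV) (\<lambda>(t, x). jacobian (v t) (at x))"
  proof -
    have "continuous_on (?I \<times> UNIV) (\<lambda>z. jacobian (v (fst z)) (at (snd z)) $ i)" for i
      using sobolev_time_continuous(2)[OF L m v lim, where i = i] by (simp add: case_prod_beta)
    then have "continuous_on (?I \<times> UNIV) (\<lambda>z. \<chi> i. jacobian (v (fst z)) (at (snd z)) $ i)" by (rule continuous_on_vec_lambda)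
    then show ?thesis by (simp add: case_prod_beta)
  qed
  have cg: "continuous_on UNIV (g t)" if "t \<in> ?I" for t
  proof -
    have "continuous_on UNIV (\<lambda>x::real^3. (t, x))" by (intro continuous_intros)
    from continuous_on_compose2[OF pg(3) this] that show ?thesis by auto
  qed
  have conv: "convex ?I"
    unfolding convex_contains_segment
  proof (intro ballI subsetI)
    fix a b x assume ab: "a \<in> ?I" "b \<in> ?I" "x \<in> closed_segment a b"
    then have "0 \<le> x" "x \<le> max a b" by (auto simp: closed_segment_eq_real_ivl time_interval_def split: if_splits)
    moreover have "ereal (max a b) < T" using ab by (auto simp: time_interval_def max_def)
    ultimately show "x \<in> ?I" using ereal_le_less_trans by (auto simp: time_interval_def)
  qed
  have "euler_flow L ?I v (\<lambda>t x. jacobian (v t) (at x)) p g"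
  proof
    show "has_gradient (p t) (g t)" if "t \<in> ?I" for t
    proof (rule has_gradientI[OF cg[OF that]])
      show "(p t has_derivative (\<lambda>h. h \<bullet> g t x)) (at x)" for x
        using pg(2)[OF that, of x] by (simp add: gderiv_def)
    qed (rule inner_commute)
    show "box_periodic L (v t)" "trace (jacobian (v t) (at x)) = 0" if "t \<in> ?I" for t x
      using sobolev_solenoidalD(2,4)[OF v[OF that]] by auto
  qed (use L conv cv cA pg v in \<open>auto intro: sobolev_solenoidal_C1[OF _ L m]\<close>)
  then show ?thesis by (rule that)
qed

context euler_flow
begin

definition det_integral :: "real \<Rightarrow> real" where
  "det_integral t = integral (box_cell L) (\<lambda>x. det (sym_part (A t x)))"

lemma enstrophy_nonneg: "t \<in> I \<Longrightarrow> enstrophy t \<ge> 0"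
  unfolding enstrophy_def
  by (intro integral_nonneg continuous_integrable_cell continuous_on_frob2 continuous_on_sym_part C1_field_continuous(2)[OF v])
    (auto simp: frob2_def intro!: sum_nonneg)

lemma sym_part_eigenvalues:
  assumes "t \<in> I"
  defines "l \<equiv> \<lambda>x. ordered_eigenvalues (sym_part (A t x))"
  shows "l x $ 1 \<ge> l x $ 2" "l x $ 2 \<ge> l x $ 3" "l x $ 1 + l x $ 2 + l x $ 3 = 0"
    "l x $ 1 * l x $ 2 * l x $ 3 = det (sym_part (A t x))"
    "(l x $ 1)\<^sup>2 + (l x $ 2)\<^sup>2 + (l x $ 3)\<^sup>2 = frob2 (sym_part (A t x))"
proof -
  have s: "transpose (sym_part (A t x)) = sym_part (A t x)"
    by (simp add: sym_part_def transpose_def vec_eq_iff)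
  have "trace (sym_part (A t x)) = trace (A t x)" by (simp add: sym_part_def trace_def transpose_def)
  then have "trace (sym_part (A t x)) = 0" using div[OF assms(1)] by simp
  with ordered_eigenvalues_symmetric[OF s]
  show "l x $ 1 \<ge> l x $ 2" "l x $ 2 \<ge> l x $ 3" "l x $ 1 + l x $ 2 + l x $ 3 = 0"
    "l x $ 1 * l x $ 2 * l x $ 3 = det (sym_part (A t x))"
    "(l x $ 1)\<^sup>2 + (l x $ 2)\<^sup>2 + (l x $ 3)\<^sup>2 = frob2 (sym_part (A t x))"
    by (auto simp: l_def frob2_def)
qed

text \<open>The pointwise hypothesis holds for every tangent parameter r; integrating it at the best
  r amounts to Jensen's inequality for the power 3/2. The sign \<sigma> lets one estimate serve both
  growth and decay.\<close>

lemma enstrophy_rate_bound: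
  assumes t: "t \<in> I" and e: "e \<ge> 0" and \<sigma>: "\<sigma> = 1 \<or> \<sigma> = (-1::real)"
    and b: "\<And>x r. r \<ge> 0 \<Longrightarrow> e * (r / 4 * frob2 (sym_part (A t x)) - r ^ 3 / 2) \<le> \<sigma> * det (sym_part (A t x))"
  shows "2 / (3 * sqrt (6 * box_volume L)) * e * (enstrophy t * sqrt (enstrophy t)) \<le> 4 * (\<sigma> * det_integral t)"
proof -
  define V where "V = box_volume L"
  have V: "V > 0" using L by (simp add: V_def box_volume)
  define Y where "Y = enstrophy t"
  have Y: "Y \<ge> 0" using enstrophy_nonneg[OF t] by (simp add: Y_def)
  \<comment> \<open>This r maximises \<open>r / 4 * Y - V * (r ^ 3 / 2)\<close>. The value is r Y /
    6, and four times it, with r written out, yields the constant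
    \<open>2 / (3 * sqrt (6 * V))\<close>.\<close>
  define r where "r = sqrt (Y / (6 * V))"
  have r: "r \<ge> 0" "r\<^sup>2 = Y / (6 * V)" using Y V by (auto simp: r_def)
  note c = C1_field_continuous(2)[OF v[OF t]]
  have i: "(\<lambda>x. frob2 (sym_part (A t x))) integrable_on box_cell L" "(\<lambda>x. det (sym_part (A t x))) integrable_on box_cell L"
    by (intro continuous_integrable_cell continuous_on_det3 continuous_on_frob2 continuous_on_sym_part c)+
  have j: "(\<lambda>x::real^3. r ^ 3 / 2) integrable_on box_cell L" by (rule continuous_integrable_cell) simp
  have k: "(\<lambda>x. r / 4 * frob2 (sym_part (A t x))) integrable_on box_cell L"
    by (rule integrable_on_mult_right[OF i(1)])
  have le: "integral (box_cell L) (\<lambda>x. e * (r / 4 * frob2 (sym_part (A t x)) - r ^ 3 / 2))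
     \<le> integral (box_cell L) (\<lambda>x. \<sigma> * det (sym_part (A t x)))"
    by (intro integral_le b r(1) integrable_on_mult_right integrable_diff k j i)
  have eq: "integral (box_cell L) (\<lambda>x. e * (r / 4 * frob2 (sym_part (A t x)) - r ^ 3 / 2))
     = e * (r / 4 * Y - V * (r ^ 3 / 2))"
    unfolding integral_mult_right integral_diff[OF k j] integral_cell_const[OF L]
    by (simp add: Y_def enstrophy_def V_def)
  have main: "e * (r / 4 * Y - V * (r ^ 3 / 2)) \<le> \<sigma> * det_integral t"
    using le unfolding eq unfolding integral_mult_right det_integral_def .
  have "V * (r ^ 3 / 2) = r * Y / 12"
  proof -
    have "r ^ 3 = r * (Y / (6 * V))" using r(2) by (simp add: power3_eq_cube power2_eq_square)
    then show ?thesis using V by simp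
  qed
  then have "e * (r / 4 * Y - V * (r ^ 3 / 2)) = e * (r * Y / 6)" by (simp add: field_simps)
  moreover have "r = sqrt Y / sqrt (6 * V)" by (simp add: r_def real_sqrt_divide)
  ultimately have "4 * (e * (r / 4 * Y - V * (r ^ 3 / 2))) = 2 / (3 * sqrt (6 * V)) * e * (Y * sqrt Y)"
    by simp
  then show ?thesis using main unfolding Y_def V_def by linarith
qed

lemma conserved_variance:
  assumes "s \<in> I" "t \<in> I"
  shows "variance L (v s) = variance L (v t)"
proof -
  obtain c1 where c1: "\<forall>s\<in>I. integral (box_cell L) (\<lambda>x. (v s x \<bullet> v s x) / 2) = c1"
    using has_derivative_zero_constant[OF I, of "\<lambda>s. integral (box_cell L) (\<lambda>x. (v s x \<bullet> v s x) / 2)"]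
      energy_derivative unfolding has_vector_derivative_def by auto
  obtain c2 where c2: "\<forall>s\<in>I. integral (box_cell L) (v s) = c2"
    using has_derivative_zero_constant[OF I, of "\<lambda>s. integral (box_cell L) (v s)"]
      momentum_derivative unfolding has_vector_derivative_def by auto
  have "integral (box_cell L) (\<lambda>x. v s x \<bullet> v s x) = 2 * c1" if "s \<in> I" for s
    using c1 that by simp
  then show ?thesis using assms c2 by (simp add: variance_def)
qed

lemma enstrophy_lower_bound:
  assumes "s \<in> I" "t \<in> I"
  shows "enstrophy t \<ge> variance L (v s) / (box_volume L * (3 * L\<^sup>2))"
proof -
  have V: "box_volume L * (3 * L\<^sup>2) > 0" using L by (simp add: box_volume)
  \<comment> \<open>The factor 2 of the two-point formula cancels against the one between the
    integrals of |A|^2 and |S|^2.\<close>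
  have "2 * variance L (v t) \<le> box_volume L * (3 * L\<^sup>2) * (2 * enstrophy t)"
    using poincare[OF v[OF assms(2)] per[OF assms(2)] L] by (simp add: enstrophy_eq[OF assms(2)])
  then have "variance L (v s) \<le> enstrophy t * (box_volume L * (3 * L\<^sup>2))"
    using conserved_variance[OF assms] by (simp add: mult_ac)
  then show ?thesis using V by (simp add: pos_divide_le_eq)
qed

end

section \<open>The time bound\<close>

lemma sign_time_le_max_time: "sign_time m L v0 \<le> max_time m L v0"
proof (cases "sign_change_times m L v0 = {}")
  case False
  then obtain t where t: "t \<in> sign_change_times m L v0" by blast
  have "sign_time m L v0 \<le> ereal t"
    using False t by (auto simp: sign_time_def intro: Inf_lower)
  also have "\<dots> \<le> max_time m L v0" using t by (simp add: sign_change_times_def less_imp_le)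
  finally show ?thesis .
qed (simp add: sign_time_def)

lemma not_sign_change_time:
  assumes "ereal s < sign_time m L v0"
  shows "s \<notin> sign_change_times m L v0"
proof
  assume s: "s \<in> sign_change_times m L v0"
  then have "sign_time m L v0 \<le> ereal s" by (auto simp: sign_time_def intro: Inf_lower)
  with assms show False by simp
qed

lemma eps_time_bound:
  assumes m: "m \<ge> 3" and L: "L > 0" and v0: "v0 \<in> A_plus m L \<union> A_minus m L"
  shows "\<exists>K\<ge>0. \<forall>t. 0 < t \<and> ereal t < sign_time m L v0 \<longrightarrow>
     (INF (x, s) \<in> UNIV \<times> {0<..<t}. eps_ratio m L v0 x s) \<le> 1 \<and>
     (INF (x, s) \<in> UNIV \<times> {0<..<t}. eps_ratio m L v0 x s) * t \<le> K"
proof (cases "max_time m L v0 > 0")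
  case False
  \<comment> \<open>Without a positive lifespan no admissible t exists, and the bound is
    vacuous.\<close>
  have "\<not> (0 < t \<and> ereal t < sign_time m L v0)" for t
  proof
    assume "0 < t \<and> ereal t < sign_time m L v0"
    then have "0 < ereal t" "ereal t < max_time m L v0"
      using sign_time_le_max_time[of m L v0] by auto
    then show False using False by (meson less_trans)
  qed
  then show ?thesis by auto
next
  case True
  define T where "T = max_time m L v0"
  define I where "I = time_interval T"
  obtain v where e: "euler_solution m L v0 T v" and sol: "\<And>t. t \<in> I \<Longrightarrow> sol_op m L t v0 = v t"
    using sol_op_eq[OF True] unfolding T_def I_def by metis
  obtain p g where "euler_flow L I v (\<lambda>t x. jacobian (v t) (at x)) p g"
    using euler_flow_solution[OF L m e] unfolding I_def by metis
  then interpret euler_flow L I v "\<lambda>t x. jacobian (v t) (at x)" p g .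
  define P where "P \<longleftrightarrow> v0 \<in> A_plus m L"
  define Y where "Y = enstrophy"
  define l where "l t x = ordered_eigenvalues (sym_part (jacobian (v t) (at x)))" for t x
  have eig: "eig i (v t) x = l t x $ i" for i t x
    by (simp add: eig_def l_def deformation_def sym_part_def)
  have I0: "0 \<in> I" using True by (simp add: I_def T_def time_interval_def zero_ereal_def)
  have v_0: "v 0 = v0" using e by (simp add: euler_solution_def)
  note l = sym_part_eigenvalues[folded l_def]
  define V where "V = box_volume L"
  have V: "V > 0" using L by (simp add: V_def box_volume)
  define \<kappa> where "\<kappa> = 2 / (3 * sqrt (6 * V))"
  have \<kappa>: "\<kappa> > 0" using V by (simp add: \<kappa>_def)
  \<comment> \<open>A middle eigenvalue vanishing identically would have infimum and supremum 0,
    which both admissible classes exclude.\<close>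
  have nz: "\<exists>x. l 0 x $ 2 \<noteq> 0"
  proof (rule ccontr)
    assume "\<not> ?thesis"
    then have "eig 2 v0 = (\<lambda>x. 0)" using eig[of 2 0] v_0 by auto
    then show False using v0 by (auto simp: A_plus_def A_minus_def)
  qed
  have S0: "\<exists>x. frob2 (sym_part (jacobian (v 0) (at x))) \<noteq> 0"
  proof -
    obtain x where "l 0 x $ 2 \<noteq> 0" using nz by blast
    then have "(l 0 x $ 1)\<^sup>2 + (l 0 x $ 2)\<^sup>2 + (l 0 x $ 3)\<^sup>2 > 0"
      by (simp add: add_pos_nonneg add_nonneg_pos)
    then show ?thesis using l(5)[OF I0, of x] by (intro exI[of _ x]) simp
  qed
  \<comment> \<open>Zero enstrophy would force the continuous periodic strain to vanish everywhere,
    against \<open>S0\<close>.\<close>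
  have Y0: "Y 0 > 0"
  proof (rule ccontr)
    assume "\<not> Y 0 > 0"
    then have z: "Y 0 = 0" using enstrophy_nonneg[OF I0] by (simp add: Y_def)
    define u where "u x = sqrt (frob2 (sym_part (jacobian (v 0) (at x))))" for x
    have fn: "frob2 M \<ge> 0" for M by (simp add: frob2_def sum_nonneg)
    have cu: "continuous_on UNIV u" unfolding u_def
      by (intro continuous_on_real_sqrt continuous_on_frob2 continuous_on_sym_part C1_field_continuous(2)[OF v[OF I0]])
    have gp: "box_periodic L (\<lambda>x. jacobian (v 0) (at x) $ i)" for i
      using v[OF I0] per[OF I0] unfolding C1_field_def
      by (intro has_gradient_periodic[where f = "\<lambda>x. v 0 x $ i"]) (auto simp: box_periodic_def)
    have "box_periodic L (\<lambda>x. jacobian (v 0) (at x))"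
      using gp unfolding box_periodic_def by (simp add: vec_eq_iff[of "jacobian _ _"])
    then have pu: "box_periodic L u" unfolding u_def by (rule box_periodic_compose)
    have "u x = 0" for x
      by (rule cell_square_integral_0[OF cu pu L]) (use z fn in \<open>simp add: u_def Y_def enstrophy_def\<close>)
    then show False using S0 by (simp add: u_def)
  qed
  define k where "k = variance L v0 / (V * (3 * L\<^sup>2))"
  have k: "k > 0"
  proof -
    obtain x where "frob2 (sym_part (jacobian (v 0) (at x))) \<noteq> 0" using S0 by blast
    then have "jacobian (v 0) (at x) \<noteq> 0" by (auto simp: frob2_def sym_part_def transpose_def)
    then have "variance L (v 0) > 0" by (rule variance_pos[OF v[OF I0] per[OF I0] L])
    then show ?thesis using V L by (simp add: k_def v_0)
  qed
  have Yk: "Y t \<ge> k" if "t \<in> I" for t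
    using enstrophy_lower_bound[OF I0 that] by (simp add: Y_def k_def V_def v_0)
  \<comment> \<open>The two entries are the bounds of \<open>riccati_growth_bound\<close> and
    \<open>decay_bound\<close>; all quantities depend on the initial field and the box only.\<close>
  define K where "K = max (2 / sqrt (Y 0)) (Y 0 / (k * sqrt k)) / \<kappa>"
  have K: "K \<ge> 0" using Y0 k \<kappa> by (simp add: K_def le_max_iff_disj)
  show ?thesis
  proof (intro exI[of _ K] conjI K allI impI)
    fix t assume t: "0 < t \<and> ereal t < sign_time m L v0"
    define A where "A = (UNIV :: (real^3) set) \<times> {0<..<t}"
    define E where "E = (INF (x, s) \<in> A. eps_ratio m L v0 x s)"
    have ne: "A \<noteq> {}" using t by (auto simp: A_def)
    have sub: "{0..t} \<subseteq> I"
    proof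
      fix s assume s: "s \<in> {0..t}"
      have "ereal t < T" using t sign_time_le_max_time[of m L v0] by (auto simp: T_def)
      then show "s \<in> I" using s ereal_le_less_trans[of s t T] by (simp add: I_def time_interval_def)
    qed
    \<comment> \<open>Only weak signs are available: before \<open>sign_time\<close> the middle
      eigenvalue may touch 0 without crossing it.\<close>
    have sign: "if P then l s x $ 2 \<ge> 0 else l s x $ 2 \<le> 0" if s: "s \<in> {0<..<t}" for s x
    proof -
      have sI: "s \<in> I" using s sub by auto
      have "ereal s < sign_time m L v0" using s t ereal_le_less_trans[of s t] by auto
      then have "s \<notin> sign_change_times m L v0" by (rule not_sign_change_time)
      moreover have "ereal s < max_time m L v0" using sI by (simp add: I_def T_def time_interval_def)
      ultimately show ?thesis
        using s sol[OF sI] unfolding sign_change_times_def P_def by (auto simp: not_less eig)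
    qed
    \<comment> \<open>In either case b and a are the moduli of the two eigenvalues of equal weak
      sign, and the remaining one has modulus a + b because the trace vanishes.\<close>
    define b where "b s x = \<bar>l s x $ 2\<bar>" for s x
    define a where "a s x = (if P then l s x $ 1 else - l s x $ 3)" for s x
    have eps: "eps_ratio m L v0 x s = b s x / a s x" if "s \<in> I" for s x
      using sol[OF that] by (simp add: eps_ratio_def lambda_main_def P_def a_def b_def eig)
    have ab: "0 \<le> b s x" "b s x \<le> a s x"
      "frob2 (sym_part (jacobian (v s) (at x))) = (a s x)\<^sup>2 + (b s x)\<^sup>2 + (a s x + b s x)\<^sup>2"
      "a s x * b s x * (a s x + b s x) = (if P then -1 else 1) * det (sym_part (jacobian (v s) (at x)))"
      if s: "s \<in> {0<..<t}" for s x
    proof -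
      have sI: "s \<in> I" using s sub by auto
      note ls = l[OF sI, of x]
      show "0 \<le> b s x" by (simp add: b_def)
      have "b s x \<le> a s x \<and>
        (l s x $ 1)\<^sup>2 + (l s x $ 2)\<^sup>2 + (l s x $ 3)\<^sup>2 = (a s x)\<^sup>2 + (b s x)\<^sup>2 + (a s x + b s x)\<^sup>2 \<and>
        a s x * b s x * (a s x + b s x) = (if P then -1 else 1) * (l s x $ 1 * l s x $ 2 * l s x $ 3)"
      proof (cases P)
        case True
        then have l2: "l s x $ 2 \<ge> 0" using sign[OF s, of x] by simp
        have b: "b s x = l s x $ 2" using l2 by (simp add: b_def)
        have a: "a s x = l s x $ 1" using True by (simp add: a_def)
        have c: "l s x $ 3 = - (a s x + b s x)" using ls(3) a b by linarith
        show ?thesis using ls(1) True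
          unfolding c a[symmetric] b[symmetric]
          by (simp only: power2_minus mult_minus_right mult_minus_left minus_minus if_True mult_1 simp_thms)
      next
        case False
        then have l2: "l s x $ 2 \<le> 0" using sign[OF s, of x] by simp
        have b: "l s x $ 2 = - b s x" using l2 by (simp add: b_def)
        have a: "l s x $ 3 = - a s x" using False by (simp add: a_def)
        have c: "l s x $ 1 = a s x + b s x" using ls(3) a b by linarith
        have "b s x \<le> a s x" using ls(2) a b by linarith
        then show ?thesis using False unfolding c a b by (simp add: power2_eq_square mult_ac add_ac)
      qed
      then show "b s x \<le> a s x"
        "frob2 (sym_part (jacobian (v s) (at x))) = (a s x)\<^sup>2 + (b s x)\<^sup>2 + (a s x + b s x)\<^sup>2"
        "a s x * b s x * (a s x + b s x) = (if P then -1 else 1) * det (sym_part (jacobian (v s) (at x)))"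
        unfolding ls(4) ls(5) by blast+
    qed
    have eps01: "0 \<le> eps_ratio m L v0 x s \<and> eps_ratio m L v0 x s \<le> 1" if s: "s \<in> {0<..<t}" for s x
    proof -
      have "s \<in> I" using s sub by auto
      then show ?thesis using ab(1,2)[OF s, of x] by (auto simp: eps divide_le_eq_1)
    qed
    \<comment> \<open>For real-valued families the infimum is a genuine lower bound only once
      boundedness below is known.\<close>
    have bdd: "bdd_below ((\<lambda>(x, s). eps_ratio m L v0 x s) ` A)"
      using eps01 by (intro bdd_belowI[of _ 0]) (auto simp: A_def)
    have E0: "E \<ge> 0" unfolding E_def using eps01 ne by (intro cINF_greatest) (auto simp: A_def)
    have El: "E \<le> eps_ratio m L v0 x s" if "s \<in> {0<..<t}" for x s
      unfolding E_def using cINF_lower[OF bdd, of "(x, s)"] that by (simp add: A_def)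
    have "E \<le> 1" using El[of "t/2" undefined] eps01[of "t/2" undefined] t by auto
    moreover have "E * t \<le> K"
    proof -
      \<comment> \<open>With this sign \<open>\<sigma> * det\<close> is the nonnegative product a b
        (a + b) in both cases, since the determinant of S is nonpositive in the first and
        nonnegative in the second.\<close>
      define \<sigma> :: real where "\<sigma> = (if P then -1 else 1)"
      have rate: "\<kappa> * E * (Y s * sqrt (Y s)) \<le> 4 * (\<sigma> * det_integral s)" if s: "s \<in> {0<..<t}" for s
        unfolding \<kappa>_def V_def Y_def
      proof (rule enstrophy_rate_bound)
        show sI: "s \<in> I" using s sub by auto
        show "E \<ge> 0" by (rule E0)
        show "\<sigma> = 1 \<or> \<sigma> = -1" by (simp add: \<sigma>_def)
        show "E * (r / 4 * frob2 (sym_part (jacobian (v s) (at x))) - r ^ 3 / 2) \<le> \<sigma> * det (sym_part (jacobian (v s) (at x)))"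
          if r: "r \<ge> 0" for x r
          using eigenvalue_product_bound[OF ab(1,2)[OF s] E0 _ r ab(3)[OF s], of x] El[OF s, of x] ab(4)[OF s, of x]
          by (simp add: eps[OF sI] \<sigma>_def)
      qed
      have d: "(Y has_vector_derivative - 4 * det_integral s) (at s within {0..t})" if "s \<in> {0..t}" for s
        unfolding Y_def det_integral_def by (rule enstrophy_derivative[OF that sub])
      have c: "\<kappa> * E \<ge> 0" using \<kappa> E0 by simp
      have "\<kappa> * E * t \<le> max (2 / sqrt (Y 0)) (Y 0 / (k * sqrt k))"
      proof (cases P)
        case True
        have "\<kappa> * E * t \<le> 2 / sqrt (Y 0)"
        proof (rule riccati_growth_bound[OF _ d _ Y0 _ c])
          show "\<kappa> * E * (Y s * sqrt (Y s)) \<le> - 4 * det_integral s" if "s \<in> {0<..<t}" for s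
            using rate[OF that] True by (simp add: \<sigma>_def)
          show "0 \<le> Y s" if "s \<in> {0..t}" for s using enstrophy_nonneg sub that by (auto simp: Y_def)
        qed (use t in auto)
        then show ?thesis by simp
      next
        case False
        have "\<kappa> * E * t \<le> Y 0 / (k * sqrt k)"
        proof (rule decay_bound[OF _ d _ _ k c])
          show "- 4 * det_integral s \<le> - (\<kappa> * E * (Y s * sqrt (Y s)))" if "s \<in> {0<..<t}" for s
            using rate[OF that] False by (simp add: \<sigma>_def)
          show "k \<le> Y s" if "s \<in> {0..t}" for s using Yk sub that by auto
        qed (use t in auto)
        then show ?thesis by simp
      qed
      then have "(E * t) * \<kappa> \<le> max (2 / sqrt (Y 0)) (Y 0 / (k * sqrt k))" by (simp add: mult_ac)
      then show ?thesis unfolding K_def using \<kappa> by (simp only: pos_le_divide_eq)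
    qed
    ultimately show "(INF (x, s) \<in> UNIV \<times> {0<..<t}. eps_ratio m L v0 x s) \<le> 1"
      "(INF (x, s) \<in> UNIV \<times> {0<..<t}. eps_ratio m L v0 x s) * t \<le> K"
      unfolding E_def A_def by auto
  qed
qed

lemma eps_sqrt_bound:
  assumes m: "m \<ge> 3" and L: "L > 0" and v0: "v0 \<in> A_plus m L \<union> A_minus m L"
  shows "\<exists>c. \<forall>t. 0 < t \<and> ereal t < sign_time m L v0 \<longrightarrow>
     (INF (x, s) \<in> UNIV \<times> {0<..<t}. eps_ratio m L v0 x s) < c / sqrt t"
proof -
  obtain K where K: "K \<ge> 0" "\<And>t. 0 < t \<Longrightarrow> ereal t < sign_time m L v0 \<Longrightarrow>
     (INF (x, s) \<in> UNIV \<times> {0<..<t}. eps_ratio m L v0 x s) \<le> 1 \<and>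
     (INF (x, s) \<in> UNIV \<times> {0<..<t}. eps_ratio m L v0 x s) * t \<le> K"
    using eps_time_bound[OF assms] by blast
  \<comment> \<open>The summand 1 makes the inequality strict.\<close>
  have "(INF (x, s) \<in> UNIV \<times> {0<..<t}. eps_ratio m L v0 x s) < (sqrt K + 1) / sqrt t"
    if t: "0 < t" "ereal t < sign_time m L v0" for t
  proof -
    define E where "E = (INF (x, s) \<in> UNIV \<times> {0<..<t}. eps_ratio m L v0 x s)"
    have E: "E \<le> 1" "E * t \<le> K" using K(2)[OF t] by (auto simp: E_def)
    have "E * sqrt t \<le> sqrt K"
    proof (cases "E \<le> 0")
      case True
      then have "E * sqrt t \<le> 0" using t(1) by (simp add: mult_le_0_iff)
      also have "0 \<le> sqrt K" using K(1) by simp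
      finally show ?thesis .
    next
      case False
      have "(E * sqrt t)\<^sup>2 = E * (E * t)" using t(1) by (simp add: power_mult_distrib power2_eq_square)
      also have "\<dots> \<le> 1 * (E * t)" using E(1) False t(1) by (intro mult_right_mono) auto
      also have "\<dots> \<le> K" using E(2) by simp
      finally show ?thesis by (rule real_le_rsqrt)
    qed
    then show ?thesis using t(1) unfolding E_def[symmetric] by (simp add: pos_less_divide_eq)
  qed
  then show ?thesis by blast
qed

theorem theorem3p2:
  fixes m :: nat
  assumes "real m > 5 / 2"
  shows "\<exists>C :: (real^3 \<Rightarrow> real^3) \<Rightarrow> real \<Rightarrow> real.
    \<forall>L > 0. \<forall>v0 \<in> A_plus m L \<union> A_minus m L.
      \<forall>t. 0 < t \<and> ereal t < sign_time m L v0 \<longrightarrow>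
        (INF (x, s) \<in> UNIV \<times> {0<..<t}. eps_ratio m L v0 x s) < C v0 (box_volume L) / sqrt t"
proof -
  have m: "m \<ge> 3" using assms by linarith
  define B where "B v0 L c \<longleftrightarrow> (\<forall>t. 0 < t \<and> ereal t < sign_time m L v0 \<longrightarrow>
     (INF (x, s) \<in> UNIV \<times> {0<..<t}. eps_ratio m L v0 x s) < c / sqrt t)" for v0 L c
  \<comment> \<open>The constant may depend on the box through its volume only; since the volume is
    L^3, the cube root recovers the side.\<close>
  define C where "C v0 V = (SOME c. B v0 (root 3 V) c)" for v0 V
  have "B v0 L (C v0 (box_volume L))" if "L > 0" "v0 \<in> A_plus m L \<union> A_minus m L" for L v0
  proof -
    have "root 3 (box_volume L) = L" using that(1) by (simp add: box_volume real_root_power_cancel)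
    moreover have "\<exists>c. B v0 L c" unfolding B_def by (rule eps_sqrt_bound[OF m that])
    ultimately show ?thesis unfolding C_def by (metis someI_ex)
  qed
  then show ?thesis unfolding B_def by (intro exI[of _ C]) blast
qed

end
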